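(* Let $\rho\in(0,1]$ and let $(\mathscr{C}^\rho_x)_{x\ge 0}$ be the non-decreasing càdlàg process defined in the context. Then $(\mathscr{C}^\rho_x)_{x\ge 0}$ consists of pure jumps, and its jump times accumulate at $0$ but are otherwise discrete. That is, almost surely: for all $0<a<b<\infty$ the process has only finitely many jump times in $[a,b]$ and is constant on each interval of $(0,\infty)$ containing no jump time; and every neighbourhood of $0$ contains infinitely many jump times.
   Context: **The process $\mathscr{C}^\rho$.** A Brownian motion with diffusion coefficient $\sigma$ has variance $\sigma^2 t$ after time $t$. Fix $0<\sigma_s\le\sigma_p<\infty$ with $\sigma_s/\sigma_p=\rho$. Let $k\in\{0,1,2,\dots\}$ and $0\le x_0\le x_1\le\dots\le x_k$. Let $(\mathscr{P}_x)_{x\le 0}$ be a backward Brownian motion with $\mathscr{P}_0=0$ and diffusion coefficient $\sigma_p$ (i.e. $(\mathscr{P}_{-t})_{t\ge 0}$ is such a Brownian motion). Let $(\mathscr{S}^i_x)_{x\ge -x_i}$, $i=0,\dots,k$, be Brownian motions with $\mathscr{S}^i_{-x_i}=0$ and diffusion coefficient $\sigma_s$, independent of each other and of $\mathscr{P}$. For $x\in[-x_i,0]$ let $$\tilde B^i_x=\mathscr{P}_x-\mathscr{P}_{-x_i}-\mathscr{S}^i_x,\qquad \tilde B^{+,i}_x=\tilde B^i_x-\inf\{\tilde B^i_s: s\in[-x_i,x]\}.$$ Let $B^{+,k}=\tilde B^{+,k}$ and, recursively for $i=k-1,k-2,\dots,0$, let $\tau_i=\inf\{x\in[-x_i,0]:\tilde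 B^{+,i}_x=B^{+,i+1}_x\}$ (with $\inf\emptyset=+\infty$), $B^{+,i}_x=\tilde B^{+,i}_x$ for $x\in[-x_i,0]$ with $x<\tau_i$, and $B^{+,i}_x=B^{+,i+1}_x$ for $x\in[-x_i,0]$ with $x\ge\tau_i$. The laws of the vectors $\left(\tfrac{1}{\sigma_p}B^{+,0}_0,\dots,\tfrac{1}{\sigma_p}B^{+,k}_0\right)$ are consistent and depend on $(\sigma_s,\sigma_p)$ only through $\rho$. $(\mathscr{C}^\rho_x)_{x\ge 0}$ is the non-decreasing càdlàg process such that $(\mathscr{C}^\rho_{x_0},\dots,\mathscr{C}^\rho_{x_k})$ has the same distribution as this vector, for all such $k$ and $x_0,\dots,x_k$. A jump time of $\mathscr{C}^\rho$ is a point $x>0$ with $\mathscr{C}^\rho_{x}\neq\lim_{y\to x^-}\mathscr{C}^\rho_y$. *)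

theory Defs
  imports "HOL-Probability.Probability"
begin

text \<open>Brownian motion on \<open>[0,\<infinity>)\<close> started at \<open>0\<close>, with variance \<open>\<sigma>\<^sup>2 t\<close> at time \<open>t\<close>.
  The second parameter of \<^const>\<open>normal_density\<close> is the standard deviation.
  Only the values \<open>W t\<close> with \<open>t \<ge> 0\<close> are relevant.\<close>

definition brownian_motion :: "'a measure \<Rightarrow> real \<Rightarrow> (real \<Rightarrow> 'a \<Rightarrow> real) \<Rightarrow> bool" where
  "brownian_motion M \<sigma> W \<longleftrightarrow>
     prob_space M \<and>
     (\<forall>t\<ge>0. W t \<in> borel_measurable M) \<and>
     (\<forall>\<omega>\<in>space M. W 0 \<omega> = 0 \<and> continuous_on {0..} (\<lambda>t. W t \<omega>)) \<and>
     (\<forall>s t. 0 \<le> s \<and> s < t \<longrightarrow>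
        distributed M lborel (\<lambda>\<omega>. W t \<omega> - W s \<omega>)
          (\<lambda>z. ennreal (normal_density 0 (\<sigma> * sqrt (t - s)) z))) \<and>
     (\<forall>(n::nat) t. 0 \<le> t 0 \<and> (\<forall>i<n. t i \<le> t (Suc i)) \<longrightarrow>
        prob_space.indep_vars M (\<lambda>_. borel) (\<lambda>i \<omega>. W (t (Suc i)) \<omega> - W (t i) \<omega>) {..<n})"

text \<open>The driving noises: \<open>P\<close> is indexed by \<open>(-\<infinity>,0]\<close> and \<open>S i\<close> by \<open>[-x i,\<infinity>)\<close>, for
  \<open>i \<le> k\<close>. Joint independence is stated for the processes as random elements of the product
  spaces over these index sets; the index \<open>None\<close> stands for \<open>P\<close>, and \<open>Some i\<close> for \<open>S i\<close>.\<close>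

definition driving_noise ::
  "'a measure \<Rightarrow> real \<Rightarrow> real \<Rightarrow> nat \<Rightarrow> (nat \<Rightarrow> real) \<Rightarrow>
     (real \<Rightarrow> 'a \<Rightarrow> real) \<Rightarrow> (nat \<Rightarrow> real \<Rightarrow> 'a \<Rightarrow> real) \<Rightarrow> bool" where
  "driving_noise M \<sigma>s \<sigma>p k x P S \<longleftrightarrow>
     brownian_motion M \<sigma>p (\<lambda>t. P (- t)) \<and>
     (\<forall>i\<le>k. brownian_motion M \<sigma>s (\<lambda>t. S i (- x i + t))) \<and>
     prob_space.indep_vars M
       (\<lambda>j. \<Pi>\<^sub>M y\<in>(case j of None \<Rightarrow> {..0} | Some i \<Rightarrow> {- x i..}). borel)
       (\<lambda>j \<omega>. case j of None \<Rightarrow> (\<lambda>y\<in>{..0}. P y \<omega>) | Some i \<Rightarrow> (\<lambda>y\<in>{- x i..}. S i y \<omega>))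
       (insert None (Some ` {..k}))"

text \<open>The following are functionals of single paths \<open>p\<close> of \<open>P\<close> and \<open>s i\<close> of \<open>S i\<close>.\<close>

definition B_tilde ::
  "(nat \<Rightarrow> real) \<Rightarrow> (real \<Rightarrow> real) \<Rightarrow> (nat \<Rightarrow> real \<Rightarrow> real) \<Rightarrow> nat \<Rightarrow> real \<Rightarrow> real" where
  "B_tilde x p s i y = p y - p (- x i) - s i y"

definition B_tilde_plus ::
  "(nat \<Rightarrow> real) \<Rightarrow> (real \<Rightarrow> real) \<Rightarrow> (nat \<Rightarrow> real \<Rightarrow> real) \<Rightarrow> nat \<Rightarrow> real \<Rightarrow> real" where
  "B_tilde_plus x p s i y = B_tilde x p s i y - (INF u\<in>{- x i..y}. B_tilde x p s i u)"

text \<open>The infimum is taken in \<^typ>\<open>ereal\<close>, so that it is \<open>\<infinity>\<close> if \<open>f\<close> and \<open>g\<close> never meet.\<close>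

definition meeting_time :: "real \<Rightarrow> (real \<Rightarrow> real) \<Rightarrow> (real \<Rightarrow> real) \<Rightarrow> ereal" where
  "meeting_time a f g = Inf (ereal ` {y\<in>{a..0}. f y = g y})"

text \<open>Downward recursion in \<open>i\<close>, starting from \<open>i = k\<close>; the clause for \<open>i > k\<close> is never used, and
  \<open>B_plus x p s k i\<close> is meaningful on \<open>[-x i,0]\<close> only.\<close>

function B_plus ::
  "(nat \<Rightarrow> real) \<Rightarrow> (real \<Rightarrow> real) \<Rightarrow> (nat \<Rightarrow> real \<Rightarrow> real) \<Rightarrow> nat \<Rightarrow> nat \<Rightarrow> real \<Rightarrow> real" where
  "B_plus x p s k i =
     (if k \<le> i then B_tilde_plus x p s k
      else (\<lambda>y. if ereal y < meeting_time (- x i) (B_tilde_plus x p s i) (B_plus x p s k (Suc i))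
                then B_tilde_plus x p s i y
                else B_plus x p s k (Suc i) y))"
  by pat_completeness auto
termination by (relation "Wellfounded.measure (\<lambda>(x, p, s, k, i). k - i)") auto

declare B_plus.simps [simp del]

text \<open>\<open>\<mu>\<close> is the law of the vector of end values at \<open>0\<close> of the paths \<open>B_plus\<close>, divided by
  \<open>\<sigma>p\<close>, for some choice of coefficients with ratio \<open>\<rho>\<close> and some realization of the noises. The law
  depends neither on the choice nor on the realization. Fixing the type of sample points is no
  restriction, as every realization can be transported to the space of paths
  \<^typ>\<open>nat option \<Rightarrow> real \<Rightarrow> real\<close>.\<close>

definition C_vector_law :: "real \<Rightarrow> nat \<Rightarrow> (nat \<Rightarrow> real) \<Rightarrow> (nat \<Rightarrow> real) measure \<Rightarrow> bool" where
  "C_vector_law \<rho> k x \<mu> \<longleftrightarrow>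
     (\<exists>\<sigma>s \<sigma>p (M :: (nat option \<Rightarrow> real \<Rightarrow> real) measure) P S.
        0 < \<sigma>s \<and> \<sigma>s \<le> \<sigma>p \<and> \<sigma>s / \<sigma>p = \<rho> \<and>
        driving_noise M \<sigma>s \<sigma>p k x P S \<and>
        \<mu> = distr M (\<Pi>\<^sub>M i\<in>{..k}. borel)
              (\<lambda>\<omega>. \<lambda>i\<in>{..k}. 1 / \<sigma>p * B_plus x (\<lambda>y. P y \<omega>) (\<lambda>j y. S j y \<omega>) k i 0))"

definition cadlag :: "(real \<Rightarrow> real) \<Rightarrow> bool" where
  "cadlag f \<longleftrightarrow>
     (\<forall>x\<ge>0. (f \<longlongrightarrow> f x) (at_right x)) \<and> (\<forall>x>0. \<exists>l. (f \<longlongrightarrow> l) (at_left x))"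

definition C_process :: "real \<Rightarrow> 'a measure \<Rightarrow> (real \<Rightarrow> 'a \<Rightarrow> real) \<Rightarrow> bool" where
  "C_process \<rho> N C \<longleftrightarrow>
     prob_space N \<and>
     (\<forall>x\<ge>0. C x \<in> borel_measurable N) \<and>
     (AE \<omega> in N. mono_on {0..} (\<lambda>x. C x \<omega>) \<and> cadlag (\<lambda>x. C x \<omega>)) \<and>
     (\<forall>k x. 0 \<le> x 0 \<and> (\<forall>i<k. x i \<le> x (Suc i)) \<longrightarrow>
        C_vector_law \<rho> k x (distr N (\<Pi>\<^sub>M i\<in>{..k}. borel) (\<lambda>\<omega>. \<lambda>i\<in>{..k}. C (x i) \<omega>)))"

definition jump_times :: "(real \<Rightarrow> real) \<Rightarrow> real set" where
  "jump_times f = {x. 0 < x \<and> f x \<noteq> Lim (at_left x) f}"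

end

(* Write Z_x for C^rho_x. The vector law for two points gives P(Z_{ih} ~= Z_{(i+1)h}) <= K/i with K
   depending on rho only. Summing over a dyadic grid of [2^-Q,2^Q), the expected number of changes of
   value is at most K 4^Q on every level, so by Fatou's lemma and right continuity Z has almost surely
   finite range on that interval, which for a non-decreasing cadlag path means finitely many jumps and
   constancy in between. Moreover Z_0 = 0 and Z_x > 0 for x > 0, so jumps accumulate at 0.

   For the two-point bound, discretise the two reflected paths X (started at -(i+1)h) and Y (started
   at -ih, with Y = 0 there) with Gaussian steps. Both are walks reflected at 0, with steps of variance
   v, driven by correlated noises; w is the difference of the steps and has variance u. Let phi_k(r) be
   the mean of such a walk after k steps from r. While X > Y, the difference phi_k(X) - phi_k(Y), with k
   the remaining number of steps, is a martingale, and X - Y is dominated by a walk with steps w, so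
   that survival for n more steps from difference d has probability at most 2d / sqrt(2 pi n u). Let m be
   the number of steps in (-(i+1)h,-ih] and 2n that in (-ih,0]. Using the second bound for the last n
   steps and the first one for the n steps before, the probability not to meet is at most
   2 (phi_{n+m}(0) - phi_n(0)) / sqrt(2 pi n u) up to errors that vanish with the mesh, and
   phi_{n+m}(0) - phi_n(0) <= (m/n) sqrt(n v) because the increments of phi_k(0) decrease in k. The
   errors come from steps w that overshoot a level epsilon; the sum of their fourth moments tends to 0. *)

theory Submission
  imports Defs
begin

section \<open>Cadlag step functions\<close>

text \<open>The rate 1/i is what the grid sum tolerates: level s has fewer than 4^Q 2^s cells, all
  of index at least 2^s. Estimating survival by the size of X at time -ih, of order sqrt(m v), would
  give only i^(-1/2), and the counts would grow with the level. The gain comes from the reflection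
  of Y at 0, which makes X - Y drift downwards; phi_k(X) - phi_k(Y) accounts for this drift, and
  phi_k(0) is a concave sequence in k of size at most sqrt(k v), so that m further steps add only
  the fraction m/n. Discrete walks can jump past each other. Since u is proportional to the mesh and
  the number of steps to its inverse, second moments of overshoots would sum to a constant, while
  fourth moments sum to the order of the mesh. \<open>C_vector_law\<close> supplies some realization
  of the noises, and measurability of the end values as functions of the sample point is never
  established. The estimates are therefore stated for all realizations and for arbitrary measurable
  events on which the end values behave as required.\<close>

lemma tendsto_finite_range_eventually_eq:
  fixes f :: "'a \<Rightarrow> 'b :: t1_space"
  assumes "(f \<longlongrightarrow> l) F" "finite S" "eventually (\<lambda>u. f u \<in> S) F"
  shows "eventually (\<lambda>u. f u = l) F"
proof -
  have "open (- (S - {l}))" using assms(2) by (intro open_Compl finite_imp_closed) auto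
  then have "eventually (\<lambda>u. f u \<in> - (S - {l})) F"
    by (rule topological_tendstoD[OF assms(1)]) simp
  then show ?thesis using assms(3) by eventually_elim auto
qed

lemma Lim_at_left_eqI:
  fixes f :: "real \<Rightarrow> real"
  assumes "(f \<longlongrightarrow> l) (at_left x)"
  shows "Lim (at_left x) f = l"
  using assms by (intro tendsto_Lim) auto

text \<open>Monotonicity places the left limit at y between \<open>f x\<close> and
  \<open>f y\<close>, and at a jump it differs from \<open>f y\<close>. The strictness makes
  \<open>f\<close> injective on jump times.\<close>

lemma jump_times_less:
  fixes f :: "real \<Rightarrow> real"
  assumes mono: "mono_on {0..} f" and cad: "cadlag f"
    and "0 \<le> x" "x < y" "y \<in> jump_times f"
  shows "f x < f y"
proof -
  have y: "0 < y" and ne: "f y \<noteq> Lim (at_left y) f" using assms by (auto simp: jump_times_def)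
  from cad y obtain l where l: "(f \<longlongrightarrow> l) (at_left y)" unfolding cadlag_def by blast
  have ev: "eventually (\<lambda>u. u \<in> {x<..<y}) (at_left y)"
    using \<open>x < y\<close> by (rule eventually_at_left_real)
  have "f x \<le> l"
    by (rule tendsto_lowerbound[OF l])
       (use ev assms(3) in \<open>auto elim!: eventually_mono intro!: mono_onD[OF mono]\<close>)
  moreover have "l \<le> f y"
    by (rule tendsto_upperbound[OF l])
       (use ev assms(3) in \<open>auto elim!: eventually_mono intro!: mono_onD[OF mono]\<close>)
  ultimately show ?thesis using Lim_at_left_eqI[OF l] ne by simp
qed

lemma finite_jump_times_if_finite_range:
  fixes f :: "real \<Rightarrow> real"
  assumes mono: "mono_on {0..} f" and cad: "cadlag f"
    and a: "0 \<le> a" and fin: "finite (f ` {a..b})"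
  shows "finite (jump_times f \<inter> {a..b})"
proof (rule finite_imageD)
  show "finite (f ` (jump_times f \<inter> {a..b}))" using fin by (rule finite_subset[rotated]) auto
  show "inj_on f (jump_times f \<inter> {a..b})"
  proof (rule linorder_inj_onI)
    fix x y assume "x < y" "x \<in> jump_times f \<inter> {a..b}" "y \<in> jump_times f \<inter> {a..b}"
    then show "f x \<noteq> f y"
      using jump_times_less[OF mono cad, of x y] a by auto
  qed auto
qed

text \<open>Consider the supremum x of the points where \<open>f\<close> still has the value
  \<open>f s\<close>. The left limit at x is \<open>f s\<close>, and x is no jump, so
  \<open>f x = f s\<close>. Right continuity within a finite range forces constancy just after x, so
  x cannot lie below t.\<close>

lemma eq_if_no_jump_times:
  fixes f :: "real \<Rightarrow> real"
  assumes mono: "mono_on {0..} f" and cad: "cadlag f"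
    and s: "0 < s" "s < t" and fin: "finite (f ` {s..t})"
    and no: "jump_times f \<inter> {s..t} = {}"
  shows "f s = f t"
proof -
  define A where "A = {u\<in>{s..t}. f u = f s}"
  define x where "x = Sup A"
  have sA: "s \<in> A" and bd: "bdd_above A" using s by (auto simp: A_def intro!: bdd_aboveI[of _ t])
  have sx: "s \<le> x" using sA bd by (auto simp: x_def intro: cSup_upper)
  have xt: "x \<le> t" using sA unfolding x_def by (intro cSup_least) (auto simp: A_def)
  have below: "f u = f s" if "s \<le> u" "u < x" for u
  proof -
    obtain v where "v \<in> A" "u < v" using \<open>u < x\<close> sA unfolding x_def by (auto elim: less_cSupE)
    moreover from this have "f u \<le> f v"
      using that s by (intro mono_onD[OF mono]) auto
    moreover have "f s \<le> f u"
      using that s by (intro mono_onD[OF mono]) auto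
    ultimately show ?thesis by (simp add: A_def)
  qed
  have fx: "f x = f s"
  proof (cases "s < x")
    case True
    have "eventually (\<lambda>u. f u = f s) (at_left x)"
      using eventually_at_left_real[OF True] by (rule eventually_mono) (auto intro: below)
    then have "(f \<longlongrightarrow> f s) (at_left x)" by (rule tendsto_eventually)
    then have "Lim (at_left x) f = f s" by (rule Lim_at_left_eqI)
    moreover have "x \<notin> jump_times f" using no sx xt by auto
    ultimately show ?thesis using sx s by (simp add: jump_times_def)
  qed (use sx in auto)
  show ?thesis
  proof (cases "x < t")
    case True
    have "(f \<longlongrightarrow> f x) (at_right x)" using cad sx s by (auto simp: cadlag_def)
    moreover have ev: "eventually (\<lambda>u. u \<in> {x<..<t}) (at_right x)"
      using True by (rule eventually_at_right_real)
    then have "eventually (\<lambda>u. f u \<in> f ` {s..t}) (at_right x)"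
      by (rule eventually_mono) (use sx in auto)
    ultimately have "eventually (\<lambda>u. f u = f x) (at_right x)"
      using fin by (intro tendsto_finite_range_eventually_eq)
    with ev have "eventually (\<lambda>u. f u = f x \<and> u \<in> {x<..<t}) (at_right x)"
      by eventually_elim auto
    then obtain u where "f u = f x" "u \<in> {x<..<t}"
      using eventually_happens[of _ "at_right x"] trivial_limit_at_right_real by blast
    then have "u \<in> A" using sx fx by (auto simp: A_def)
    then have "u \<le> x" using bd by (auto simp: x_def intro: cSup_upper)
    then show ?thesis using \<open>u \<in> {x<..<t}\<close> by auto
  qed (use xt fx in auto)
qed

text \<open>For the last conjunct: with finitely many jump times near 0, \<open>f\<close> would be
  constant on some interval (0, c], with the value \<open>f 0 = 0\<close> by right continuity,
  against \<open>pos\<close>.\<close>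

lemma pure_jumps_if_finite_ranges:
  fixes f :: "real \<Rightarrow> real"
  assumes mono: "mono_on {0..} f" and cad: "cadlag f"
    and fin: "\<And>a b. 0 < a \<Longrightarrow> finite (f ` {a..b})"
    and zero: "f 0 = 0" and pos: "\<And>n. f (1 / real (Suc n)) \<noteq> 0"
  shows "(\<forall>a b. 0 < a \<and> a < b \<longrightarrow> finite (jump_times f \<inter> {a..b})) \<and>
    (\<forall>I. is_interval I \<and> I \<subseteq> {0<..} \<and> I \<inter> jump_times f = {} \<longrightarrow> f constant_on I) \<and>
    (\<forall>U. open U \<and> 0 \<in> U \<longrightarrow> infinite (jump_times f \<inter> U))"
proof (intro conjI allI impI)
  fix a b :: real assume "0 < a \<and> a < b"
  then show "finite (jump_times f \<inter> {a..b})"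
    by (intro finite_jump_times_if_finite_range[OF mono cad]) (auto intro: fin)
next
  fix I :: "real set" assume I: "is_interval I \<and> I \<subseteq> {0<..} \<and> I \<inter> jump_times f = {}"
  have eq: "f s = f t" if "s \<in> I" "t \<in> I" "s < t" for s t
  proof (rule eq_if_no_jump_times[OF mono cad _ that(3)])
    show "0 < s" using I that by auto
    then show "finite (f ` {s..t})" by (rule fin)
    have "{s..t} \<subseteq> I" using I that is_interval_1[of I] by (metis atLeastAtMost_iff subsetI)
    then show "jump_times f \<inter> {s..t} = {}" using I by auto
  qed
  have "f s = f t" if "s \<in> I" "t \<in> I" for s t
    using eq[OF that] eq[OF that(2,1)] by (metis linorder_less_linear)
  then show "f constant_on I" unfolding constant_on_def by metis
next
  fix U :: "real set" assume U: "open U \<and> 0 \<in> U"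
  show "infinite (jump_times f \<inter> U)"
  proof
    assume J: "finite (jump_times f \<inter> U)"
    obtain e where e: "0 < e" "ball 0 e \<subseteq> U" using U openE by blast
    \<comment> \<open>Inserting \<open>e\<close> keeps the minimum defined when \<open>U\<close>
      contains no jump time; either way no jump time lies in (0, d).\<close>
    define d where "d = Min (insert e (jump_times f \<inter> U))"
    have d0: "0 < d" using J e by (auto simp: d_def jump_times_def)
    have de: "d \<le> e" using J by (auto simp: d_def)
    have nj: "jump_times f \<inter> {s..t} = {}" if "0 < s" "t < d" for s t
    proof -
      have "x \<notin> jump_times f" if x: "s \<le> x" "x \<le> t" for x
      proof
        assume xj: "x \<in> jump_times f"
        have "x \<in> ball 0 e" using x \<open>0 < s\<close> \<open>t < d\<close> de by (auto simp: dist_real_def)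
        then have "x \<in> jump_times f \<inter> U" using xj e by auto
        then have "d \<le> x" using J by (auto simp: d_def)
        then show False using x \<open>t < d\<close> by auto
      qed
      then show ?thesis by auto
    qed
    obtain n where n: "1 / real (Suc n) < d" using d0 nat_approx_posE by blast
    define c where "c = 1 / real (Suc n)"
    have c: "0 < c" "c < d" using n by (auto simp: c_def)
    have "f u = f c" if "u \<in> {0<..<c}" for u
      using that c by (intro eq_if_no_jump_times[OF mono cad] fin nj) auto
    then have "eventually (\<lambda>u. f u = f c) (at_right 0)"
      using eventually_at_right_real[OF c(1)] by (auto elim: eventually_mono)
    then have "(f \<longlongrightarrow> f c) (at_right 0)" by (rule tendsto_eventually)
    moreover have "(f \<longlongrightarrow> 0) (at_right 0)" using cad zero unfolding cadlag_def by force
    ultimately have "f c = 0" by (rule tendsto_unique[rotated]) auto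
    then show False using pos[of n] by (simp add: c_def)
  qed
qed

section \<open>Gaussian walks reflected at zero\<close>

text \<open>This is 2 Phi(d/s) - 1 for the standard normal distribution function Phi. For d >= 0 it
  is, by the reflection principle, the probability that a Brownian motion from d avoids 0 until its
  variance reaches s^2. The odd extension to negative d averages correctly over Gaussian steps that
  jump past 0.\<close>

definition signed_normal :: "real \<Rightarrow> real \<Rightarrow> real" where
  "signed_normal s d = (\<integral>y. normal_density 0 s y * sgn (d + y) \<partial>lborel)"

lemma integrable_normal_density_mult_bounded:
  assumes "0 < s" "f \<in> borel_measurable borel" "\<And>y. \<bar>f y\<bar> \<le> B"
  shows "integrable lborel (\<lambda>y. normal_density 0 s y * f y)"
proof (rule Bochner_Integration.integrable_bound)
  show "integrable lborel (\<lambda>y. B * normal_density 0 s y)" using assms(1) by simp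
  show "AE y in lborel. norm (normal_density 0 s y * f y) \<le> norm (B * normal_density 0 s y)"
  proof (rule AE_I2)
    fix y
    have "B \<ge> 0" using assms(3)[of 0] by linarith
    then show "norm (normal_density 0 s y * f y) \<le> norm (B * normal_density 0 s y)"
      using mult_left_mono[OF assms(3)[of y], of "normal_density 0 s y"] by (simp add: abs_mult mult.commute)
  qed
qed (use assms(2) in measurable)

lemma normal_density_sgn_integral:
  assumes "0 < s" shows "(\<integral>y. normal_density 0 s y * sgn y \<partial>lborel) = 0"
proof -
  have "(\<integral>y. normal_density 0 s y * sgn y \<partial>lborel) = (\<integral>y. - (normal_density 0 s y * sgn y) \<partial>lborel)"
    by (subst lborel_integral_real_affine[where c="-1" and t=0]) (simp_all add: normal_density_def)
  then show ?thesis by simp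
qed

lemma integrable_signed_normal:
  assumes "0 < s"
  shows "integrable lborel (\<lambda>y. normal_density 0 s y * sgn (d + y))"
  by (rule integrable_normal_density_mult_bounded[where B=1]) (use assms in \<open>auto simp: abs_sgn_eq\<close>)

lemma signed_normal_mono:
  assumes "0 < s" "d \<le> e"
  shows "signed_normal s d \<le> signed_normal s e"
  unfolding signed_normal_def using assms
  by (intro integral_mono integrable_signed_normal mult_left_mono) (auto simp: sgn_if)

lemma signed_normal_nonneg:
  assumes "0 < s" "0 \<le> d"
  shows "0 \<le> signed_normal s d"
  using signed_normal_mono[OF assms] normal_density_sgn_integral[OF assms(1)]
  by (simp add: signed_normal_def)

lemma abs_signed_normal_le_1:
  assumes "0 < s"
  shows "\<bar>signed_normal s d\<bar> \<le> 1"
proof -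
  have "\<bar>signed_normal s d\<bar> \<le> (\<integral>y. \<bar>normal_density 0 s y * sgn (d + y)\<bar> \<partial>lborel)"
    unfolding signed_normal_def by (rule integral_abs_bound)
  also have "\<dots> \<le> (\<integral>y. normal_density 0 s y \<partial>lborel)"
    using assms by (intro integral_mono integrable_abs integrable_signed_normal)
      (auto simp: abs_mult abs_sgn_eq)
  finally show ?thesis using assms by simp
qed

text \<open>Subtract the value at d = 0, which vanishes by symmetry:
  \<open>sgn (d + y) - sgn y\<close> is at most 2 and lives on [-d, 0], where the density is at most
  \<open>1 / (sqrt (2 * pi) * s)\<close>.\<close>

lemma signed_normal_le:
  assumes s: "0 < s" and d: "0 \<le> d"
  shows "signed_normal s d \<le> 2 * d / (sqrt (2 * pi) * s)"
proof -
  let ?c = "1 / (sqrt (2 * pi) * s)"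
  have nd: "normal_density 0 s y \<le> ?c" for y
  proof -
    have "sqrt (2 * pi * s\<^sup>2) = sqrt (2 * pi) * s" using s by (simp add: real_sqrt_mult)
    then show ?thesis using s by (auto simp: normal_density_def divide_simps)
  qed
  have "signed_normal s d = (\<integral>y. normal_density 0 s y * sgn (d + y) \<partial>lborel) - (\<integral>y. normal_density 0 s y * sgn y \<partial>lborel)"
    using normal_density_sgn_integral[OF s] by (simp add: signed_normal_def)
  also have "\<dots> = (\<integral>y. normal_density 0 s y * sgn (d + y) - normal_density 0 s y * sgn y \<partial>lborel)"
    using integrable_signed_normal[OF s, of d] integrable_signed_normal[OF s, of 0] by simp
  also have "\<dots> \<le> (\<integral>y. 2 * ?c * indicator {-d..0} y \<partial>lborel)"
  proof (rule integral_mono)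
    show "integrable lborel (\<lambda>y. 2 * ?c * indicator {- d..0} y :: real)"
      using d by (intro integrable_mult_right integrable_real_indicator) auto
    fix y
    have "normal_density 0 s y * (sgn (d + y) - sgn y) \<le> ?c * (2 * indicator {-d..0} y)"
      using nd[of y] d s by (intro mult_mono) (auto simp: sgn_if indicator_def)
    then show "normal_density 0 s y * sgn (d + y) - normal_density 0 s y * sgn y \<le> 2 * ?c * indicator {- d..0} y"
      by (simp add: algebra_simps)
  qed (use integrable_signed_normal[OF s, of d] integrable_signed_normal[OF s, of 0] in auto)
  also have "\<dots> = 2 * d / (sqrt (2 * pi) * s)" using d by simp
  finally show ?thesis .
qed

lemma borel_measurable_signed_normal [measurable]:
  "0 < s \<Longrightarrow> signed_normal s \<in> borel_measurable borel"
  by (intro borel_measurable_mono monoI signed_normal_mono)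

text \<open>Sums of independent normals are normal; the independent pair is realised by the
  coordinates on the product of the two laws. This is the martingale property behind
  \<open>signed_walk_Suc\<close>.\<close>

lemma signed_normal_convolution:
  assumes s: "0 < s" and t: "0 < t"
  shows "(\<integral>w. normal_density 0 t w * signed_normal s (d + w) \<partial>lborel) = signed_normal (sqrt (s\<^sup>2 + t\<^sup>2)) d"
proof -
  define G where "G = (\<lambda>s. density lborel (\<lambda>x. ennreal (normal_density 0 s x)))"
  interpret T: prob_space "G t" unfolding G_def using t by (rule prob_space_normal_density)
  interpret S: prob_space "G s" unfolding G_def using s by (rule prob_space_normal_density)
  interpret TS: pair_prob_space "G t" "G s" ..
  have [measurable_cong]: "sets (G t) = sets borel" "sets (G s) = sets borel" by (auto simp: G_def)
  have d1: "distr (G t \<Otimes>\<^sub>M G s) (G t) fst = G t" by (rule S.distr_pair_fst)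
  have d2: "distr (G t \<Otimes>\<^sub>M G s) (G s) snd = G s"
  proof -
    have "distr (G t \<Otimes>\<^sub>M G s) (G s) snd = distr (distr (G s \<Otimes>\<^sub>M G t) (G t \<Otimes>\<^sub>M G s) (\<lambda>(x, y). (y, x))) (G s) snd"
      by (subst TS.distr_pair_swap) simp
    also have "\<dots> = distr (G s \<Otimes>\<^sub>M G t) (G s) fst"
      by (subst distr_distr) (auto simp: comp_def case_prod_beta)
    also have "\<dots> = G s" by (rule T.distr_pair_fst)
    finally show ?thesis .
  qed
  have "distr (G t \<Otimes>\<^sub>M G s) borel fst = distr (G t \<Otimes>\<^sub>M G s) (G t) fst"
    "distr (G t \<Otimes>\<^sub>M G s) borel snd = distr (G t \<Otimes>\<^sub>M G s) (G s) snd"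
    by (intro distr_cong refl; simp add: G_def)+
  with d1 d2 have dd: "distr (G t \<Otimes>\<^sub>M G s) borel fst = G t"
    "distr (G t \<Otimes>\<^sub>M G s) borel snd = G s" by simp_all
  have ind: "TS.indep_var borel fst borel snd"
    unfolding TS.indep_var_distribution_eq dd
  proof (intro conjI)
    have "sets (borel \<Otimes>\<^sub>M borel) = sets (G t \<Otimes>\<^sub>M G s)"
      by (intro sets_pair_measure_cong) (simp_all add: G_def)
    then show "G t \<Otimes>\<^sub>M G s = distr (G t \<Otimes>\<^sub>M G s) (borel \<Otimes>\<^sub>M borel) (\<lambda>x. (fst x, snd x))"
      by (simp add: distr_id2)
  qed measurable
  have "distributed (G t \<Otimes>\<^sub>M G s) lborel (\<lambda>x. fst x + snd x)
      (\<lambda>x. ennreal (normal_density (0 + 0) (sqrt (t\<^sup>2 + s\<^sup>2)) x))"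
    using s t dd by (intro TS.add_indep_normal ind) (auto simp: distributed_def G_def cong: distr_cong)
  then have dist: "distributed (G t \<Otimes>\<^sub>M G s) lborel (\<lambda>x. fst x + snd x)
      (\<lambda>x. ennreal (normal_density 0 (sqrt (s\<^sup>2 + t\<^sup>2)) x))" by (simp add: add.commute)
  have "signed_normal (sqrt (s\<^sup>2 + t\<^sup>2)) d = (\<integral>x. sgn (d + (fst x + snd x)) \<partial>(G t \<Otimes>\<^sub>M G s))"
    unfolding signed_normal_def
    by (rule distributed_integral[OF dist]) auto
  also have "\<dots> = (\<integral>w. (\<integral>y. sgn (d + (w + y)) \<partial>G s) \<partial>G t)"
    by (subst TS.integral_fst'[symmetric])
       (auto intro!: TS.P.integrable_const_bound[where B=1] simp: abs_sgn_eq)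
  also have "\<dots> = (\<integral>w. signed_normal s (d + w) \<partial>G t)"
  proof (intro Bochner_Integration.integral_cong refl)
    fix w show "(\<integral>y. sgn (d + (w + y)) \<partial>G s) = signed_normal s (d + w)"
      unfolding G_def signed_normal_def by (subst integral_density) (auto simp: add.assoc)
  qed
  also have "\<dots> = (\<integral>w. normal_density 0 t w * signed_normal s (d + w) \<partial>lborel)"
    unfolding G_def using s by (subst integral_density) auto
  finally show ?thesis ..
qed

text \<open>\<open>\<nu>\<close> is the joint law of one step of X (first coordinate) and of Y
  (second). The coordinates share the noise of P and are correlated, so what is recorded is their
  common marginal law and the law of their difference; \<open>\<alpha>\<close> and
  \<open>\<beta>\<close> are the square roots of the variances v and u.\<close>

locale gaussian_pair = prob_space \<nu> for \<nu> :: "(real \<times> real) measure" +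
  fixes \<alpha> \<beta> :: real
  assumes sets_eq [measurable_cong]: "sets \<nu> = sets (borel \<Otimes>\<^sub>M borel)"
    and \<alpha>_pos: "0 < \<alpha>" and \<beta>_pos: "0 < \<beta>"
    and fst_normal: "distributed \<nu> lborel fst (\<lambda>z. ennreal (normal_density 0 \<alpha> z))"
    and snd_normal: "distributed \<nu> lborel snd (\<lambda>z. ennreal (normal_density 0 \<alpha> z))"
    and diff_normal: "distributed \<nu> lborel (\<lambda>z. fst z - snd z) (\<lambda>z. ennreal (normal_density 0 \<beta> z))"
begin

section \<open>Moments of one step and means of the reflected walk\<close>

lemma integrable_fst_power: "integrable \<nu> (\<lambda>z. fst z ^ k)"
  using distributed_integrable[OF fst_normal, of "\<lambda>z. z ^ k"] integrable_normal_moment[OF \<alpha>_pos, of 0 k]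
  by simp

lemma integrable_fst: "integrable \<nu> fst"
  using integrable_fst_power[of 1] by simp

lemma integrable_snd: "integrable \<nu> snd"
  using distributed_integrable[OF snd_normal, of "\<lambda>z. z"] integrable_normal_moment[OF \<alpha>_pos, of 0 1]
  by simp

lemma expectation_fst: "expectation fst = 0"
  using distributed_integral[OF fst_normal, of "\<lambda>z. z"] integral_normal_moment_odd[OF \<alpha>_pos, of 0 0]
  by simp

lemma expectation_fst_square: "expectation (\<lambda>z. (fst z)\<^sup>2) = \<alpha>\<^sup>2"
  using distributed_integral[OF fst_normal, of "\<lambda>z. z\<^sup>2"] integral_normal_moment_even[OF \<alpha>_pos, of 0 1]
  by simp

lemma expectation_comp_snd:
  assumes "f \<in> borel_measurable borel"
  shows "expectation (\<lambda>z. f (snd z)) = expectation (\<lambda>z. f (fst z) :: real)"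
  using distributed_integral[OF fst_normal, of f] distributed_integral[OF snd_normal, of f] assms
  by simp

lemma integrable_diff_power4: "integrable \<nu> (\<lambda>z. (fst z - snd z) ^ 4)"
  using distributed_integrable[OF diff_normal, of "\<lambda>z. z ^ 4"] integrable_normal_moment[OF \<beta>_pos, of 0 4]
  by simp

lemma expectation_diff_power4: "expectation (\<lambda>z. (fst z - snd z) ^ 4) = 3 * \<beta> ^ 4"
proof -
  have "(\<integral>y. normal_density 0 \<beta> y * y ^ 4 \<partial>lborel) = 3 * \<beta> ^ 4"
    using integral_normal_moment_even[OF \<beta>_pos, of 0 2]
    by (simp add: fact_numeral power_divide flip: power_mult)
  then show ?thesis
    using distributed_integral[OF diff_normal, of "\<lambda>z. z ^ 4"] by simp
qed

text \<open>The functions \<open>phi_k\<close> of the header comment.\<close>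

primrec reflected_mean :: "nat \<Rightarrow> real \<Rightarrow> real" where
  "reflected_mean 0 r = r"
| "reflected_mean (Suc k) r = expectation (\<lambda>z. reflected_mean k (max 0 (r + fst z)))"

text \<open>Monotonicity supplies measurability and the Lipschitz bound linear growth. Both
  properties survive the recursion of \<open>reflected_mean\<close>, which makes every function in
  it integrable along a step.\<close>

lemma integrable_monotone_lipschitz_reflected:
  fixes f :: "real \<Rightarrow> real"
  assumes "\<And>r s. r \<le> s \<Longrightarrow> f r \<le> f s \<and> f s \<le> f r + (s - r)" "X \<in> borel_measurable \<nu>" "integrable \<nu> X"
  shows "integrable \<nu> (\<lambda>z. f (max 0 (r + X z)))"
proof (rule Bochner_Integration.integrable_bound)
  have [measurable]: "f \<in> borel_measurable borel"
    using assms(1) by (intro borel_measurable_mono monoI) auto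
  note [measurable] = assms(2)
  show "(\<lambda>z. f (max 0 (r + X z))) \<in> borel_measurable \<nu>" by measurable
  show "integrable \<nu> (\<lambda>z. \<bar>f 0\<bar> + \<bar>r\<bar> + \<bar>X z\<bar>)" using assms(3) by auto
  show "AE z in \<nu>. norm (f (max 0 (r + X z))) \<le> norm (\<bar>f 0\<bar> + \<bar>r\<bar> + \<bar>X z\<bar>)"
  proof (rule AE_I2)
    fix z
    have "f 0 \<le> f (max 0 (r + X z)) \<and> f (max 0 (r + X z)) \<le> f 0 + (max 0 (r + X z) - 0)"
      by (rule assms(1)) simp
    then show "norm (f (max 0 (r + X z))) \<le> norm (\<bar>f 0\<bar> + \<bar>r\<bar> + \<bar>X z\<bar>)" by auto
  qed
qed

text \<open>Two reflected walks driven by the same steps keep their order and never move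
  apart.\<close>

lemma reflected_mean_mono_lipschitz:
  "r \<le> s \<Longrightarrow> reflected_mean k r \<le> reflected_mean k s \<and> reflected_mean k s \<le> reflected_mean k r + (s - r)"
proof (induction k arbitrary: r s)
  case (Suc k)
  note int = integrable_monotone_lipschitz_reflected[OF Suc.IH _ integrable_fst]
  have le: "max 0 (r + fst z) \<le> max 0 (s + fst z)" "max 0 (s + fst z) - max 0 (r + fst z) \<le> s - r" for z :: "real \<times> real"
    using Suc.prems by auto
  have "reflected_mean (Suc k) r \<le> reflected_mean (Suc k) s"
    using Suc.IH[OF le(1)] by (auto intro!: integral_mono int)
  moreover have "reflected_mean (Suc k) s \<le> expectation (\<lambda>z. reflected_mean k (max 0 (r + fst z)) + (s - r))"
    unfolding reflected_mean.simps
  proof (intro integral_mono int Bochner_Integration.integrable_add)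
    fix z :: "real \<times> real"
    show "reflected_mean k (max 0 (s + fst z)) \<le> reflected_mean k (max 0 (r + fst z)) + (s - r)"
      using Suc.IH[OF le(1)[of z]] le(2)[of z] by linarith
  qed auto
  then have "reflected_mean (Suc k) s \<le> reflected_mean (Suc k) r + (s - r)"
    by (subst (asm) Bochner_Integration.integral_add) (auto intro!: int simp: prob_space)
  ultimately show ?case by simp
qed simp

lemmas reflected_mean_mono = reflected_mean_mono_lipschitz[THEN conjunct1]
  and reflected_mean_lipschitz = reflected_mean_mono_lipschitz[THEN conjunct2]

lemma borel_measurable_reflected_mean [measurable]: "reflected_mean k \<in> borel_measurable borel"
  by (intro borel_measurable_mono monoI reflected_mean_mono)

lemma integrable_reflected_mean:
  "integrable \<nu> (\<lambda>z. reflected_mean k (max 0 (r + fst z)))"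
  "integrable \<nu> (\<lambda>z. reflected_mean k (max 0 (r + snd z)))"
  by (intro integrable_monotone_lipschitz_reflected reflected_mean_mono_lipschitz integrable_fst integrable_snd; simp)+

lemma expectation_reflected_mean_snd:
  "expectation (\<lambda>z. reflected_mean k (max 0 (r + snd z))) = reflected_mean (Suc k) r"
  using expectation_comp_snd[of "\<lambda>z. reflected_mean k (max 0 (r + z))"] by simp

text \<open>Reflection does not increase squares, so the second moment after k steps is at most the
  expression under the root; the concavity of the root does the rest.\<close>

lemma reflected_mean_le: "reflected_mean k r \<le> sqrt (r\<^sup>2 + real k * \<alpha>\<^sup>2)"
proof (induction k arbitrary: r)
  case (Suc k)
  define s where "s = sqrt (r\<^sup>2 + real (Suc k) * \<alpha>\<^sup>2)"
  have "0 < real (Suc k) * \<alpha>\<^sup>2" using \<alpha>_pos by (intro mult_pos_pos) auto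
  then have "0 < r\<^sup>2 + real (Suc k) * \<alpha>\<^sup>2" by (intro add_nonneg_pos) auto
  then have s: "0 < s" "s\<^sup>2 = r\<^sup>2 + real (Suc k) * \<alpha>\<^sup>2" by (auto simp: s_def)
  have "reflected_mean (Suc k) r
      \<le> expectation (\<lambda>z. (r\<^sup>2 + 2 * r * fst z + (fst z)\<^sup>2 + real k * \<alpha>\<^sup>2) / (2 * s) + s / 2)"
    unfolding reflected_mean.simps
  proof (intro integral_mono integrable_reflected_mean)
    show "integrable \<nu> (\<lambda>z. (r\<^sup>2 + 2 * r * fst z + (fst z)\<^sup>2 + real k * \<alpha>\<^sup>2) / (2 * s) + s / 2)"
      using integrable_fst integrable_fst_power[of 2] by auto
    fix z :: "real \<times> real"
    define q where "q = (r + fst z)\<^sup>2 + real k * \<alpha>\<^sup>2"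
    have "reflected_mean k (max 0 (r + fst z)) \<le> sqrt ((max 0 (r + fst z))\<^sup>2 + real k * \<alpha>\<^sup>2)"
      by (rule Suc.IH)
    also have "\<dots> \<le> sqrt q" unfolding q_def by (intro real_sqrt_le_mono) (auto simp: max_def)
    \<comment> \<open>the tangent of the square root at \<open>s\<^sup>2\<close>\<close>
    also have "\<dots> \<le> q / (2 * s) + s / 2"
    proof -
      have "0 \<le> q" by (simp add: q_def)
      then have "0 \<le> (sqrt q - s)\<^sup>2" "(sqrt q)\<^sup>2 = q" by simp_all
      then have "2 * s * sqrt q \<le> q + s\<^sup>2" by (simp add: power2_diff mult_ac)
      then show ?thesis using s(1) by (simp add: field_simps power2_eq_square)
    qed
    finally show "reflected_mean k (max 0 (r + fst z))
        \<le> (r\<^sup>2 + 2 * r * fst z + (fst z)\<^sup>2 + real k * \<alpha>\<^sup>2) / (2 * s) + s / 2"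
      by (simp add: q_def power2_sum algebra_simps)
  qed
  also have "\<dots> = s\<^sup>2 / (2 * s) + s / 2"
    using integrable_fst integrable_fst_power[of 2] expectation_fst expectation_fst_square
    by (simp add: prob_space s algebra_simps)
  also have "\<dots> = s" using s(1) by (simp add: power2_eq_square)
  finally show ?case by (simp add: s_def)
qed simp

text \<open>For k = 0 this is the Lipschitz bound. In the induction the increment from r is the
  average of the previous increment over \<open>max 0 (r + fst z)\<close>, which is monotone in
  r.\<close>

lemma reflected_mean_increment_antimono:
  "0 \<le> r \<Longrightarrow> r \<le> s \<Longrightarrow> reflected_mean (Suc k) s - reflected_mean k s \<le> reflected_mean (Suc k) r - reflected_mean k r"
proof (induction k arbitrary: r s)
  case 0
  then show ?case using reflected_mean_lipschitz[of r s 1] by simp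
next
  case (Suc k)
  have eq: "reflected_mean (Suc (Suc k)) r - reflected_mean (Suc k) r =
      expectation (\<lambda>z. reflected_mean (Suc k) (max 0 (r + fst z)) - reflected_mean k (max 0 (r + fst z)))" for r
    using integrable_reflected_mean[of "Suc k" r] integrable_reflected_mean[of k r] by simp
  show ?case unfolding eq
    using Suc.prems
    by (intro integral_mono Bochner_Integration.integrable_diff integrable_reflected_mean Suc.IH) auto
qed

text \<open>A step from 0 leads to a point >= 0, where the increment is at most the one at 0. Hence
  \<open>reflected_mean k 0\<close> is concave in k.\<close>

lemma reflected_mean_increment_decreasing:
  "reflected_mean (Suc (Suc k)) 0 - reflected_mean (Suc k) 0 \<le> reflected_mean (Suc k) 0 - reflected_mean k 0"
proof -
  have "reflected_mean (Suc (Suc k)) 0 - reflected_mean (Suc k) 0 =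
      expectation (\<lambda>z. reflected_mean (Suc k) (max 0 (0 + fst z)) - reflected_mean k (max 0 (0 + fst z)))"
    using integrable_reflected_mean[of "Suc k" 0] integrable_reflected_mean[of k 0] by simp
  also have "\<dots> \<le> expectation (\<lambda>z. reflected_mean (Suc k) 0 - reflected_mean k 0)"
    by (intro integral_mono Bochner_Integration.integrable_diff integrable_reflected_mean
        reflected_mean_increment_antimono) auto
  finally show ?thesis by (simp add: prob_space)
qed

text \<open>By concavity the increment at n is at most the average of the n increments before it,
  which is \<open>reflected_mean n 0\<close> divided by n, and it dominates the m increments that
  follow.\<close>

lemma reflected_mean_growth:
  assumes "0 < n"
  shows "reflected_mean (n + m) 0 - reflected_mean n 0 \<le> real m / real n * (sqrt (real n) * \<alpha>)"
proof -
  define \<psi> where "\<psi> k = reflected_mean (Suc k) 0 - reflected_mean k 0" for k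
  have "\<psi> (Suc k) \<le> \<psi> k" for k
    unfolding \<psi>_def by (rule reflected_mean_increment_decreasing)
  then have anti: "\<psi> j \<le> \<psi> i" if "i \<le> j" for i j
    using that by (rule lift_Suc_antimono_le)
  have tel: "reflected_mean k 0 = (\<Sum>i<k. \<psi> i)" for k
    by (induction k) (simp_all add: \<psi>_def del: reflected_mean.simps(2))
  have "real n * \<psi> n \<le> (\<Sum>i<n. \<psi> i)"
    using sum_mono[of "{..<n}" "\<lambda>_. \<psi> n" \<psi>, OF anti] by simp
  also have "\<dots> \<le> sqrt (real n) * \<alpha>"
    using reflected_mean_le[of n 0] \<alpha>_pos by (simp add: tel[symmetric] real_sqrt_mult)
  finally have "\<psi> n \<le> sqrt (real n) * \<alpha> / real n" using assms by (simp add: field_simps)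
  then have "real m * \<psi> n \<le> real m * (sqrt (real n) * \<alpha> / real n)" by (intro mult_left_mono) auto
  moreover have "reflected_mean (n + m) 0 - reflected_mean n 0 \<le> real m * \<psi> n" for m
  proof (induction m)
    case (Suc m)
    have "reflected_mean (n + Suc m) 0 - reflected_mean (n + m) 0 = \<psi> (n + m)"
      by (simp add: \<psi>_def)
    also have "\<dots> \<le> \<psi> n" by (rule anti) simp
    finally show ?case using Suc.IH unfolding of_nat_Suc distrib_right by linarith
  qed simp
  ultimately show ?thesis using order_trans by fastforce
qed

section \<open>Survival probabilities of a pair of walks\<close>

primrec survival :: "nat \<Rightarrow> real \<Rightarrow> real \<Rightarrow> ennreal" where
  "survival 0 x y = (if y < x then 1 else 0)"
| "survival (Suc k) x y =
     (if y < x then \<integral>\<^sup>+z. survival k (max 0 (x + fst z)) (max 0 (y + snd z)) \<partial>\<nu> else 0)"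

lemma survival_eq_0: "x \<le> y \<Longrightarrow> survival k x y = 0"
  by (cases k) auto

text \<open>The mean sign of d plus a sum of k independent differences of steps. The case k = 0 is
  separate because \<open>normal_density\<close> with standard deviation 0 is no point mass.\<close>

definition signed_walk :: "nat \<Rightarrow> real \<Rightarrow> real" where
  "signed_walk k d = (if k = 0 then sgn d else signed_normal (sqrt (real k) * \<beta>) d)"

lemma signed_walk_nonneg: "0 \<le> d \<Longrightarrow> 0 \<le> signed_walk k d"
  using \<beta>_pos by (auto simp: signed_walk_def intro!: signed_normal_nonneg)

lemma abs_signed_walk_le_1: "\<bar>signed_walk k d\<bar> \<le> 1"
  using \<beta>_pos by (auto simp: signed_walk_def abs_sgn_eq intro!: abs_signed_normal_le_1)

lemma signed_walk_mono: "d \<le> e \<Longrightarrow> signed_walk k d \<le> signed_walk k e"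
  using \<beta>_pos by (auto simp: signed_walk_def sgn_if intro!: signed_normal_mono)

lemma signed_walk_le:
  assumes "0 < k" "0 \<le> d"
  shows "signed_walk k d \<le> 2 / (sqrt (2 * pi) * (sqrt (real k) * \<beta>)) * d"
  using signed_normal_le[of "sqrt (real k) * \<beta>" d] \<beta>_pos assms by (simp add: signed_walk_def)

lemma borel_measurable_signed_walk [measurable]: "signed_walk k \<in> borel_measurable borel"
  by (intro borel_measurable_mono monoI signed_walk_mono)

text \<open>One more step adds the variance \<open>\<beta>\<close>^2: the convolution identity, or
  the definition itself when k = 0.\<close>

lemma signed_walk_Suc: "expectation (\<lambda>z. signed_walk k (d + (fst z - snd z))) = signed_walk (Suc k) d"
proof -
  have "expectation (\<lambda>z. signed_walk k (d + (fst z - snd z))) =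
      (\<integral>w. normal_density 0 \<beta> w * signed_walk k (d + w) \<partial>lborel)"
    using distributed_integral[OF diff_normal, of "\<lambda>w. signed_walk k (d + w)"] by simp
  also have "\<dots> = signed_walk (Suc k) d"
  proof (cases "k = 0")
    case True
    then show ?thesis by (simp add: signed_walk_def signed_normal_def)
  next
    case False
    have "sqrt ((sqrt (real k) * \<beta>)\<^sup>2 + \<beta>\<^sup>2) = sqrt (real (Suc k) * \<beta>\<^sup>2)"
      by (simp add: power_mult_distrib algebra_simps)
    also have "\<dots> = sqrt (real (Suc k)) * \<beta>" using \<beta>_pos by (simp add: real_sqrt_mult)
    finally show ?thesis
      using False \<beta>_pos signed_normal_convolution[of "sqrt (real k) * \<beta>" \<beta> d]
      by (simp add: signed_walk_def)
  qed
  finally show ?thesis .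
qed

lemma integrable_signed_walk: "integrable \<nu> (\<lambda>z. signed_walk k (d + (fst z - snd z)))"
  by (rule integrable_const_bound[where B=1]) (auto intro: abs_signed_walk_le_1)

text \<open>While \<open>x > y\<close>, reflection at \<open>0\<close> can only shrink the difference of the two walks, up to an
  overshoot that costs a fourth moment.\<close>

lemma survival_le_signed_walk:
  assumes \<epsilon>: "0 < \<epsilon>" and "0 \<le> y" "y < x"
  shows "survival k x y \<le> ennreal (signed_walk k (x - y + \<epsilon>) + real k * (3 * \<beta> ^ 4 / \<epsilon> ^ 4))"
  using assms(2,3)
proof (induction k arbitrary: x y)
  case 0
  then show ?case using \<epsilon> by (simp add: signed_walk_def)
next
  case (Suc k)
  define c where "c = real k * (3 * \<beta> ^ 4 / \<epsilon> ^ 4)"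
  have c: "0 \<le> c" using \<epsilon> \<beta>_pos by (simp add: c_def)
  \<comment> \<open>\<open>g\<close> dominates the survival probability after one step and is
    nonnegative, so its \<open>nn_integral\<close> is an ordinary expectation, computable term by
    term.\<close>
  define g where "g z = signed_walk k (x - y + \<epsilon> + (fst z - snd z)) + (fst z - snd z) ^ 4 / \<epsilon> ^ 4 + c" for z
  \<comment> \<open>A step of at least \<open>- \<epsilon>\<close> leaves the shifted difference
    positive; a lower one makes the fourth-power term at least 1, which pays for a sign of
    -1.\<close>
  have nonneg: "0 \<le> signed_walk k (x - y + \<epsilon> + w) + w ^ 4 / \<epsilon> ^ 4" for w
  proof (cases "- \<epsilon> \<le> w")
    case True
    then have "0 \<le> signed_walk k (x - y + \<epsilon> + w)"
      using Suc.prems by (intro signed_walk_nonneg) auto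
    then show ?thesis using \<epsilon> by simp
  next
    case False
    then have "\<epsilon> ^ 4 \<le> (- w) ^ 4" using \<epsilon> by (intro power_mono) auto
    then have "1 \<le> w ^ 4 / \<epsilon> ^ 4" using \<epsilon> by simp
    then show ?thesis using abs_signed_walk_le_1[of k "x - y + \<epsilon> + w"] by linarith
  qed
  have g0: "0 \<le> g z" for z using nonneg[of "fst z - snd z"] c by (simp add: g_def)
  have "survival (Suc k) x y \<le> (\<integral>\<^sup>+z. ennreal (g z) \<partial>\<nu>)"
  proof -
    have "survival k (max 0 (x + fst z)) (max 0 (y + snd z)) \<le> ennreal (g z)" for z :: "real \<times> real"
    proof (cases "max 0 (y + snd z) < max 0 (x + fst z)")
      case True
      then have "survival k (max 0 (x + fst z)) (max 0 (y + snd z)) \<le>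
          ennreal (signed_walk k (max 0 (x + fst z) - max 0 (y + snd z) + \<epsilon>) + c)"
        unfolding c_def by (intro Suc.IH) auto
      also have "\<dots> \<le> ennreal (g z)"
      proof (rule ennreal_leI)
        have "signed_walk k (max 0 (x + fst z) - max 0 (y + snd z) + \<epsilon>)
            \<le> signed_walk k (x - y + \<epsilon> + (fst z - snd z))"
          using True by (intro signed_walk_mono) auto
        moreover have "0 \<le> (fst z - snd z) ^ 4 / \<epsilon> ^ 4" by simp
        ultimately show "signed_walk k (max 0 (x + fst z) - max 0 (y + snd z) + \<epsilon>) + c \<le> g z"
          unfolding g_def by linarith
      qed
      finally show ?thesis .
    next
      case False
      then show ?thesis by (subst survival_eq_0) auto
    qed
    then show ?thesis using Suc.prems by (auto intro!: nn_integral_mono)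
  qed
  also have "\<dots> = ennreal (expectation g)"
    unfolding g_def using g0[unfolded g_def] integrable_diff_power4 integrable_signed_walk
    by (intro nn_integral_eq_integral) auto
  also have "expectation g = signed_walk (Suc k) (x - y + \<epsilon>) + 3 * \<beta> ^ 4 / \<epsilon> ^ 4 + c"
    unfolding g_def using integrable_diff_power4 integrable_signed_walk
    by (simp add: signed_walk_Suc expectation_diff_power4 prob_space)
  finally show ?case by (simp only: c_def of_nat_Suc distrib_right mult_1_left add_ac)
qed

text \<open>The base case is the bound for the last n steps, linear in the distance. Going back k
  more steps, the mean distance becomes \<open>reflected_mean k x - reflected_mean k y\<close>,
  which one step reproduces exactly because both coordinates have the same marginal law.\<close>

lemma survival_le_reflected_mean:
  assumes \<epsilon>: "0 < \<epsilon>" and n: "0 < n" and "0 \<le> y" "y < x"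
  defines "\<kappa> \<equiv> 2 / (sqrt (2 * pi) * (sqrt (real n) * \<beta>))"
  shows "survival (n + k) x y \<le> ennreal (\<kappa> * (reflected_mean k x - reflected_mean k y + \<epsilon>
    + real k * (3 * \<beta> ^ 4 / \<epsilon> ^ 3)) + real n * (3 * \<beta> ^ 4 / \<epsilon> ^ 4))"
  using assms(3,4)
proof (induction k arbitrary: x y)
  case 0
  have "survival n x y \<le> ennreal (signed_walk n (x - y + \<epsilon>) + real n * (3 * \<beta> ^ 4 / \<epsilon> ^ 4))"
    using \<epsilon> 0 by (rule survival_le_signed_walk)
  also have "\<dots> \<le> ennreal (\<kappa> * (x - y + \<epsilon>) + real n * (3 * \<beta> ^ 4 / \<epsilon> ^ 4))"
    using signed_walk_le[OF n, of "x - y + \<epsilon>"] 0 \<epsilon> unfolding \<kappa>_def by (intro ennreal_leI) auto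
  finally show ?case by simp
next
  case (Suc k)
  have \<kappa>: "0 \<le> \<kappa>" using \<beta>_pos by (simp add: \<kappa>_def)
  define c where "c = real k * (3 * \<beta> ^ 4 / \<epsilon> ^ 3)"
  define c' where "c' = real n * (3 * \<beta> ^ 4 / \<epsilon> ^ 4)"
  have c: "0 \<le> c" "0 \<le> c'" using \<epsilon> \<beta>_pos by (simp_all add: c_def c'_def)
  \<comment> \<open>\<open>h\<close> scales like a length, so an overshoot costs the fourth moment
    over \<open>\<epsilon> ^ 3\<close>; the error over \<open>\<epsilon> ^ 4\<close> is inherited
    from the last n steps.\<close>
  define h where "h z = reflected_mean k (max 0 (x + fst z)) - reflected_mean k (max 0 (y + snd z)) + \<epsilon>
      + (fst z - snd z) ^ 4 / \<epsilon> ^ 3" for z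
  define g where "g z = \<kappa> * (h z + c) + c'" for z
  have h0: "0 \<le> h z" for z
  proof -
    define x' y' w where "x' = max 0 (x + fst z)" and "y' = max 0 (y + snd z)" and "w = fst z - snd z"
    have w4: "0 \<le> w ^ 4 / \<epsilon> ^ 3" using \<epsilon> by simp
    show ?thesis
    proof (cases "y' \<le> x'")
      case True
      then show ?thesis using reflected_mean_mono[OF True, of k] w4 \<epsilon>
        by (simp add: h_def x'_def y'_def w_def)
    next
      case False
      \<comment> \<open>After a crossing \<open>y'\<close> is unreflected and \<open>x'\<close> can
        only have been raised by reflection, so \<open>y < x\<close> bounds the gap by
        \<open>\<bar>w\<bar>\<close>; the Lipschitz property turns it into a loss of at most that
        size.\<close>
      then have "y' - x' \<le> \<bar>w\<bar>" using Suc.prems by (auto simp: x'_def y'_def w_def max_def split: if_splits)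
      then have le: "- \<bar>w\<bar> \<le> reflected_mean k x' - reflected_mean k y'"
        using reflected_mean_lipschitz[of x' y' k] False by linarith
      have "\<bar>w\<bar> \<le> \<epsilon> + w ^ 4 / \<epsilon> ^ 3"
      proof (cases "\<bar>w\<bar> \<le> \<epsilon>")
        case True
        then show ?thesis using w4 by linarith
      next
        case False
        then have "\<epsilon> ^ 3 * \<bar>w\<bar> \<le> \<bar>w\<bar> ^ 3 * \<bar>w\<bar>" using \<epsilon> by (intro mult_right_mono power_mono) auto
        also have "\<dots> = w ^ 4" using power_even_abs[of 4 w] by (simp add: eval_nat_numeral)
        finally have "\<bar>w\<bar> \<le> w ^ 4 / \<epsilon> ^ 3" using \<epsilon> by (simp add: field_simps)
        then show ?thesis using \<epsilon> by linarith
      qed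
      then show ?thesis using le by (simp add: h_def x'_def y'_def w_def)
    qed
  qed
  have g0: "0 \<le> g z" for z unfolding g_def using h0 c \<kappa> by simp
  have int: "integrable \<nu> h" unfolding h_def
    using integrable_reflected_mean integrable_diff_power4 by auto
  have "survival (n + Suc k) x y \<le> (\<integral>\<^sup>+z. ennreal (g z) \<partial>\<nu>)"
  proof -
    have "survival (n + k) (max 0 (x + fst z)) (max 0 (y + snd z)) \<le> ennreal (g z)" for z :: "real \<times> real"
    proof (cases "max 0 (y + snd z) < max 0 (x + fst z)")
      case True
      then have "survival (n + k) (max 0 (x + fst z)) (max 0 (y + snd z)) \<le>
          ennreal (\<kappa> * (reflected_mean k (max 0 (x + fst z)) - reflected_mean k (max 0 (y + snd z)) + \<epsilon> + c) + c')"
        unfolding c_def c'_def by (intro Suc.IH) auto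
      also have "\<dots> \<le> ennreal (g z)"
      proof (intro ennreal_leI)
        have "0 \<le> (fst z - snd z) ^ 4 / \<epsilon> ^ 3" using \<epsilon> by simp
        then show "\<kappa> * (reflected_mean k (max 0 (x + fst z)) - reflected_mean k (max 0 (y + snd z)) + \<epsilon> + c) + c'
            \<le> g z"
          using \<kappa> unfolding g_def h_def by (intro add_right_mono mult_left_mono) auto
      qed
      finally show ?thesis .
    next
      case False
      then show ?thesis by (subst survival_eq_0) auto
    qed
    then show ?thesis using Suc.prems by (auto intro!: nn_integral_mono)
  qed
  also have "\<dots> = ennreal (expectation g)"
    using int g0 unfolding g_def by (intro nn_integral_eq_integral) auto
  also have "expectation g = \<kappa> * (expectation h + c) + c'"
    unfolding g_def using int by (simp add: prob_space)
  also have "expectation h = reflected_mean (Suc k) x - reflected_mean (Suc k) y + \<epsilon> + 3 * \<beta> ^ 4 / \<epsilon> ^ 3"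
    unfolding h_def using integrable_reflected_mean[of k] integrable_diff_power4
    by (simp add: expectation_reflected_mean_snd expectation_diff_power4 prob_space)
  finally show ?case by (simp only: c_def c'_def of_nat_Suc distrib_right mult_1_left add_ac)
qed

text \<open>X moves alone for m steps; only then does Y start, at 0, with k common steps
  left.\<close>

primrec delayed_survival :: "nat \<Rightarrow> nat \<Rightarrow> real \<Rightarrow> ennreal" where
  "delayed_survival k 0 x = survival k x 0"
| "delayed_survival k (Suc m) x = (\<integral>\<^sup>+z. delayed_survival k m (max 0 (x + fst z)) \<partial>\<nu>)"

text \<open>The later n of the 2n common steps give the linear bound, the earlier n the functions
  \<open>reflected_mean n\<close>. The m steps of X alone turn its term into
  \<open>reflected_mean (n + m)\<close>, while the term of Y stays
  \<open>reflected_mean n 0\<close>; the growth bound compares the two.\<close>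

lemma delayed_survival_le:
  assumes \<epsilon>: "0 < \<epsilon>" and n: "0 < n"
  defines "\<kappa> \<equiv> 2 / (sqrt (2 * pi) * (sqrt (real n) * \<beta>))"
  shows "delayed_survival (2 * n) m 0 \<le> ennreal (\<kappa> * (real m / real n * (sqrt (real n) * \<alpha>) + \<epsilon>
    + real n * (3 * \<beta> ^ 4 / \<epsilon> ^ 3)) + real n * (3 * \<beta> ^ 4 / \<epsilon> ^ 4))"
proof -
  have \<kappa>: "0 \<le> \<kappa>" using \<beta>_pos by (simp add: \<kappa>_def)
  define c where "c = \<epsilon> + real n * (3 * \<beta> ^ 4 / \<epsilon> ^ 3)"
  define c' where "c' = real n * (3 * \<beta> ^ 4 / \<epsilon> ^ 4)"
  have c: "0 \<le> c" "0 \<le> c'" using \<epsilon> \<beta>_pos by (simp_all add: c_def c'_def)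
  \<comment> \<open>This makes the integrand \<open>g\<close> below nonnegative, so that its
    \<open>nn_integral\<close> is an expectation.\<close>
  have inc: "reflected_mean n 0 \<le> reflected_mean (n + j) x" if "0 \<le> x" for j x
  proof -
    have "reflected_mean k 0 \<le> reflected_mean (Suc k) 0" for k
    proof -
      have "expectation (\<lambda>z. reflected_mean k 0) \<le> reflected_mean (Suc k) 0"
        unfolding reflected_mean.simps
        by (intro integral_mono integrable_reflected_mean reflected_mean_mono) auto
      then show ?thesis by (simp add: prob_space)
    qed
    then have "reflected_mean n 0 \<le> reflected_mean (n + j) 0"
      by (rule lift_Suc_mono_le[of "\<lambda>k. reflected_mean k 0"]) simp
    then show ?thesis using reflected_mean_mono[OF that, of "n + j"] by linarith
  qed
  have "delayed_survival (2 * n) m x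
      \<le> ennreal (\<kappa> * (reflected_mean (n + m) x - reflected_mean n 0 + c) + c')" if "0 \<le> x" for x
    using that
  proof (induction m arbitrary: x)
    case 0
    show ?case
    proof (cases "x = 0")
      case True
      then show ?thesis by (simp add: survival_eq_0)
    next
      case False
      then have "survival (n + n) x 0 \<le> ennreal (\<kappa> * (reflected_mean n x - reflected_mean n 0 + \<epsilon>
          + real n * (3 * \<beta> ^ 4 / \<epsilon> ^ 3)) + real n * (3 * \<beta> ^ 4 / \<epsilon> ^ 4))"
        unfolding \<kappa>_def using \<epsilon> n 0 by (intro survival_le_reflected_mean) auto
      then show ?thesis by (simp add: c_def c'_def mult_2 add.assoc)
    qed
  next
    case (Suc m)
    define g where "g z = \<kappa> * (reflected_mean (n + m) (max 0 (x + fst z)) - reflected_mean n 0 + c) + c'"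
      for z :: "real \<times> real"
    have g0: "0 \<le> g z" for z
      using inc[of "max 0 (x + fst z)" m] \<kappa> c by (simp add: g_def)
    have "delayed_survival (2 * n) (Suc m) x \<le> (\<integral>\<^sup>+z. ennreal (g z) \<partial>\<nu>)"
      unfolding delayed_survival.simps g_def by (intro nn_integral_mono Suc.IH) auto
    also have "\<dots> = ennreal (expectation g)"
      using g0 integrable_reflected_mean(1)[of "n + m" x] unfolding g_def
      by (intro nn_integral_eq_integral) (simp_all del: reflected_mean.simps)
    also have "expectation g = \<kappa> * (reflected_mean (n + Suc m) x - reflected_mean n 0 + c) + c'"
      unfolding g_def using integrable_reflected_mean(1)[of "n + m" x] by (simp add: prob_space)
    finally show ?case .
  qed
  from this[of 0] have "delayed_survival (2 * n) m 0
      \<le> ennreal (\<kappa> * (reflected_mean (n + m) 0 - reflected_mean n 0 + c) + c')" by simp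
  also have "\<dots> \<le> ennreal (\<kappa> * (real m / real n * (sqrt (real n) * \<alpha>) + c) + c')"
    using reflected_mean_growth[OF n, of m] \<kappa> by (intro ennreal_leI add_mono mult_left_mono) auto
  finally show ?thesis by (simp add: c_def c'_def add.assoc)
qed

lemma borel_measurable_survival [measurable]:
  "(\<lambda>p. survival k (fst p) (snd p)) \<in> borel_measurable (borel \<Otimes>\<^sub>M borel)"
proof (induction k)
  case (Suc k)
  have [measurable]: "(\<lambda>q. survival k (max 0 (fst (fst q) + fst (snd q))) (max 0 (snd (fst q) + snd (snd q))))
      \<in> borel_measurable ((borel \<Otimes>\<^sub>M borel) \<Otimes>\<^sub>M \<nu>)"
    using measurable_compose[OF _ Suc, of
      "\<lambda>q. (max 0 (fst (fst q) + fst (snd q)), max 0 (snd (fst q) + snd (snd q)))"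
      "(borel \<Otimes>\<^sub>M borel) \<Otimes>\<^sub>M \<nu>"]
    by simp
  show ?case unfolding survival.simps by measurable
qed simp

lemma borel_measurable_delayed_survival [measurable]:
  "delayed_survival k m \<in> borel_measurable borel"
proof (induction m)
  case 0
  show ?case
    using measurable_compose[OF _ borel_measurable_survival, of "\<lambda>x. (x, 0)" borel k] by simp
next
  case (Suc m)
  note [measurable] = Suc
  have "(\<lambda>x. \<integral>\<^sup>+z. delayed_survival k m (max 0 (x + fst z)) \<partial>\<nu>) \<in> borel_measurable borel"
    by measurable
  then show ?case by simp
qed

section \<open>Probability that the reflected walk is at zero\<close>

primrec zero_probability :: "nat \<Rightarrow> real \<Rightarrow> ennreal" where
  "zero_probability 0 x = (if x = 0 then 1 else 0)"
| "zero_probability (Suc k) x = (\<integral>\<^sup>+z. zero_probability k (max 0 (x + fst z)) \<partial>\<nu>)"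

lemma borel_measurable_zero_probability [measurable]: "zero_probability k \<in> borel_measurable borel"
proof (induction k)
  case 0
  have "(\<lambda>x::real. if x = 0 then 1 else 0 :: ennreal) \<in> borel_measurable borel" by measurable
  then show ?case by (simp add: zero_probability_def)
next
  case (Suc k)
  note [measurable] = Suc
  have "(\<lambda>x. \<integral>\<^sup>+z. zero_probability k (max 0 (x + fst z)) \<partial>\<nu>) \<in> borel_measurable borel"
    by measurable
  then show ?case by simp
qed

lemma reflected_mean_one_zero: "reflected_mean 1 0 = \<alpha> / sqrt (2 * pi)"
proof -
  have abs: "integrable \<nu> (\<lambda>z. \<bar>fst z\<bar>)" using integrable_fst by auto
  have "expectation (\<lambda>z. \<bar>fst z\<bar>) = \<alpha> * sqrt (2 / pi)"
    using distributed_integral[OF fst_normal, of abs] integral_normal_moment_abs_odd[OF \<alpha>_pos, of 0 0]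
    by simp
  moreover have "expectation (\<lambda>z. max 0 (fst z)) = expectation (\<lambda>z. (\<bar>fst z\<bar> + fst z) / 2)"
    by (intro Bochner_Integration.integral_cong refl) auto
  moreover have "\<dots> = expectation (\<lambda>z. \<bar>fst z\<bar>) / 2"
    using abs integrable_fst expectation_fst by simp
  ultimately have "expectation (\<lambda>z. max 0 (fst z)) = \<alpha> * (sqrt (2 / pi) / 2)" by simp
  also have "sqrt (2 / pi) / 2 = 1 / sqrt (2 * pi)"
    by (simp add: real_sqrt_divide real_sqrt_mult field_simps)
  finally show ?thesis by simp
qed

text \<open>The mean increment \<open>\<E> (x + z)\<^sup>-\<close> of the reflected walk at \<open>x\<close>, divided by its
  value at \<open>0\<close>, dominates the indicator of \<open>x = 0\<close>.\<close>

lemma zero_probability_le_increment: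
  "0 \<le> x \<Longrightarrow> zero_probability k x \<le>
     ennreal ((reflected_mean (Suc k) x - reflected_mean k x) / reflected_mean 1 0)"
proof (induction k arbitrary: x)
  case 0
  have "expectation (\<lambda>z. x + fst z) \<le> reflected_mean (Suc 0) x"
    unfolding reflected_mean.simps
    using integrable_fst integrable_reflected_mean(1)[of 0 x] by (intro integral_mono) auto
  then have "x \<le> reflected_mean (Suc 0) x"
    using integrable_fst expectation_fst by (simp add: prob_space)
  moreover have "0 < reflected_mean (Suc 0) 0"
    using reflected_mean_one_zero \<alpha>_pos by simp
  ultimately show ?case by (cases "x = 0") (simp_all del: reflected_mean.simps(2))
next
  case (Suc k)
  define g where "g z = (reflected_mean (Suc k) (max 0 (x + fst z)) - reflected_mean k (max 0 (x + fst z)))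
    / reflected_mean 1 0" for z :: "real \<times> real"
  have pos: "0 < reflected_mean 1 0" using reflected_mean_one_zero \<alpha>_pos by simp
  \<comment> \<open>Nonnegative increments make \<open>g\<close> nonnegative; for k = 0 the positive
    part of r plus a centred step has mean at least r.\<close>
  have inc: "reflected_mean k r \<le> reflected_mean (Suc k) r" if "0 \<le> r" for k r
    using that
  proof (induction k arbitrary: r)
    case 0
    have "expectation (\<lambda>z. r + fst z) \<le> reflected_mean (Suc 0) r"
      unfolding reflected_mean.simps
      using integrable_fst integrable_reflected_mean(1)[of 0 r] by (intro integral_mono) auto
    then show ?case using integrable_fst expectation_fst by (simp add: prob_space)
  next
    case (Suc k)
    have "expectation (\<lambda>z. reflected_mean k (max 0 (r + fst z)))
        \<le> expectation (\<lambda>z. reflected_mean (Suc k) (max 0 (r + fst z)))"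
      by (intro integral_mono integrable_reflected_mean Suc.IH) auto
    then show ?case by (simp only: reflected_mean.simps(2))
  qed
  have "zero_probability (Suc k) x \<le> (\<integral>\<^sup>+z. ennreal (g z) \<partial>\<nu>)"
    unfolding zero_probability.simps g_def by (intro nn_integral_mono Suc.IH) auto
  also have "\<dots> = ennreal (expectation g)"
    unfolding g_def using inc[of _ k] pos integrable_reflected_mean(1)[of k x] integrable_reflected_mean(1)[of "Suc k" x]
    by (intro nn_integral_eq_integral) (simp_all del: reflected_mean.simps)
  also have "expectation g = (reflected_mean (Suc (Suc k)) x - reflected_mean (Suc k) x) / reflected_mean 1 0"
    unfolding g_def using integrable_reflected_mean(1)[of k x] integrable_reflected_mean(1)[of "Suc k" x]
    by (simp add: reflected_mean.simps(2)[of "Suc k" x] reflected_mean.simps(2)[of k x] del: reflected_mean.simps)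
  finally show ?case .
qed

text \<open>The growth bound with m = 1 gives an increment of at most
  \<open>\<alpha> / sqrt (real n)\<close>; dividing by \<open>reflected_mean 1 0\<close> produces
  the constant.\<close>

lemma zero_probability_le:
  assumes "0 < n"
  shows "zero_probability n 0 \<le> ennreal (sqrt (2 * pi) / sqrt (real n))"
proof -
  have "(reflected_mean (Suc n) 0 - reflected_mean n 0) / reflected_mean 1 0 \<le> sqrt (2 * pi) / sqrt (real n)"
  proof -
    have "reflected_mean (Suc n) 0 - reflected_mean n 0 \<le> sqrt (real n) * \<alpha> / real n"
      using reflected_mean_growth[OF assms, of 1] by simp
    also have "\<dots> = \<alpha> / sqrt (real n)" using assms by (simp add: field_simps)
    finally have "(reflected_mean (Suc n) 0 - reflected_mean n 0) / reflected_mean 1 0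
        \<le> (\<alpha> / sqrt (real n)) / reflected_mean 1 0"
      by (rule divide_right_mono) (use reflected_mean_one_zero \<alpha>_pos in simp)
    also have "\<dots> = sqrt (2 * pi) / sqrt (real n)"
      unfolding reflected_mean_one_zero using \<alpha>_pos by simp
    finally show ?thesis .
  qed
  then show ?thesis
    using zero_probability_le_increment[of 0 n] order_trans ennreal_leI by blast
qed

end

section \<open>Independence and Markov chains\<close>

context prob_space
begin

text \<open>Fubini's theorem for the joint law, which is a product: Y may be integrated out with X
  frozen.\<close>

lemma nn_integral_indep_var:
  assumes ind: "indep_var S X N Y" and f [measurable]: "f \<in> borel_measurable (S \<Otimes>\<^sub>M N)"
  shows "(\<integral>\<^sup>+\<omega>. f (X \<omega>, Y \<omega>) \<partial>M) = (\<integral>\<^sup>+\<omega>. (\<integral>\<^sup>+z. f (X \<omega>, z) \<partial>distr M N Y) \<partial>M)"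
proof -
  have [measurable]: "X \<in> M \<rightarrow>\<^sub>M S" "Y \<in> M \<rightarrow>\<^sub>M N" using ind by (auto dest: indep_var_rv1 indep_var_rv2)
  interpret Y: prob_space "distr M N Y" by (rule prob_space_distr) simp
  have "(\<integral>\<^sup>+\<omega>. f (X \<omega>, Y \<omega>) \<partial>M) = (\<integral>\<^sup>+q. f q \<partial>distr M (S \<Otimes>\<^sub>M N) (\<lambda>\<omega>. (X \<omega>, Y \<omega>)))"
    by (subst nn_integral_distr) auto
  also have "\<dots> = (\<integral>\<^sup>+q. f q \<partial>(distr M S X \<Otimes>\<^sub>M distr M N Y))"
    using ind by (simp add: indep_var_distribution_eq)
  also have "\<dots> = (\<integral>\<^sup>+x. (\<integral>\<^sup>+z. f (x, z) \<partial>distr M N Y) \<partial>distr M S X)"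
    by (rule Y.nn_integral_fst[symmetric]) simp
  also have "\<dots> = (\<integral>\<^sup>+\<omega>. (\<integral>\<^sup>+z. f (X \<omega>, z) \<partial>distr M N Y) \<partial>M)"
    by (subst nn_integral_distr) auto
  finally show ?thesis .
qed

text \<open>By \<open>le\<close> the process \<open>F k (T k \<omega>)\<close> is a supermartingale,
  since \<open>T k\<close> is determined by the first k noises and thus independent of the next
  one.\<close>

lemma nn_integral_markov_chain_le:
  fixes S N :: "'b measure"
  assumes ind: "indep_vars (\<lambda>_. N) \<xi> {..<L}"
    and step [measurable]: "\<And>k. (\<lambda>(s, z). step k s z) \<in> S \<Otimes>\<^sub>M N \<rightarrow>\<^sub>M S"
    and s0: "s0 \<in> space S" "\<And>\<omega>. T 0 \<omega> = s0"
    and T: "\<And>k \<omega>. T (Suc k) \<omega> = step k (T k \<omega>) (\<xi> k \<omega>)"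
    and F [measurable]: "\<And>k. F k \<in> borel_measurable S"
    and le: "\<And>k s. k < L \<Longrightarrow> s \<in> space S \<Longrightarrow> (\<integral>\<^sup>+z. F (Suc k) (step k s z) \<partial>distr M N (\<xi> k)) \<le> F k s"
  shows "(\<integral>\<^sup>+\<omega>. F L (T L \<omega>) \<partial>M) \<le> F 0 s0"
proof -
  have \<xi> [measurable]: "\<xi> k \<in> M \<rightarrow>\<^sub>M N" if "k < L" for k
    using ind that by (auto simp: indep_vars_def)
  \<comment> \<open>Factoring \<open>T k\<close> through the noises before k yields both its
    measurability and its independence from \<open>\<xi> k\<close>.\<close>
  have ex: "\<exists>g\<in>PiM {..<k} (\<lambda>_. N) \<rightarrow>\<^sub>M S. \<forall>\<omega>. T k \<omega> = g (\<lambda>i\<in>{..<k}. \<xi> i \<omega>)" for k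
  proof (induction k)
    case 0
    show ?case using s0 by (intro bexI[of _ "\<lambda>_. s0"]) auto
  next
    case (Suc k)
    then obtain g where g [measurable]: "g \<in> PiM {..<k} (\<lambda>_. N) \<rightarrow>\<^sub>M S"
      and Tk: "\<And>\<omega>. T k \<omega> = g (\<lambda>i\<in>{..<k}. \<xi> i \<omega>)" by blast
    have [measurable]: "(\<lambda>h. restrict h {..<k}) \<in> PiM {..<Suc k} (\<lambda>_. N) \<rightarrow>\<^sub>M PiM {..<k} (\<lambda>_. N)"
      by (rule measurable_restrict_subset) auto
    have [measurable]: "(\<lambda>h. h k) \<in> PiM {..<Suc k} (\<lambda>_. N) \<rightarrow>\<^sub>M N"
      by (rule measurable_component_singleton) auto
    have "(\<lambda>h. (\<lambda>(s, z). step k s z) (g (restrict h {..<k}), h k)) \<in> PiM {..<Suc k} (\<lambda>_. N) \<rightarrow>\<^sub>M S"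
      by measurable
    moreover have "T (Suc k) \<omega> = (\<lambda>(s, z). step k s z)
        (g (restrict (\<lambda>i\<in>{..<Suc k}. \<xi> i \<omega>) {..<k}), (\<lambda>i\<in>{..<Suc k}. \<xi> i \<omega>) k)" for \<omega>
    proof -
      have "restrict (\<lambda>i\<in>{..<Suc k}. \<xi> i \<omega>) {..<k} = (\<lambda>i\<in>{..<k}. \<xi> i \<omega>)"
        by (auto simp: restrict_def fun_eq_iff)
      then show ?thesis by (simp only: T Tk) simp
    qed
    ultimately show ?case 
      by (intro bexI[of _ "\<lambda>h. (\<lambda>(s, z). step k s z) (g (restrict h {..<k}), h k)"] allI; blast)
  qed
  have indep: "indep_var S (T k) N (\<xi> k)" if "k < L" for k
  proof -
    obtain g where g: "g \<in> PiM {..<k} (\<lambda>_. N) \<rightarrow>\<^sub>M S" "\<And>\<omega>. T k \<omega> = g (\<lambda>i\<in>{..<k}. \<xi> i \<omega>)"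
      using ex by blast
    have "indep_var (PiM {..<k} (\<lambda>_. N)) (\<lambda>\<omega>. \<lambda>i\<in>{..<k}. \<xi> i \<omega>) (PiM {k} (\<lambda>_. N)) (\<lambda>\<omega>. \<lambda>i\<in>{k}. \<xi> i \<omega>)"
      using ind that by (intro indep_var_restrict) auto
    then have "indep_var S (g \<circ> (\<lambda>\<omega>. \<lambda>i\<in>{..<k}. \<xi> i \<omega>)) N ((\<lambda>h. h k) \<circ> (\<lambda>\<omega>. \<lambda>i\<in>{k}. \<xi> i \<omega>))"
      using g(1) by (rule indep_var_compose) (auto intro: measurable_component_singleton)
    moreover have "g \<circ> (\<lambda>\<omega>. \<lambda>i\<in>{..<k}. \<xi> i \<omega>) = T k" "(\<lambda>h. h k) \<circ> (\<lambda>\<omega>. \<lambda>i\<in>{k}. \<xi> i \<omega>) = \<xi> k"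
      using g(2) by (auto simp: fun_eq_iff)
    ultimately show ?thesis by simp
  qed
  have dec: "(\<integral>\<^sup>+\<omega>. F (Suc k) (T (Suc k) \<omega>) \<partial>M) \<le> (\<integral>\<^sup>+\<omega>. F k (T k \<omega>) \<partial>M)" if k: "k < L" for k
  proof -
    have [measurable]: "T k \<in> M \<rightarrow>\<^sub>M S" using indep[OF k] by (rule indep_var_rv1)
    have "(\<lambda>q. F (Suc k) ((\<lambda>(s, z). step k s z) q)) \<in> borel_measurable (S \<Otimes>\<^sub>M N)" by measurable
    from nn_integral_indep_var[OF indep[OF k] this]
    have "(\<integral>\<^sup>+\<omega>. F (Suc k) (T (Suc k) \<omega>) \<partial>M) =
        (\<integral>\<^sup>+\<omega>. (\<integral>\<^sup>+z. F (Suc k) (step k (T k \<omega>) z) \<partial>distr M N (\<xi> k)) \<partial>M)"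
      by (simp add: T)
    also have "\<dots> \<le> (\<integral>\<^sup>+\<omega>. F k (T k \<omega>) \<partial>M)"
      using k by (intro nn_integral_mono le) (auto intro: measurable_space)
    finally show ?thesis .
  qed
  have "(\<integral>\<^sup>+\<omega>. F k (T k \<omega>) \<partial>M) \<le> F 0 s0" if "k \<le> L" for k
    using that
  proof (induction k)
    case 0
    show ?case by (simp add: s0 emeasure_space_1)
  next
    case (Suc k)
    then show ?case using dec[of k] by (auto intro: order_trans)
  qed
  then show ?thesis by simp
qed

text \<open>Probabilities of rectangles factor twice, first over the blocks j and then over i inside
  each block. The index pairs are written (i, j) for the later regrouping by the time index
  i.\<close>

lemma indep_vars_blocks:
  assumes fin: "finite J" "J \<noteq> {}" "finite I" "I \<noteq> {}"
    and blocks: "indep_vars (\<lambda>j. PiM I (\<lambda>_. N)) (\<lambda>j \<omega>. \<lambda>i\<in>I. X j i \<omega>) J"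
    and inner: "\<And>j. j \<in> J \<Longrightarrow> indep_vars (\<lambda>_. N) (X j) I"
  shows "indep_vars (\<lambda>_. N) (\<lambda>(i, j). X j i) (I \<times> J)"
proof -
  have rv [measurable]: "X j i \<in> M \<rightarrow>\<^sub>M N" if "j \<in> J" "i \<in> I" for i j
    using inner[OF that(1)] that(2) by (auto simp: indep_vars_def)
  have iff: "indep_vars (\<lambda>_. N) (\<lambda>(i, j). X j i) (I \<times> J) \<longleftrightarrow>
    (\<forall>A\<in>(\<Pi> q\<in>I \<times> J. sets N). prob (\<Inter>q\<in>I \<times> J. (\<lambda>(i, j). X j i) q -` A q \<inter> space M)
      = (\<Prod>q\<in>I \<times> J. prob ((\<lambda>(i, j). X j i) q -` A q \<inter> space M)))"
    using fin by (intro indep_vars_finite)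
      (auto simp: sets.sigma_sets_eq sets.Int_stable sets.space_closed)
  show ?thesis unfolding iff
  proof
    fix A assume A: "A \<in> (\<Pi> q\<in>I \<times> J. sets N)"
    have "(\<Inter>q\<in>I \<times> J. (\<lambda>(i, j). X j i) q -` A q \<inter> space M)
        = (\<Inter>j\<in>J. (\<lambda>\<omega>. \<lambda>i\<in>I. X j i \<omega>) -` (\<Pi>\<^sub>E i\<in>I. A (i, j)) \<inter> space M)"
      using fin by (auto simp: PiE_iff)
    also have "prob \<dots> = (\<Prod>j\<in>J. prob ((\<lambda>\<omega>. \<lambda>i\<in>I. X j i \<omega>) -` (\<Pi>\<^sub>E i\<in>I. A (i, j)) \<inter> space M))"
      using A fin by (intro indep_varsD_finite[OF blocks]) (auto intro!: sets_PiM_I_finite)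
    also have "\<dots> = (\<Prod>j\<in>J. \<Prod>i\<in>I. prob (X j i -` A (i, j) \<inter> space M))"
    proof (rule prod.cong[OF refl])
      fix j assume j: "j \<in> J"
      have "(\<lambda>\<omega>. \<lambda>i\<in>I. X j i \<omega>) -` (\<Pi>\<^sub>E i\<in>I. A (i, j)) \<inter> space M = (\<Inter>i\<in>I. X j i -` A (i, j) \<inter> space M)"
        using fin(4) by (auto simp: PiE_iff)
      moreover have "prob (\<Inter>i\<in>I. X j i -` A (i, j) \<inter> space M) = (\<Prod>i\<in>I. prob (X j i -` A (i, j) \<inter> space M))"
        using A j fin by (intro indep_varsD_finite[OF inner[OF j]]) auto
      ultimately show "prob ((\<lambda>\<omega>. \<lambda>i\<in>I. X j i \<omega>) -` (\<Pi>\<^sub>E i\<in>I. A (i, j)) \<inter> space M)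
          = (\<Prod>i\<in>I. prob (X j i -` A (i, j) \<inter> space M))"
        by (simp only:)
    qed
    also have "\<dots> = (\<Prod>i\<in>I. \<Prod>j\<in>J. prob (X j i -` A (i, j) \<inter> space M))" by (rule prod.swap)
    also have "\<dots> = (\<Prod>q\<in>I \<times> J. prob ((\<lambda>(i, j). X j i) q -` A q \<inter> space M))"
      by (simp add: prod.cartesian_product case_prod_beta)
    finally show "prob (\<Inter>q\<in>I \<times> J. (\<lambda>(i, j). X j i) q -` A q \<inter> space M) = \<dots>" .
  qed
qed

end

section \<open>Increments of the driving noise\<close>

lemma (in prob_space) indep_vars_reindex:
  assumes "indep_vars (\<lambda>_. N) X I" "inj_on f J" "f ` J \<subseteq> I"
  shows "indep_vars (\<lambda>_. N) (\<lambda>j. X (f j)) J"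
proof -
  have "indep_vars (\<lambda>j. PiM {f j} (\<lambda>_. N)) (\<lambda>j \<omega>. restrict (\<lambda>i. X i \<omega>) {f j}) J"
    using assms by (intro indep_vars_restrict) (auto simp: disjoint_family_on_def inj_on_def)
  then have "indep_vars (\<lambda>_. N) (\<lambda>j \<omega>. (\<lambda>h. h (f j)) (restrict (\<lambda>i. X i \<omega>) {f j})) J"
    by (rule indep_vars_compose2) (auto intro: measurable_component_singleton)
  then show ?thesis by simp
qed

lemma (in prob_space) distributed_uminus_normal:
  assumes "distributed M lborel X (\<lambda>z. ennreal (normal_density 0 s z))" "0 < s"
  shows "distributed M lborel (\<lambda>\<omega>. - X \<omega>) (\<lambda>z. ennreal (normal_density 0 s z))"
  using normal_density_affine[OF assms, of "-1" 0] by simp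

lemma brownian_motionD:
  assumes "brownian_motion M \<sigma> W"
  shows brownian_motion_continuous: "\<omega> \<in> space M \<Longrightarrow> continuous_on {0..} (\<lambda>t. W t \<omega>)"
    and brownian_motion_normal: "\<And>s t. 0 \<le> s \<and> s < t \<longrightarrow> distributed M lborel (\<lambda>\<omega>. W t \<omega> - W s \<omega>)
      (\<lambda>z. ennreal (normal_density 0 (\<sigma> * sqrt (t - s)) z))"
    and brownian_motion_indep: "\<And>(n::nat) t. 0 \<le> t 0 \<and> (\<forall>i<n. t i \<le> t (Suc i)) \<longrightarrow>
      prob_space.indep_vars M (\<lambda>_. borel) (\<lambda>i \<omega>. W (t (Suc i)) \<omega> - W (t i) \<omega>) {..<n}"
proof -
  note D = assms[unfolded brownian_motion_def]
  show "\<omega> \<in> space M \<Longrightarrow> continuous_on {0..} (\<lambda>t. W t \<omega>)"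
    using D[THEN conjunct2, THEN conjunct2, THEN conjunct1] by auto
  fix s t show "0 \<le> s \<and> s < t \<longrightarrow> distributed M lborel (\<lambda>\<omega>. W t \<omega> - W s \<omega>)
      (\<lambda>z. ennreal (normal_density 0 (\<sigma> * sqrt (t - s)) z))"
    by (rule D[THEN conjunct2, THEN conjunct2, THEN conjunct2, THEN conjunct1, THEN spec, THEN spec])
next
  fix n :: nat and t
  show "0 \<le> t 0 \<and> (\<forall>i<n. t i \<le> t (Suc i)) \<longrightarrow>
      prob_space.indep_vars M (\<lambda>_. borel) (\<lambda>i \<omega>. W (t (Suc i)) \<omega> - W (t i) \<omega>) {..<n}"
    by (rule assms[unfolded brownian_motion_def, THEN conjunct2, THEN conjunct2, THEN conjunct2,
        THEN conjunct2, THEN spec, THEN spec])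
qed

lemma brownian_motion_increment_normal:
  assumes "brownian_motion M \<sigma> W" "0 < \<delta>"
  shows "distributed M lborel (\<lambda>\<omega>. W (real (Suc i) * \<delta>) \<omega> - W (real i * \<delta>) \<omega>)
    (\<lambda>z. ennreal (normal_density 0 (\<sigma> * sqrt \<delta>) z))"
proof -
  have "0 \<le> real i * \<delta> \<and> real i * \<delta> < real (Suc i) * \<delta>" using assms(2) by simp
  then have "distributed M lborel (\<lambda>\<omega>. W (real (Suc i) * \<delta>) \<omega> - W (real i * \<delta>) \<omega>)
    (\<lambda>z. ennreal (normal_density 0 (\<sigma> * sqrt (real (Suc i) * \<delta> - real i * \<delta>)) z))"
    by (rule brownian_motion_normal[OF assms(1), THEN mp])
  moreover have "real (Suc i) * \<delta> - real i * \<delta> = \<delta>" by (simp add: algebra_simps)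
  ultimately show ?thesis by simp
qed

lemma brownian_motion_increments_indep:
  assumes "brownian_motion M \<sigma> W" "0 < \<delta>"
  shows "prob_space.indep_vars M (\<lambda>_. borel)
    (\<lambda>i \<omega>. W (real (Suc i) * \<delta>) \<omega> - W (real i * \<delta>) \<omega>) {..<L::nat}"
proof -
  have "0 \<le> real 0 * \<delta> \<and> (\<forall>i<L. real i * \<delta> \<le> real (Suc i) * \<delta>)"
    using assms(2) by (auto intro!: mult_right_mono)
  then have "prob_space.indep_vars M (\<lambda>_. borel)
      (\<lambda>i \<omega>. W ((\<lambda>i. real i * \<delta>) (Suc i)) \<omega> - W ((\<lambda>i. real i * \<delta>) i) \<omega>) {..<L}"
    by (rule brownian_motion_indep[OF assms(1), THEN mp])
  then show ?thesis by simp
qed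

text \<open>The process \<open>S 0\<close> lives on \<open>[-x 0,\<infinity>)\<close> only. In the \<open>m\<close> steps before \<open>-x 0\<close>,
  where its increments are irrelevant, increments after time \<open>0\<close> are used instead, so that the steps
  are identically distributed throughout.\<close>

definition noise_step ::
  "real \<Rightarrow> nat \<Rightarrow> nat \<Rightarrow> (nat \<Rightarrow> real) \<Rightarrow> (real \<Rightarrow> 'a \<Rightarrow> real) \<Rightarrow> (nat \<Rightarrow> real \<Rightarrow> 'a \<Rightarrow> real)
    \<Rightarrow> nat option \<Rightarrow> nat \<Rightarrow> 'a \<Rightarrow> real" where
  "noise_step \<delta> m n x P S j i \<omega> = (case j of
     None \<Rightarrow> P (- x 1 + real (Suc i) * \<delta>) \<omega> - P (- x 1 + real i * \<delta>) \<omega>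
   | Some l \<Rightarrow> let k = (if l = 0 then if i < m then i + n else i - m else i)
       in S l (- x l + real (Suc k) * \<delta>) \<omega> - S l (- x l + real k * \<delta>) \<omega>)"

text \<open>The first coordinate drives the path started at \<open>- x 1\<close>, the second the one
  started at \<open>- x 0\<close>. The common step of P cancels in their difference.\<close>

definition step_pair ::
  "real \<Rightarrow> nat \<Rightarrow> nat \<Rightarrow> (nat \<Rightarrow> real) \<Rightarrow> (real \<Rightarrow> 'a \<Rightarrow> real) \<Rightarrow> (nat \<Rightarrow> real \<Rightarrow> 'a \<Rightarrow> real)
    \<Rightarrow> nat \<Rightarrow> 'a \<Rightarrow> real \<times> real" where
  "step_pair \<delta> m n x P S i \<omega> =
    (noise_step \<delta> m n x P S None i \<omega> - noise_step \<delta> m n x P S (Some 1) i \<omega>,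
     noise_step \<delta> m n x P S None i \<omega> - noise_step \<delta> m n x P S (Some 0) i \<omega>)"

context
  fixes M :: "'a measure" and \<sigma>s \<sigma>p \<delta> :: real and m n :: nat and x P S
  assumes noise: "driving_noise M \<sigma>s \<sigma>p 1 x P S"
    and pos: "0 < \<sigma>s" "0 < \<sigma>p" "0 < \<delta>" "0 < m + n"
    and x1: "x 1 = real (m + n) * \<delta>"
begin

interpretation prob_space M
  using noise by (simp add: driving_noise_def brownian_motion_def)

lemma brownian_P: "brownian_motion M \<sigma>p (\<lambda>t. P (- t))"
  and brownian_S: "l \<le> 1 \<Longrightarrow> brownian_motion M \<sigma>s (\<lambda>t. S l (- x l + t))"
  using noise by (auto simp: driving_noise_def)

text \<open>P runs backwards from 0, so its forward steps are the negated increments of the Brownian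
  motion t -> P (- t), in reverse order.\<close>

lemma noise_step_None:
  assumes "i < m + n"
  shows "noise_step \<delta> m n x P S None i \<omega> =
    - (P (- (real (Suc (m + n - Suc i)) * \<delta>)) \<omega> - P (- (real (m + n - Suc i) * \<delta>)) \<omega>)"
proof -
  have "- x 1 + real (Suc i) * \<delta> = - (real (m + n - Suc i) * \<delta>)"
    "- x 1 + real i * \<delta> = - (real (Suc (m + n - Suc i)) * \<delta>)"
    using assms x1 by (simp_all add: of_nat_diff algebra_simps)
  then show ?thesis by (simp add: noise_step_def)
qed

lemma noise_step_normal:
  assumes "i < m + n" "j \<in> {None, Some 0, Some 1}"
  shows "distributed M lborel (noise_step \<delta> m n x P S j i)
    (\<lambda>z. ennreal (normal_density 0 ((if j = None then \<sigma>p else \<sigma>s) * sqrt \<delta>) z))"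
proof (cases j)
  case None
  have "0 < \<sigma>p * sqrt \<delta>" using pos by simp
  from distributed_uminus_normal[OF brownian_motion_increment_normal[OF brownian_P pos(3)] this]
  have "distributed M lborel (\<lambda>\<omega>. - (P (- (real (Suc (m + n - Suc i)) * \<delta>)) \<omega> - P (- (real (m + n - Suc i) * \<delta>)) \<omega>))
    (\<lambda>z. ennreal (normal_density 0 (\<sigma>p * sqrt \<delta>) z))" .
  also have "(\<lambda>\<omega>. - (P (- (real (Suc (m + n - Suc i)) * \<delta>)) \<omega> - P (- (real (m + n - Suc i) * \<delta>)) \<omega>))
      = noise_step \<delta> m n x P S None i"
    using noise_step_None[OF assms(1)] by auto
  finally show ?thesis using None by simp
next
  case (Some l)
  then have l: "l \<le> 1" using assms by auto
  from brownian_motion_increment_normal[OF brownian_S[OF l] pos(3)]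
  show ?thesis by (simp add: Some noise_step_def[abs_def] Let_def)
qed

text \<open>The index maps (reversal for P, rotation by m for S 0, identity for S 1) permute the m +
  n increments of one Brownian motion.\<close>

lemma noise_step_indep_inner:
  assumes "j \<in> {None, Some 0, Some 1}"
  shows "indep_vars (\<lambda>_. borel) (noise_step \<delta> m n x P S j) {..<m + n}"
proof (cases j)
  case None
  have "indep_vars (\<lambda>_. borel) (\<lambda>i \<omega>. (\<lambda>i \<omega>. P (- (real (Suc i) * \<delta>)) \<omega> - P (- (real i * \<delta>)) \<omega>) (m + n - Suc i) \<omega>) {..<m + n}"
    by (rule indep_vars_reindex[OF brownian_motion_increments_indep[OF brownian_P pos(3), of "m + n"]])
      (auto simp: inj_on_def)
  then have "indep_vars (\<lambda>_. borel) (\<lambda>i \<omega>. - (P (- (real (Suc (m + n - Suc i)) * \<delta>)) \<omega>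
      - P (- (real (m + n - Suc i) * \<delta>)) \<omega>)) {..<m + n}"
    by (rule indep_vars_compose2[where Y="\<lambda>_. uminus"]) auto
  then show ?thesis unfolding None
    by (subst indep_vars_cong[OF refl _ refl]) (auto simp: noise_step_None)
next
  case (Some l)
  then have l: "l \<le> 1" using assms by auto
  have "indep_vars (\<lambda>_. borel) (\<lambda>i. (\<lambda>k \<omega>. S l (- x l + real (Suc k) * \<delta>) \<omega> - S l (- x l + real k * \<delta>) \<omega>)
      (if l = 0 then if i < m then i + n else i - m else i)) {..<m + n}"
    by (rule indep_vars_reindex[OF brownian_motion_increments_indep[OF brownian_S[OF l] pos(3), of "m + n"]])
      (auto simp: inj_on_def)
  then show ?thesis by (simp add: Some noise_step_def[abs_def] Let_def)
qed

text \<open>Independence of the three processes passes to their vectors of grid increments through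
  measurable maps on the path spaces; it is then combined with the independence inside each
  process.\<close>

lemma noise_step_indep:
  "indep_vars (\<lambda>_. borel) (\<lambda>(i, j). noise_step \<delta> m n x P S j i) ({..<m + n} \<times> {None, Some 0, Some 1})"
proof (rule indep_vars_blocks)
  let ?D = "\<lambda>j. case j of None \<Rightarrow> {..0} | Some i \<Rightarrow> {- x i..}"
  have J: "insert None (Some ` {..1}) = {None, Some 0, Some (1::nat)}" by auto
  have ind: "indep_vars (\<lambda>j. \<Pi>\<^sub>M y\<in>?D j. borel)
      (\<lambda>j \<omega>. case j of None \<Rightarrow> (\<lambda>y\<in>{..0}. P y \<omega>) | Some i \<Rightarrow> (\<lambda>y\<in>{- x i..}. S i y \<omega>)) {None, Some 0, Some 1}"
    by (rule noise[unfolded driving_noise_def J, THEN conjunct2, THEN conjunct2])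
  define proc where "proc j = (case j of None \<Rightarrow> P | Some l \<Rightarrow> S l)" for j
  define ix where "ix j i = (if j = Some 0 then if i < m then i + n else i - m else i)" for j :: "nat option" and i
  define pt where "pt j k = - x (case j of None \<Rightarrow> 1 | Some l \<Rightarrow> l) + real k * \<delta>" for j k
  have step: "noise_step \<delta> m n x P S j i \<omega> = proc j (pt j (Suc (ix j i))) \<omega> - proc j (pt j (ix j i)) \<omega>" for j i \<omega>
    by (cases j) (simp_all add: noise_step_def proc_def ix_def pt_def Let_def)
  \<comment> \<open>Each grid point must lie in the index set of its process, since the restricted
    path carries a value of the process only there. For P this holds because the grid ends at
    0.\<close>
  have dom: "pt j (Suc (ix j i)) \<in> ?D j" "pt j (ix j i) \<in> ?D j" if "i < m + n" for i j
  proof -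
    have *: "- x 1 + real k * \<delta> \<le> 0" if "k \<le> m + n" for k
    proof -
      have "real k * \<delta> \<le> real (m + n) * \<delta>" using that pos(3) by (intro mult_right_mono) auto
      then show ?thesis unfolding x1 by simp
    qed
    show "pt j (Suc (ix j i)) \<in> ?D j" "pt j (ix j i) \<in> ?D j"
      using that *[of i] *[of "Suc i"] pos(3)
      by (cases j; simp add: pt_def ix_def del: of_nat_Suc; fail)+
  qed
  define Y where "Y j h = (\<lambda>i\<in>{..<m + n}. h (pt j (Suc (ix j i))) - h (pt j (ix j i)))"
    for j and h :: "real \<Rightarrow> real"
  have Y: "Y j \<in> (\<Pi>\<^sub>M y\<in>?D j. borel) \<rightarrow>\<^sub>M (\<Pi>\<^sub>M i\<in>{..<m + n}. borel)" for j
    unfolding Y_def using dom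
    by (intro measurable_restrict borel_measurable_diff measurable_component_singleton) auto
  have "indep_vars (\<lambda>j. \<Pi>\<^sub>M i\<in>{..<m + n}. borel)
      (\<lambda>j \<omega>. Y j (case j of None \<Rightarrow> (\<lambda>y\<in>{..0}. P y \<omega>) | Some i \<Rightarrow> (\<lambda>y\<in>{- x i..}. S i y \<omega>))) {None, Some 0, Some 1}"
    by (rule indep_vars_compose2[OF ind Y])
  moreover have "Y j (case j of None \<Rightarrow> (\<lambda>y\<in>{..0}. P y \<omega>) | Some i \<Rightarrow> (\<lambda>y\<in>{- x i..}. S i y \<omega>))
      = (\<lambda>i\<in>{..<m + n}. noise_step \<delta> m n x P S j i \<omega>)" for j \<omega>
  proof -
    have "(case j of None \<Rightarrow> (\<lambda>y\<in>{..0}. P y \<omega>) | Some i \<Rightarrow> (\<lambda>y\<in>{- x i..}. S i y \<omega>)) = (\<lambda>y\<in>?D j. proc j y \<omega>)"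
      by (cases j) (simp_all add: proc_def)
    then show ?thesis unfolding Y_def step by (intro restrict_ext) (simp add: dom)
  qed
  ultimately show "indep_vars (\<lambda>j. \<Pi>\<^sub>M i\<in>{..<m + n}. borel)
      (\<lambda>j \<omega>. \<lambda>i\<in>{..<m + n}. noise_step \<delta> m n x P S j i \<omega>) {None, Some 0, Some 1}" by simp
next
  show "{..<m + n} \<noteq> {}" using pos(4) by (auto simp only: lessThan_empty_iff)
qed (simp_all add: noise_step_indep_inner)

lemma step_pair_indep: "indep_vars (\<lambda>_. borel \<Otimes>\<^sub>M borel) (step_pair \<delta> m n x P S) {..<m + n}"
proof -
  let ?J = "{None, Some 0, Some (1::nat)}"
  have "indep_vars (\<lambda>i. PiM ({i} \<times> ?J) (\<lambda>_. borel))
     (\<lambda>i \<omega>. \<lambda>q\<in>{i} \<times> ?J. (case q of (i, j) \<Rightarrow> noise_step \<delta> m n x P S j i) \<omega>) {..<m + n}"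
    by (rule indep_vars_restrict[OF noise_step_indep]) (auto simp: disjoint_family_on_def)
  then have "indep_vars (\<lambda>_. borel \<Otimes>\<^sub>M borel)
     (\<lambda>i \<omega>. (\<lambda>h. (h (i, None) - h (i, Some 1), h (i, None) - h (i, Some 0)))
        (\<lambda>q\<in>{i} \<times> ?J. (case q of (i, j) \<Rightarrow> noise_step \<delta> m n x P S j i) \<omega>)) {..<m + n}"
    by (rule indep_vars_compose2)
      (intro measurable_Pair borel_measurable_diff measurable_component_singleton; simp)
  then show ?thesis by (simp add: step_pair_def[abs_def])
qed

text \<open>For every i the three noise steps have as joint law the same product of normals, and the
  pair is a fixed function of them.\<close>

lemma step_pair_law:
  assumes i: "i < m + n"
  shows "distr M (borel \<Otimes>\<^sub>M borel) (step_pair \<delta> m n x P S i) = distr M (borel \<Otimes>\<^sub>M borel) (step_pair \<delta> m n x P S 0)"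
proof -
  let ?J = "{None, Some 0, Some (1::nat)}"
  let ?G = "\<lambda>j. density lborel (\<lambda>z. ennreal (normal_density 0 ((if j = None then \<sigma>p else \<sigma>s) * sqrt \<delta>) z))"
  let ?g = "\<lambda>h. (h None - h (Some 1), h None - h (Some (0::nat))) :: real \<times> real"
  have "distr M (borel \<Otimes>\<^sub>M borel) (step_pair \<delta> m n x P S i) = distr (PiM ?J ?G) (borel \<Otimes>\<^sub>M borel) ?g"
    if i: "i < m + n" for i
  proof -
    have "indep_vars (\<lambda>_. borel) (\<lambda>j. (\<lambda>(i, j). noise_step \<delta> m n x P S j i) (i, j)) ?J"
      by (rule indep_vars_reindex[OF noise_step_indep]) (use i in \<open>auto simp: inj_on_def\<close>)
    then have ind: "indep_vars (\<lambda>_. borel) (\<lambda>j. noise_step \<delta> m n x P S j i) ?J" by simp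
    have rv [measurable]: "noise_step \<delta> m n x P S j i \<in> borel_measurable M" if "j \<in> ?J" for j
      using ind that unfolding indep_vars_def by blast
    have G: "distr M borel (noise_step \<delta> m n x P S j i) = ?G j" if "j \<in> ?J" for j
    proof -
      have "distr M borel (noise_step \<delta> m n x P S j i) = distr M lborel (noise_step \<delta> m n x P S j i)"
        by (intro distr_cong) auto
      then show ?thesis using distributed_distr_eq_density[OF noise_step_normal[OF i that]] by simp
    qed
    have "distr M (PiM ?J (\<lambda>_. borel)) (\<lambda>\<omega>. \<lambda>j\<in>?J. noise_step \<delta> m n x P S j i \<omega>)
        = PiM ?J (\<lambda>j. distr M borel (noise_step \<delta> m n x P S j i))"
      using ind by (subst (asm) indep_vars_iff_distr_eq_PiM') (auto intro: rv)
    also have "\<dots> = PiM ?J ?G" by (intro PiM_cong refl G)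
    finally have "distr (PiM ?J ?G) (borel \<Otimes>\<^sub>M borel) ?g =
        distr (distr M (PiM ?J (\<lambda>_. borel)) (\<lambda>\<omega>. \<lambda>j\<in>?J. noise_step \<delta> m n x P S j i \<omega>)) (borel \<Otimes>\<^sub>M borel) ?g"
      by simp
    also have "\<dots> = distr M (borel \<Otimes>\<^sub>M borel) (?g \<circ> (\<lambda>\<omega>. \<lambda>j\<in>?J. noise_step \<delta> m n x P S j i \<omega>))"
    proof (rule distr_distr)
      show "?g \<in> PiM ?J (\<lambda>_. borel) \<rightarrow>\<^sub>M borel \<Otimes>\<^sub>M borel"
        by (intro measurable_Pair borel_measurable_diff measurable_component_singleton; simp)
      show "(\<lambda>\<omega>. \<lambda>j\<in>?J. noise_step \<delta> m n x P S j i \<omega>) \<in> M \<rightarrow>\<^sub>M PiM ?J (\<lambda>_. borel)"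
        by (intro measurable_restrict rv)
    qed
    also have "?g \<circ> (\<lambda>\<omega>. \<lambda>j\<in>?J. noise_step \<delta> m n x P S j i \<omega>) = step_pair \<delta> m n x P S i"
      by (auto simp: step_pair_def fun_eq_iff)
    finally show ?thesis ..
  qed
  from this[of i] this[of 0] show ?thesis using i pos by auto
qed

text \<open>Per unit of time a coordinate P - S has variance
  \<open>\<sigma>p\<^sup>2 + \<sigma>s\<^sup>2\<close>, and the difference S 0 - S 1 has variance
  \<open>2 * \<sigma>s\<^sup>2\<close>.\<close>

lemma step_pair_gaussian:
  "gaussian_pair (distr M (borel \<Otimes>\<^sub>M borel) (step_pair \<delta> m n x P S 0)) (sqrt (\<sigma>p\<^sup>2 + \<sigma>s\<^sup>2) * sqrt \<delta>) (sqrt 2 * \<sigma>s * sqrt \<delta>)"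
proof -
  have rv [measurable]: "step_pair \<delta> m n x P S 0 \<in> M \<rightarrow>\<^sub>M borel \<Otimes>\<^sub>M borel"
    using step_pair_indep pos(4) unfolding indep_vars_def by blast
  interpret D: prob_space "distr M (borel \<Otimes>\<^sub>M borel) (step_pair \<delta> m n x P S 0)"
    by (rule prob_space_distr) simp
  let ?X = "\<lambda>j. noise_step \<delta> m n x P S j 0"
  let ?J = "{None, Some 0, Some (1::nat)}"
  have sp: "0 < \<sigma>p * sqrt \<delta>" "0 < \<sigma>s * sqrt \<delta>" using pos by auto
  have nrm: "distributed M lborel (?X j)
      (\<lambda>z. ennreal (normal_density 0 ((if j = None then \<sigma>p else \<sigma>s) * sqrt \<delta>) z))" if "j \<in> ?J" for j
    using noise_step_normal[OF pos(4) that] .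
  have ind: "indep_var borel (?X a) borel (?X b)" if "a \<in> ?J" "b \<in> ?J" "a \<noteq> b" for a b
  proof -
    have "indep_vars (\<lambda>_. borel) (\<lambda>c. (\<lambda>(i, j). noise_step \<delta> m n x P S j i) (0, case_bool a b c)) UNIV"
      by (rule indep_vars_reindex[OF noise_step_indep])
        (use pos(4) that in \<open>auto simp: inj_on_def split: bool.splits\<close>)
    moreover have "(\<lambda>c. (\<lambda>(i, j). noise_step \<delta> m n x P S j i) (0, case_bool a b c)) = case_bool (?X a) (?X b)"
      by (auto simp: fun_eq_iff split: bool.split)
    moreover have "(\<lambda>_. borel :: real measure) = case_bool borel borel" by (auto split: bool.split)
    ultimately show ?thesis unfolding indep_var_def by simp
  qed
  have diff: "distributed (distr M (borel \<Otimes>\<^sub>M borel) (step_pair \<delta> m n x P S 0)) lborel f (\<lambda>z. ennreal (normal_density 0 s z))"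
    if f: "f \<in> borel_measurable (borel \<Otimes>\<^sub>M borel)" and
      d: "distributed M lborel (\<lambda>\<omega>. f (step_pair \<delta> m n x P S 0 \<omega>)) (\<lambda>z. ennreal (normal_density 0 s z))" for f s
    using d f unfolding distributed_def by (auto simp: distr_distr comp_def)
  have s1: "sqrt ((\<sigma>p * sqrt \<delta>)\<^sup>2 + (\<sigma>s * sqrt \<delta>)\<^sup>2) = sqrt (\<sigma>p\<^sup>2 + \<sigma>s\<^sup>2) * sqrt \<delta>"
    using pos(3) by (simp add: power_mult_distrib real_sqrt_mult flip: distrib_right)
  have s2: "sqrt ((\<sigma>s * sqrt \<delta>)\<^sup>2 + (\<sigma>s * sqrt \<delta>)\<^sup>2) = sqrt 2 * \<sigma>s * sqrt \<delta>"
  proof -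
    have "(\<sigma>s * sqrt \<delta>)\<^sup>2 + (\<sigma>s * sqrt \<delta>)\<^sup>2 = 2 * (\<sigma>s * sqrt \<delta>)\<^sup>2" by simp
    then show ?thesis using sp(2) by (simp only: real_sqrt_mult) simp
  qed
  show ?thesis
  proof
    have "distributed M lborel (\<lambda>\<omega>. ?X None \<omega> - ?X (Some 1) \<omega>)
        (\<lambda>z. ennreal (normal_density (0 - 0) (sqrt ((\<sigma>p * sqrt \<delta>)\<^sup>2 + (\<sigma>s * sqrt \<delta>)\<^sup>2)) z))"
      using nrm[of None] nrm[of "Some 1"] sp by (intro diff_indep_normal ind) auto
    then show "distributed (distr M (borel \<Otimes>\<^sub>M borel) (step_pair \<delta> m n x P S 0)) lborel fst
        (\<lambda>z. ennreal (normal_density 0 (sqrt (\<sigma>p\<^sup>2 + \<sigma>s\<^sup>2) * sqrt \<delta>) z))"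
      by (intro diff) (simp_all add: step_pair_def s1)
    have "distributed M lborel (\<lambda>\<omega>. ?X None \<omega> - ?X (Some 0) \<omega>)
        (\<lambda>z. ennreal (normal_density (0 - 0) (sqrt ((\<sigma>p * sqrt \<delta>)\<^sup>2 + (\<sigma>s * sqrt \<delta>)\<^sup>2)) z))"
      using nrm[of None] nrm[of "Some 0"] sp by (intro diff_indep_normal ind) auto
    then show "distributed (distr M (borel \<Otimes>\<^sub>M borel) (step_pair \<delta> m n x P S 0)) lborel snd
        (\<lambda>z. ennreal (normal_density 0 (sqrt (\<sigma>p\<^sup>2 + \<sigma>s\<^sup>2) * sqrt \<delta>) z))"
      by (intro diff) (simp_all add: step_pair_def s1)
    have "distributed M lborel (\<lambda>\<omega>. ?X (Some 0) \<omega> - ?X (Some 1) \<omega>)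
        (\<lambda>z. ennreal (normal_density (0 - 0) (sqrt ((\<sigma>s * sqrt \<delta>)\<^sup>2 + (\<sigma>s * sqrt \<delta>)\<^sup>2)) z))"
      using nrm[of "Some 0"] nrm[of "Some 1"] sp by (intro diff_indep_normal ind) auto
    then have "distributed M lborel (\<lambda>\<omega>. ?X (Some 0) \<omega> - ?X (Some 1) \<omega>)
        (\<lambda>z. ennreal (normal_density 0 (sqrt 2 * \<sigma>s * sqrt \<delta>) z))" unfolding s2 by simp
    then show "distributed (distr M (borel \<Otimes>\<^sub>M borel) (step_pair \<delta> m n x P S 0)) lborel (\<lambda>z. fst z - snd z)
        (\<lambda>z. ennreal (normal_density 0 (sqrt 2 * \<sigma>s * sqrt \<delta>) z))"
      by (intro diff) (simp_all add: step_pair_def)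
  qed (use pos in \<open>auto simp: add_pos_pos\<close>)
qed

end

section \<open>Reflected walks on fine grids\<close>

primrec reflected :: "(nat \<Rightarrow> real) \<Rightarrow> nat \<Rightarrow> real" where
  "reflected a 0 = 0"
| "reflected a (Suc k) = max 0 (reflected a k + a k)"

lemma reflected_nonneg: "0 \<le> reflected a k"
  by (cases k) auto

text \<open>The Skorokhod formula in discrete time. It links the step recursion with the infimum in
  \<open>B_tilde_plus\<close>.\<close>

lemma reflected_telescope:
  "reflected (\<lambda>i. f (Suc i) - f i) k = f k - Min (f ` {..k})"
proof (induction k)
  case (Suc k)
  have "Min (f ` {..Suc k}) = min (f (Suc k)) (Min (f ` {..k}))"
    by (simp add: atMost_Suc)
  moreover have "max 0 (a - \<mu> + (b - a)) = b - min b \<mu>" for a b \<mu> :: real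
    by (auto simp: max_def min_def)
  ultimately show ?case by (simp only: reflected.simps Suc.IH)
qed simp

lemma borel_measurable_reflected:
  "(\<And>i. i < k \<Longrightarrow> a i \<in> borel_measurable M) \<Longrightarrow> (\<lambda>\<omega>. reflected (\<lambda>i. a i \<omega>) k) \<in> borel_measurable M"
  by (induction k) auto

context gaussian_pair
begin

text \<open>With \<open>F\<close> as the conditional survival probability given the current state,
  the supermartingale bound applies to the chain \<open>T\<close>, and on the event the chain
  follows both reflected walks to the end, where \<open>F\<close> is 1.\<close>

lemma emeasure_separated_le_delayed_survival:
  assumes M: "prob_space M"
    and ind: "prob_space.indep_vars M (\<lambda>_. borel \<Otimes>\<^sub>M borel) \<xi> {..<m + n}"
    and law: "\<And>i. i < m + n \<Longrightarrow> distr M (borel \<Otimes>\<^sub>M borel) (\<xi> i) = \<nu>"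
  shows "emeasure M {\<omega> \<in> space M. \<forall>k\<le>n. reflected (\<lambda>i. snd (\<xi> (m + i) \<omega>)) k
      < reflected (\<lambda>i. fst (\<xi> i \<omega>)) (m + k)} \<le> delayed_survival n m 0"
    (is "emeasure M ?A \<le> _")
proof -
  interpret M: prob_space M by fact
  \<comment> \<open>Before time m the second walk is held at 0; afterwards the pair is frozen once
    it is no longer separated, in accordance with \<open>survival\<close> being 0 there.\<close>
  define step :: "nat \<Rightarrow> real \<times> real \<Rightarrow> real \<times> real \<Rightarrow> real \<times> real" where
    "step k s z = (if k < m then (max 0 (fst s + fst z), 0)
      else if snd s < fst s then (max 0 (fst s + fst z), max 0 (snd s + snd z)) else s)" for k s z
  define T where "T k \<omega> = rec_nat (0, 0) (\<lambda>k s. step k s (\<xi> k \<omega>)) k" for k \<omega>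
  define F where "F k s = (if k < m then delayed_survival n (m - k) (fst s)
    else survival (m + n - k) (fst s) (snd s))" for k and s :: "real \<times> real"
  have le: "(\<integral>\<^sup>+\<omega>. F (m + n) (T (m + n) \<omega>) \<partial>M) \<le> F 0 (0, 0)"
  proof (rule M.nn_integral_markov_chain_le[OF ind, where S="borel \<Otimes>\<^sub>M borel" and step=step and F=F
        and T=T and ?s0.0="(0, 0)"])
    fix k
    show "(\<lambda>(s, z). step k s z) \<in> (borel \<Otimes>\<^sub>M borel) \<Otimes>\<^sub>M (borel \<Otimes>\<^sub>M borel) \<rightarrow>\<^sub>M borel \<Otimes>\<^sub>M borel"
      unfolding step_def by measurable
    show "F k \<in> borel_measurable (borel \<Otimes>\<^sub>M borel)"
      unfolding F_def by measurable
    fix s :: "real \<times> real"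
    assume k: "k < m + n"
    show "(\<integral>\<^sup>+z. F (Suc k) (step k s z) \<partial>distr M (borel \<Otimes>\<^sub>M borel) (\<xi> k)) \<le> F k s"
    proof (cases "k < m")
      case True
      define j where "j = m - Suc k"
      have j: "m - k = Suc j" using True by (simp add: j_def)
      have "F (Suc k) (step k s z) = delayed_survival n j (max 0 (fst s + fst z))" for z
      proof (cases "Suc k < m")
        case False
        with True have "m = Suc k" by simp
        then show ?thesis by (simp add: F_def step_def j_def)
      qed (simp add: F_def step_def j_def)
      moreover have "F k s = delayed_survival n (Suc j) (fst s)" using True by (simp add: F_def j)
      ultimately show ?thesis using k by (simp add: law)
    next
      case False
      define j where "j = m + n - Suc k"
      have j: "m + n - k = Suc j" "m + n - Suc k = j" using k by (simp_all add: j_def)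
      have F: "F k s = survival (Suc j) (fst s) (snd s)" "F (Suc k) t = survival j (fst t) (snd t)" for t
        using False by (simp_all add: F_def j)
      show ?thesis unfolding F law[OF k] using False by (simp add: step_def survival_eq_0)
    qed
  qed (auto simp: T_def space_pair_measure)
  have T0: "T 0 \<omega> = (0, 0)" and TS: "T (Suc k) \<omega> = step k (T k \<omega>) (\<xi> k \<omega>)" for k \<omega>
    by (simp_all add: T_def)
  have T: "T k \<omega> = (reflected (\<lambda>i. fst (\<xi> i \<omega>)) k, 0)" if "k \<le> m" for k \<omega>
    using that by (induction k) (simp_all add: T0 TS step_def)
  have T': "T (m + k) \<omega> = (reflected (\<lambda>i. fst (\<xi> i \<omega>)) (m + k), reflected (\<lambda>i. snd (\<xi> (m + i) \<omega>)) k)"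
    if \<omega>: "\<omega> \<in> ?A" and "k \<le> n" for k \<omega>
    using that(2)
  proof (induction k)
    case 0
    show ?case using T[of m \<omega>] by simp
  next
    case (Suc k)
    then have "reflected (\<lambda>i. snd (\<xi> (m + i) \<omega>)) k < reflected (\<lambda>i. fst (\<xi> i \<omega>)) (m + k)"
      using \<omega> by simp
    then show ?case using Suc by (simp add: TS step_def)
  qed
  have F0: "F 0 (0, 0) = delayed_survival n m 0" by (cases m) (simp_all add: F_def)
  define A where "A = ?A"
  have "indicator A \<omega> \<le> F (m + n) (T (m + n) \<omega>)" for \<omega>
  proof (cases "\<omega> \<in> A")
    case True
    then have \<omega>: "\<omega> \<in> ?A" by (simp only: A_def)
    then have "reflected (\<lambda>i. snd (\<xi> (m + i) \<omega>)) n < reflected (\<lambda>i. fst (\<xi> i \<omega>)) (m + n)" by blast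
    then have "F (m + n) (T (m + n) \<omega>) = 1" unfolding T'[OF \<omega> order_refl] by (simp add: F_def)
    then show ?thesis using True by simp
  qed simp
  then have "(\<integral>\<^sup>+\<omega>. indicator A \<omega> \<partial>M) \<le> (\<integral>\<^sup>+\<omega>. F (m + n) (T (m + n) \<omega>) \<partial>M)"
    by (rule nn_integral_mono)
  also have "\<dots> \<le> delayed_survival n m 0" using le unfolding F0 .
  finally have "(\<integral>\<^sup>+\<omega>. indicator A \<omega> \<partial>M) \<le> delayed_survival n m 0" .
  \<comment> \<open>Measurability of the event is not at issue: otherwise its
    \<open>emeasure\<close> is 0 by convention.\<close>
  then have "emeasure M A \<le> delayed_survival n m 0"
    using emeasure_notin_sets[of A M] by (cases "A \<in> sets M") (simp_all add: nn_integral_indicator)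
  then show ?thesis by (simp only: A_def)
qed

lemma emeasure_reflected_eq_0_le:
  assumes M: "prob_space M"
    and ind: "prob_space.indep_vars M (\<lambda>_. borel \<Otimes>\<^sub>M borel) \<xi> {..<n}"
    and law: "\<And>i. i < n \<Longrightarrow> distr M (borel \<Otimes>\<^sub>M borel) (\<xi> i) = \<nu>"
  shows "emeasure M {\<omega> \<in> space M. reflected (\<lambda>i. fst (\<xi> i \<omega>)) n = 0} \<le> zero_probability n 0"
    (is "emeasure M ?A \<le> _")
proof -
  interpret M: prob_space M by fact
  \<comment> \<open>The constant second coordinate gives the states the same type as the steps, as
    the chain lemma requires.\<close>
  define step :: "nat \<Rightarrow> real \<times> real \<Rightarrow> real \<times> real \<Rightarrow> real \<times> real" where
    "step k s z = (max 0 (fst s + fst z), 0)" for k s z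
  define T where "T k \<omega> = (reflected (\<lambda>i. fst (\<xi> i \<omega>)) k, 0::real)" for k \<omega>
  define F where "F k s = zero_probability (n - k) (fst s)" for k and s :: "real \<times> real"
  have le: "(\<integral>\<^sup>+\<omega>. F n (T n \<omega>) \<partial>M) \<le> F 0 (0, 0)"
  proof (rule M.nn_integral_markov_chain_le[OF ind, where S="borel \<Otimes>\<^sub>M borel" and step=step and F=F
        and T=T and ?s0.0="(0, 0)"])
    fix k
    show "(\<lambda>(s, z). step k s z) \<in> (borel \<Otimes>\<^sub>M borel) \<Otimes>\<^sub>M (borel \<Otimes>\<^sub>M borel) \<rightarrow>\<^sub>M borel \<Otimes>\<^sub>M borel"
      unfolding step_def by measurable
    show "F k \<in> borel_measurable (borel \<Otimes>\<^sub>M borel)"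
      unfolding F_def by measurable
    fix s :: "real \<times> real"
    assume k: "k < n"
    define j where "j = n - Suc k"
    have j: "n - k = Suc j" "n - Suc k = j" using k by (simp_all add: j_def)
    show "(\<integral>\<^sup>+z. F (Suc k) (step k s z) \<partial>distr M (borel \<Otimes>\<^sub>M borel) (\<xi> k)) \<le> F k s"
      using k by (simp add: law F_def step_def j)
  qed (auto simp: T_def step_def space_pair_measure)
  define A where "A = ?A"
  have "indicator A \<omega> \<le> F n (T n \<omega>)" for \<omega>
    by (auto simp: A_def F_def T_def indicator_def)
  then have "(\<integral>\<^sup>+\<omega>. indicator A \<omega> \<partial>M) \<le> (\<integral>\<^sup>+\<omega>. F n (T n \<omega>) \<partial>M)"
    by (rule nn_integral_mono)
  also have "\<dots> \<le> zero_probability n 0" using le by (simp add: F_def)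
  finally have "(\<integral>\<^sup>+\<omega>. indicator A \<omega> \<partial>M) \<le> zero_probability n 0" .
  then have "emeasure M A \<le> zero_probability n 0"
    using emeasure_notin_sets[of A M] by (cases "A \<in> sets M") (simp_all add: nn_integral_indicator)
  then show ?thesis by (simp only: A_def)
qed

end

section \<open>Continuous reflected paths and their grid walks\<close>

definition running_excess :: "real \<Rightarrow> (real \<Rightarrow> real) \<Rightarrow> real \<Rightarrow> real" where
  "running_excess a f y = f y - (INF u\<in>{a..y}. f u)"

lemma bdd_below_image_Icc:
  fixes f :: "real \<Rightarrow> real"
  assumes "continuous_on {a..b} f" "y \<le> b"
  shows "bdd_below (f ` {a..y})"
  using assms by (intro bounded_imp_bdd_below compact_imp_bounded compact_continuous_image)
    (auto intro: continuous_on_subset)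

lemma running_excess_nonneg:
  assumes "continuous_on {a..b} f" "a \<le> y" "y \<le> b"
  shows "0 \<le> running_excess a f y"
  using cINF_lower[OF bdd_below_image_Icc[OF assms(1,3)], of y] assms by (simp add: running_excess_def)

lemma uniform_modulus:
  fixes f :: "real \<Rightarrow> real"
  assumes "continuous_on {a..b} f" "0 < e"
  obtains d where "0 < d" "\<And>u v. u \<in> {a..b} \<Longrightarrow> v \<in> {a..b} \<Longrightarrow> \<bar>u - v\<bar> < d \<Longrightarrow> \<bar>f u - f v\<bar> < e"
proof -
  have "uniformly_continuous_on {a..b} f"
    using assms(1) by (intro compact_uniformly_continuous) auto
  then obtain d where "0 < d" "\<And>u v. u \<in> {a..b} \<Longrightarrow> v \<in> {a..b} \<Longrightarrow> dist v u < d \<Longrightarrow> dist (f v) (f u) < e"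
    using assms(2) unfolding uniformly_continuous_on_def by metis
  then show ?thesis using that[of d] by (simp add: dist_real_def)
qed

text \<open>The running infimum inherits the modulus of continuity of f: extending the interval from
  v to w lowers it by at most the oscillation of f on [v, w].\<close>

lemma continuous_on_running_excess:
  assumes f: "continuous_on {a..b} f"
  shows "continuous_on {a..b} (running_excess a f)"
proof -
  have "continuous_on {a..b} (\<lambda>y. INF u\<in>{a..y}. f u)"
    unfolding continuous_on_iff
  proof (intro ballI allI impI)
    fix y e :: real assume y: "y \<in> {a..b}" and e: "0 < e"
    have "0 < e / 2" using e by simp
    from uniform_modulus[OF f this] obtain d where d: "0 < d"
      "\<And>u v. u \<in> {a..b} \<Longrightarrow> v \<in> {a..b} \<Longrightarrow> \<bar>u - v\<bar> < d \<Longrightarrow> \<bar>f u - f v\<bar> < e / 2" by metis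
    have close: "(INF u\<in>{a..v}. f u) \<le> (INF u\<in>{a..w}. f u) + e / 2 \<and> (INF u\<in>{a..w}. f u) \<le> (INF u\<in>{a..v}. f u)"
      if vw: "v \<in> {a..b}" "w \<in> {a..b}" "v \<le> w" "w - v < d" for v w
    proof
      show "(INF u\<in>{a..w}. f u) \<le> (INF u\<in>{a..v}. f u)"
        using vw bdd_below_image_Icc[OF f, of w] by (intro cINF_superset_mono) auto
      have "(INF u\<in>{a..v}. f u) - e / 2 \<le> (INF u\<in>{a..w}. f u)"
      proof (rule cINF_greatest)
        fix u assume u: "u \<in> {a..w}"
        show "(INF u\<in>{a..v}. f u) - e / 2 \<le> f u"
        proof (cases "u \<le> v")
          case True
          then have "(INF u\<in>{a..v}. f u) \<le> f u"
            using u vw bdd_below_image_Icc[OF f, of v] by (intro cINF_lower) auto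
          then show ?thesis using e by simp
        next
          case False
          have "(INF u\<in>{a..v}. f u) \<le> f v"
            using vw bdd_below_image_Icc[OF f, of v] by (intro cINF_lower) auto
          moreover have "\<bar>f u - f v\<bar> < e / 2" using False u vw by (intro d(2)) auto
          ultimately show ?thesis by linarith
        qed
      qed (use vw in auto)
      then show "(INF u\<in>{a..v}. f u) \<le> (INF u\<in>{a..w}. f u) + e / 2" by simp
    qed
    show "\<exists>d>0. \<forall>y'\<in>{a..b}. dist y' y < d \<longrightarrow> dist (INF u\<in>{a..y'}. f u) (INF u\<in>{a..y}. f u) < e"
    proof (intro exI[of _ d] conjI ballI impI)
      fix y' assume y': "y' \<in> {a..b}" "dist y' y < d"
      show "dist (INF u\<in>{a..y'}. f u) (INF u\<in>{a..y}. f u) < e"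
      proof (cases "y' \<le> y")
        case True
        then show ?thesis using close[of y' y] y y' e by (simp add: dist_real_def abs_if split: if_splits)
      next
        case False
        then show ?thesis using close[of y y'] y y' e by (simp add: dist_real_def abs_if split: if_splits)
      qed
    qed (rule d(1))
  qed
  then show ?thesis unfolding running_excess_def[abs_def] using f by (intro continuous_on_diff)
qed

text \<open>A minimum over grid points is at least the infimum over the whole interval.\<close>

lemma reflected_grid_le:
  assumes f: "continuous_on {a..b} f" and \<delta>: "0 < \<delta>" and k: "a + real k * \<delta> \<le> b"
  shows "reflected (\<lambda>i. f (a + real (Suc i) * \<delta>) - f (a + real i * \<delta>)) k \<le> running_excess a f (a + real k * \<delta>)"
proof -
  have "(INF u\<in>{a..a + real k * \<delta>}. f u) \<le> Min ((\<lambda>i. f (a + real i * \<delta>)) ` {..k})"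
  proof (intro Min.boundedI)
    fix v assume "v \<in> (\<lambda>i. f (a + real i * \<delta>)) ` {..k}"
    then obtain i where "i \<le> k" and v: "v = f (a + real i * \<delta>)" by auto
    then have "a + real i * \<delta> \<in> {a..a + real k * \<delta>}" using \<delta> by (auto intro!: mult_right_mono)
    then show "(INF u\<in>{a..a + real k * \<delta>}. f u) \<le> v"
      unfolding v using bdd_below_image_Icc[OF f k] by (intro cINF_lower) auto
  qed auto
  then show ?thesis
    using reflected_telescope[of "\<lambda>i. f (a + real i * \<delta>)" k] by (simp add: running_excess_def)
qed

text \<open>Every point has a grid point less than d to its left, so the grid minimum exceeds the
  infimum by at most e.\<close>

lemma running_excess_le_reflected_grid:
  assumes \<delta>: "0 < \<delta>" "\<delta> < d" and k: "a + real k * \<delta> \<le> b"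
    and mod: "\<And>u v. u \<in> {a..b} \<Longrightarrow> v \<in> {a..b} \<Longrightarrow> \<bar>u - v\<bar> < d \<Longrightarrow> \<bar>f u - f v\<bar> < e"
  shows "running_excess a f (a + real k * \<delta>) \<le> reflected (\<lambda>i. f (a + real (Suc i) * \<delta>) - f (a + real i * \<delta>)) k + e"
proof -
  have "Min ((\<lambda>i. f (a + real i * \<delta>)) ` {..k}) - e \<le> (INF u\<in>{a..a + real k * \<delta>}. f u)"
  proof (rule cINF_greatest)
    show "{a..a + real k * \<delta>} \<noteq> {}" using \<delta> by auto
    fix u assume u: "u \<in> {a..a + real k * \<delta>}"
    define i where "i = nat \<lfloor>(u - a) / \<delta>\<rfloor>"
    have i: "real i \<le> (u - a) / \<delta>" "(u - a) / \<delta> < real i + 1"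
      using u \<delta> by (simp_all add: i_def)
    have "(u - a) / \<delta> \<le> real k" using u \<delta> by (simp add: field_simps)
    with i(1) have ik: "i \<le> k" by simp
    have "real i * \<delta> \<le> u - a" "u - a < real i * \<delta> + \<delta>" using i \<delta> by (simp_all add: field_simps)
    moreover have "0 \<le> real i * \<delta>" using \<delta> by simp
    ultimately have "\<bar>f (a + real i * \<delta>) - f u\<bar> < e"
      using u k \<delta> by (intro mod) auto
    moreover have "Min ((\<lambda>i. f (a + real i * \<delta>)) ` {..k}) \<le> f (a + real i * \<delta>)"
      using ik by (intro Min_le) auto
    ultimately show "Min ((\<lambda>i. f (a + real i * \<delta>)) ` {..k}) - e \<le> f u" by linarith
  qed
  then show ?thesis
    using reflected_telescope[of "\<lambda>i. f (a + real i * \<delta>)" k] unfolding running_excess_def by linarith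
qed

text \<open>By compactness, paths that never meet keep a positive distance. Discretisation lowers
  the upper path by at most e, half the least distance, and never raises the lower path.\<close>

lemma separated_on_fine_grids:
  assumes f: "continuous_on {- x1..0} f" and g: "continuous_on {- x0..0} g"
    and x: "0 \<le> x0" "x0 \<le> x1"
    and ne: "\<And>y. y \<in> {- x0..0} \<Longrightarrow> running_excess (- x0) g y \<noteq> running_excess (- x1) f y"
  obtains d where "0 < d" "\<And>\<delta> m n k. 0 < \<delta> \<Longrightarrow> \<delta> < d \<Longrightarrow> x1 = real (m + n) * \<delta> \<Longrightarrow> x0 = real n * \<delta> \<Longrightarrow> k \<le> n \<Longrightarrow>
    reflected (\<lambda>i. g (- x0 + real (Suc i) * \<delta>) - g (- x0 + real i * \<delta>)) k
    < reflected (\<lambda>i. f (- x1 + real (Suc i) * \<delta>) - f (- x1 + real i * \<delta>)) (m + k)"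
proof -
  define h where "h y = running_excess (- x1) f y - running_excess (- x0) g y" for y
  have cont: "continuous_on {- x0..0} h"
    unfolding h_def using continuous_on_running_excess[OF f] continuous_on_running_excess[OF g] x
    by (intro continuous_on_diff) (auto intro: continuous_on_subset)
  have "running_excess (- x0) g (- x0) = 0" by (simp add: running_excess_def)
  then have h0: "0 \<le> h (- x0)" using running_excess_nonneg[OF f, of "- x0"] x by (simp add: h_def)
  \<comment> \<open>The lower path starts at 0, so \<open>h\<close> is nonnegative at the left end,
    and a later nonpositive value would force a meeting.\<close>
  have pos: "0 < h y" if y: "y \<in> {- x0..0}" for y
  proof (rule ccontr)
    assume "\<not> 0 < h y"
    then obtain z where "z \<in> {- x0..y}" "h z = 0"
      using IVT2'[of h y 0 "- x0"] h0 y continuous_on_subset[OF cont, of "{- x0..y}"] by auto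
    then show False using ne[of z] y by (auto simp: h_def)
  qed
  obtain y0 where y0: "y0 \<in> {- x0..0}" "\<And>y. y \<in> {- x0..0} \<Longrightarrow> h y0 \<le> h y"
    using continuous_attains_inf[OF _ _ cont] x by auto
  define e where "e = h y0 / 2"
  have e: "0 < e" "e < h y0" using pos[OF y0(1)] by (simp_all add: e_def)
  from uniform_modulus[OF f e(1)] obtain d where d: "0 < d"
    "\<And>u v. u \<in> {- x1..0} \<Longrightarrow> v \<in> {- x1..0} \<Longrightarrow> \<bar>u - v\<bar> < d \<Longrightarrow> \<bar>f u - f v\<bar> < e" by metis
  show ?thesis
  proof (rule that[OF d(1)])
    fix \<delta> m n k
    assume \<delta>: "0 < \<delta>" "\<delta> < d" "x1 = real (m + n) * \<delta>" "x0 = real n * \<delta>" "k \<le> n"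
    have kn: "real k * \<delta> \<le> real n * \<delta>" using \<delta> by (intro mult_right_mono) auto
    have eq: "- x1 + real (m + k) * \<delta> = - x0 + real k * \<delta>" using \<delta> by (simp add: algebra_simps)
    have in0: "- x0 + real k * \<delta> \<in> {- x0..0}" using kn \<delta> by auto
    have "h y0 \<le> h (- x0 + real k * \<delta>)" by (rule y0(2)[OF in0])
    moreover have "running_excess (- x1) f (- x1 + real (m + k) * \<delta>) \<le>
        reflected (\<lambda>i. f (- x1 + real (Suc i) * \<delta>) - f (- x1 + real i * \<delta>)) (m + k) + e"
      using in0 by (intro running_excess_le_reflected_grid[OF \<delta>(1,2) _ d(2)]) (simp_all only: eq atLeastAtMost_iff)
    moreover have "reflected (\<lambda>i. g (- x0 + real (Suc i) * \<delta>) - g (- x0 + real i * \<delta>)) k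
        \<le> running_excess (- x0) g (- x0 + real k * \<delta>)"
      using in0 \<delta> by (intro reflected_grid_le[OF g]) auto
    ultimately show "reflected (\<lambda>i. g (- x0 + real (Suc i) * \<delta>) - g (- x0 + real i * \<delta>)) k
      < reflected (\<lambda>i. f (- x1 + real (Suc i) * \<delta>) - f (- x1 + real i * \<delta>)) (m + k)"
      using e(2) unfolding eq h_def by linarith
  qed
qed

section \<open>The two-point bound\<close>

lemma B_tilde_plus_eq: "B_tilde_plus x p s i = running_excess (- x i) (B_tilde x p s i)"
  by (simp add: fun_eq_iff B_tilde_plus_def running_excess_def)

lemma B_plus_last: "B_plus x p s k k = B_tilde_plus x p s k"
  by (simp add: B_plus.simps)

text \<open>A meeting anywhere in the interval gives a meeting time of at most 0, and then the
  recursion hands the value at 0 over from index 1 to index 0.\<close>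

lemma no_meeting_if_end_values_differ:
  assumes "B_plus x p s 1 0 0 \<noteq> B_plus x p s 1 1 0" "y \<in> {- x 0..0}"
  shows "B_tilde_plus x p s 0 y \<noteq> B_tilde_plus x p s 1 y"
proof
  assume eq: "B_tilde_plus x p s 0 y = B_tilde_plus x p s 1 y"
  have B1: "B_plus x p s 1 1 = B_tilde_plus x p s 1" by (rule B_plus_last)
  have "meeting_time (- x 0) (B_tilde_plus x p s 0) (B_tilde_plus x p s 1) \<le> ereal y"
    unfolding meeting_time_def using assms(2) eq by (intro Inf_lower) auto
  also have "\<dots> \<le> ereal 0" using assms(2) by simp
  finally have "\<not> ereal 0 < meeting_time (- x 0) (B_tilde_plus x p s 0) (B_plus x p s 1 (Suc 0))"
    using B1 by (simp add: not_less)
  then have "B_plus x p s 1 0 0 = B_plus x p s 1 (Suc 0) 0"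
    by (subst B_plus.simps) simp
  then show False using assms(1) by simp
qed

lemma driving_noise_paths:
  assumes noise: "driving_noise M \<sigma>s \<sigma>p k x P S" and i: "i \<le> k" and x: "0 \<le> x i" and \<omega>: "\<omega> \<in> space M"
  shows "continuous_on {- x i..0} (B_tilde x (\<lambda>y. P y \<omega>) (\<lambda>j y. S j y \<omega>) i)"
proof -
  have "brownian_motion M \<sigma>p (\<lambda>t. P (- t))" "brownian_motion M \<sigma>s (\<lambda>t. S i (- x i + t))"
    using noise i by (auto simp: driving_noise_def)
  from this[THEN brownian_motion_continuous, OF \<omega>]
  have c: "continuous_on {0..} (\<lambda>t. P (- t) \<omega>)" "continuous_on {0..} (\<lambda>t. S i (- x i + t) \<omega>)" .
  have "continuous_on {- x i..0} (\<lambda>y. P (- (- y)) \<omega>)"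
    by (rule continuous_on_compose2[OF c(1)]) (auto intro!: continuous_intros)
  moreover have "continuous_on {- x i..0} (\<lambda>y. S i (- x i + (x i + y)) \<omega>)"
    by (rule continuous_on_compose2[OF c(2)]) (auto intro!: continuous_intros)
  ultimately show ?thesis
    unfolding B_tilde_def[abs_def] by (auto intro!: continuous_intros)
qed

lemma fst_step_pair:
  "fst (step_pair \<delta> m n x P S i \<omega>) =
    B_tilde x (\<lambda>y. P y \<omega>) (\<lambda>j y. S j y \<omega>) 1 (- x 1 + real (Suc i) * \<delta>)
    - B_tilde x (\<lambda>y. P y \<omega>) (\<lambda>j y. S j y \<omega>) 1 (- x 1 + real i * \<delta>)"
  by (simp add: step_pair_def noise_step_def B_tilde_def)

text \<open>After m steps the grid from \<open>- x 1\<close> reaches \<open>- x 0\<close>, and from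
  there on \<open>noise_step\<close> reads S 0 in its natural order.\<close>

lemma snd_step_pair:
  assumes "x 1 = real (m + n) * \<delta>" "x 0 = real n * \<delta>"
  shows "snd (step_pair \<delta> m n x P S (m + i) \<omega>) =
    B_tilde x (\<lambda>y. P y \<omega>) (\<lambda>j y. S j y \<omega>) 0 (- x 0 + real (Suc i) * \<delta>)
    - B_tilde x (\<lambda>y. P y \<omega>) (\<lambda>j y. S j y \<omega>) 0 (- x 0 + real i * \<delta>)"
proof -
  have "- x 1 + real (Suc (m + i)) * \<delta> = - x 0 + real (Suc i) * \<delta>"
    "- x 1 + real (m + i) * \<delta> = - x 0 + real i * \<delta>"
    using assms by (simp_all add: algebra_simps)
  then show ?thesis by (simp add: step_pair_def noise_step_def B_tilde_def)
qed

lemma step_pair_measurable: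
  assumes noise: "driving_noise M \<sigma>s \<sigma>p 1 x P S"
    and pos: "0 < \<sigma>s" "0 < \<sigma>p" "0 < \<delta>" "0 < m + n"
    and x1: "x 1 = real (m + n) * \<delta>" and i: "i < m + n"
  shows "(\<lambda>\<omega>. fst (step_pair \<delta> m n x P S i \<omega>)) \<in> borel_measurable M"
    and "(\<lambda>\<omega>. snd (step_pair \<delta> m n x P S i \<omega>)) \<in> borel_measurable M"
proof -
  interpret prob_space M using noise by (simp add: driving_noise_def brownian_motion_def)
  have [measurable]: "step_pair \<delta> m n x P S i \<in> M \<rightarrow>\<^sub>M borel \<Otimes>\<^sub>M borel"
    using step_pair_indep[OF noise pos x1] i unfolding indep_vars_def by blast
  show "(\<lambda>\<omega>. fst (step_pair \<delta> m n x P S i \<omega>)) \<in> borel_measurable M"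
    "(\<lambda>\<omega>. snd (step_pair \<delta> m n x P S i \<omega>)) \<in> borel_measurable M" by measurable
qed

text \<open>On \<open>A\<close> the paths never meet, so the grid walks are separated from some mesh
  on. The mesh tends to 0 for fixed \<open>\<epsilon>\<close>, and \<open>\<epsilon>\<close> tends
  to 0 only afterwards, because the errors have powers of it in the denominator.\<close>

lemma measure_end_values_differ_le:
  assumes noise: "driving_noise M \<sigma>s \<sigma>p 1 x P S"
    and \<sigma>: "0 < \<sigma>s" "0 < \<sigma>p" and h: "0 < h" and i: "0 < i"
    and x0: "x 0 = real i * h" and x1: "x 1 = real (Suc i) * h"
    and A: "A \<in> sets M" "\<And>\<omega>. \<omega> \<in> A \<Longrightarrow>
      B_plus x (\<lambda>y. P y \<omega>) (\<lambda>j y. S j y \<omega>) 1 0 0 \<noteq> B_plus x (\<lambda>y. P y \<omega>) (\<lambda>j y. S j y \<omega>) 1 1 0"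
  shows "measure M A \<le> (4 / sqrt (2 * pi) * sqrt ((1 + (\<sigma>p / \<sigma>s)\<^sup>2) / 2)) / real i"
proof -
  interpret M: prob_space M using noise by (simp add: driving_noise_def brownian_motion_def)
  \<comment> \<open>An even number of steps per interval of length h makes \<open>n N\<close> twice
    the integer \<open>i * Suc N\<close>, the form needed in
    \<open>delayed_survival_le\<close>.\<close>
  define \<delta> where "\<delta> N = h / (2 * real (Suc N))" for N
  define m where "m N = 2 * Suc N" for N :: nat
  define n where "n N = 2 * (i * Suc N)" for N
  have \<delta>: "0 < \<delta> N" for N using h by (simp add: \<delta>_def)
  have x0': "x 0 = real (n N) * \<delta> N" for N
    by (simp add: x0 \<delta>_def n_def field_simps)
  have x1': "x 1 = real (m N + n N) * \<delta> N" for N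
    unfolding x1 \<delta>_def n_def m_def by (simp add: field_simps del: of_nat_Suc) (simp add: algebra_simps)
  have mn: "0 < m N + n N" for N by (simp add: m_def)
  define E where "E N = {\<omega> \<in> space M. \<forall>k\<le>n N.
      reflected (\<lambda>i. snd (step_pair (\<delta> N) (m N) (n N) x P S (m N + i) \<omega>)) k
      < reflected (\<lambda>i. fst (step_pair (\<delta> N) (m N) (n N) x P S i \<omega>)) (m N + k)}" for N
  have E_sets: "E N \<in> sets M" for N
  proof -
    note sm = step_pair_measurable[OF noise \<sigma> \<delta> mn x1', of _ N]
    have "(\<lambda>\<omega>. reflected (\<lambda>i. snd (step_pair (\<delta> N) (m N) (n N) x P S (m N + i) \<omega>)) k) \<in> borel_measurable M"
      if "k \<le> n N" for k
      by (rule borel_measurable_reflected, rule sm) (use that in simp)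
    moreover have "(\<lambda>\<omega>. reflected (\<lambda>i. fst (step_pair (\<delta> N) (m N) (n N) x P S i \<omega>)) (m N + k)) \<in> borel_measurable M"
      if "k \<le> n N" for k
      by (rule borel_measurable_reflected, rule sm) (use that in simp)
    ultimately have "{\<omega> \<in> space M. reflected (\<lambda>i. snd (step_pair (\<delta> N) (m N) (n N) x P S (m N + i) \<omega>)) k
      < reflected (\<lambda>i. fst (step_pair (\<delta> N) (m N) (n N) x P S i \<omega>)) (m N + k)} \<in> sets M" if "k \<in> {..n N}" for k
      by (rule borel_measurable_less) (use that in auto)
    then have "{\<omega> \<in> space M. \<forall>k\<in>{..n N}. reflected (\<lambda>i. snd (step_pair (\<delta> N) (m N) (n N) x P S (m N + i) \<omega>)) k
      < reflected (\<lambda>i. fst (step_pair (\<delta> N) (m N) (n N) x P S i \<omega>)) (m N + k)} \<in> sets M"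
      by (rule sets.sets_Collect_finite_All) auto
    then show ?thesis unfolding E_def Ball_def atMost_iff .
  qed
  define bound where "bound N \<epsilon> =
    2 / (sqrt (2 * pi) * (sqrt (real (i * Suc N)) * (sqrt 2 * \<sigma>s * sqrt (\<delta> N)))) *
      (real (m N) / real (i * Suc N) * (sqrt (real (i * Suc N)) * (sqrt (\<sigma>p\<^sup>2 + \<sigma>s\<^sup>2) * sqrt (\<delta> N))) + \<epsilon>
      + real (i * Suc N) * (3 * (sqrt 2 * \<sigma>s * sqrt (\<delta> N)) ^ 4 / \<epsilon> ^ 3))
    + real (i * Suc N) * (3 * (sqrt 2 * \<sigma>s * sqrt (\<delta> N)) ^ 4 / \<epsilon> ^ 4)" for N \<epsilon>
  have bound0: "0 \<le> bound N \<epsilon>" if "0 < \<epsilon>" for N \<epsilon>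
    using that \<sigma> \<delta>[of N] i unfolding bound_def by (intro add_nonneg_nonneg mult_nonneg_nonneg divide_nonneg_nonneg) auto
  have E_le: "measure M (E N) \<le> bound N \<epsilon>" if \<epsilon>: "0 < \<epsilon>" for N \<epsilon>
  proof -
    interpret G: gaussian_pair "distr M (borel \<Otimes>\<^sub>M borel) (step_pair (\<delta> N) (m N) (n N) x P S 0)"
      "sqrt (\<sigma>p\<^sup>2 + \<sigma>s\<^sup>2) * sqrt (\<delta> N)" "sqrt 2 * \<sigma>s * sqrt (\<delta> N)"
      by (rule step_pair_gaussian[OF noise \<sigma> \<delta> mn x1'])
    have "emeasure M (E N) \<le> G.delayed_survival (n N) (m N) 0"
      unfolding E_def
      by (rule G.emeasure_separated_le_delayed_survival[OF M.prob_space_axioms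
          step_pair_indep[OF noise \<sigma> \<delta> mn x1'] step_pair_law[OF noise \<sigma> \<delta> mn x1']])
    also have "G.delayed_survival k (m N) 0 \<le> ennreal (bound N \<epsilon>)" if k: "k = 2 * (i * Suc N)" for k
      unfolding k bound_def by (rule G.delayed_survival_le[OF \<epsilon>]) (use i in simp)
    from this[OF n_def] have "G.delayed_survival (n N) (m N) 0 \<le> ennreal (bound N \<epsilon>)" .
    finally show ?thesis using bound0[OF \<epsilon>] by (simp add: M.emeasure_eq_measure)
  qed
  have limit: "(\<lambda>N. bound N \<epsilon>) \<longlonglongrightarrow>
      2 / (sqrt (2 * pi) * (sqrt (real i * h) * \<sigma>s)) *
        (2 / real i * (sqrt (real i * h / 2) * sqrt (\<sigma>p\<^sup>2 + \<sigma>s\<^sup>2)) + \<epsilon>)" if \<epsilon>: "0 < \<epsilon>" for \<epsilon>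
  proof -
    have q: "0 < real (Suc N)" "real (i * Suc N) = real i * real (Suc N)"
      "\<delta> N = h / (2 * real (Suc N))" "real (m N) = 2 * real (Suc N)" for N
      by (simp_all only: \<delta>_def m_def of_nat_mult of_nat_numeral of_nat_0_less_iff zero_less_Suc)
    \<comment> \<open>One half of the common steps takes the time \<open>i * h / 2\<close>, whatever
      the mesh.\<close>
    have a: "sqrt (real (i * Suc N)) * (c * sqrt (\<delta> N)) = sqrt (real i * h / 2) * c" for c N
    proof -
      have "real (i * Suc N) * \<delta> N = real i * h / 2"
        unfolding q using q(1)[of N] by (simp del: of_nat_Suc)
      then have "sqrt (real (i * Suc N)) * sqrt (\<delta> N) = sqrt (real i * h / 2)"
        by (simp only: real_sqrt_mult[symmetric])
      then show ?thesis by (simp only: mult_ac)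
    qed
    \<comment> \<open>The fourth moment of a step is of order 1/N^2 and the number of steps of order
      N, so the errors vanish like 1/N.\<close>
    have b: "real (i * Suc N) * (3 * (sqrt 2 * \<sigma>s * sqrt (\<delta> N)) ^ 4 / e) = (3 * real i * \<sigma>s ^ 4 * h\<^sup>2 / e) * inverse (real (Suc N))" for e N
    proof -
      have p4: "sqrt y ^ 4 = y\<^sup>2" if "0 \<le> y" for y :: real
      proof -
        have "sqrt y ^ 4 = ((sqrt y)\<^sup>2)\<^sup>2" by (simp only: power_mult[symmetric]) simp
        then show ?thesis using that by simp
      qed
      have "(sqrt 2 * \<sigma>s * sqrt (\<delta> N)) ^ 4 = 4 * \<sigma>s ^ 4 * (h / (2 * real (Suc N)))\<^sup>2"
        using \<delta>[of N] by (simp only: power_mult_distrib p4 less_imp_le zero_le_numeral q(3)[symmetric]) simp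
      moreover have "real i * r * (3 * (4 * \<sigma>s ^ 4 * (h / (2 * r))\<^sup>2) / e) = (3 * real i * \<sigma>s ^ 4 * h\<^sup>2 / e) * inverse r"
        if "0 < r" for r :: real
        using that by (simp add: power_divide power_mult_distrib field_simps power2_eq_square)
      ultimately show ?thesis unfolding q(2) using q(1)[of N] by (simp only:)
    qed
    have c: "real (m N) / real (i * Suc N) = 2 / real i" for N
      unfolding q using q(1)[of N] by (simp del: of_nat_Suc)
    have d: "sqrt (real i * h / 2) * (sqrt 2 * \<sigma>s) = sqrt (real i * h) * \<sigma>s"
      by (simp add: real_sqrt_divide)
    have "(\<lambda>N. 2 / (sqrt (2 * pi) * (sqrt (real i * h) * \<sigma>s)) *
        (2 / real i * (sqrt (real i * h / 2) * sqrt (\<sigma>p\<^sup>2 + \<sigma>s\<^sup>2)) + \<epsilon>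
          + (3 * real i * \<sigma>s ^ 4 * h\<^sup>2 / \<epsilon> ^ 3) * inverse (real (Suc N)))
        + (3 * real i * \<sigma>s ^ 4 * h\<^sup>2 / \<epsilon> ^ 4) * inverse (real (Suc N))) \<longlonglongrightarrow>
      2 / (sqrt (2 * pi) * (sqrt (real i * h) * \<sigma>s)) *
        (2 / real i * (sqrt (real i * h / 2) * sqrt (\<sigma>p\<^sup>2 + \<sigma>s\<^sup>2)) + \<epsilon>
          + (3 * real i * \<sigma>s ^ 4 * h\<^sup>2 / \<epsilon> ^ 3) * 0)
        + (3 * real i * \<sigma>s ^ 4 * h\<^sup>2 / \<epsilon> ^ 4) * 0"
      by (intro tendsto_intros LIMSEQ_inverse_real_of_nat)
    then show ?thesis
      unfolding bound_def a b c d by simp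
  qed
  have sub: "A \<subseteq> (\<Union>N. \<Inter>N'\<in>{N..}. E N')"
  proof
    fix \<omega> assume \<omega>: "\<omega> \<in> A"
    then have sp: "\<omega> \<in> space M" using A(1) sets.sets_into_space by auto
    let ?B = "B_tilde x (\<lambda>y. P y \<omega>) (\<lambda>j y. S j y \<omega>)"
    have xs: "0 \<le> x 0" "x 0 \<le> x 1" "0 \<le> x 1" using h unfolding x0 x1 by (auto intro!: mult_right_mono)
    obtain d where d: "0 < d" "\<And>\<delta> m n k. 0 < \<delta> \<Longrightarrow> \<delta> < d \<Longrightarrow> x 1 = real (m + n) * \<delta> \<Longrightarrow> x 0 = real n * \<delta> \<Longrightarrow> k \<le> n \<Longrightarrow>
      reflected (\<lambda>i. ?B 0 (- x 0 + real (Suc i) * \<delta>) - ?B 0 (- x 0 + real i * \<delta>)) k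
      < reflected (\<lambda>i. ?B 1 (- x 1 + real (Suc i) * \<delta>) - ?B 1 (- x 1 + real i * \<delta>)) (m + k)"
    proof (rule separated_on_fine_grids)
      show "continuous_on {- x 1..0} (?B 1)" "continuous_on {- x 0..0} (?B 0)"
        using driving_noise_paths[OF noise _ _ sp] xs by auto
      show "running_excess (- x 0) (?B 0) y \<noteq> running_excess (- x 1) (?B 1) y" if "y \<in> {- x 0..0}" for y
        using no_meeting_if_end_values_differ[OF A(2)[OF \<omega>] that] by (simp add: B_tilde_plus_eq)
    qed (use xs in auto)
    have "\<delta> \<longlonglongrightarrow> 0"
    proof -
      have "(\<lambda>N. h / 2 * inverse (real (Suc N))) \<longlonglongrightarrow> h / 2 * 0"
        by (intro tendsto_intros LIMSEQ_inverse_real_of_nat)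
      moreover have "\<delta> = (\<lambda>N. h / 2 * inverse (real (Suc N)))" by (auto simp: \<delta>_def field_simps)
      ultimately show ?thesis by simp
    qed
    then have "eventually (\<lambda>N. \<delta> N < d) sequentially" using d(1) by (rule order_tendstoD)
    then obtain N0 where "\<And>N. N0 \<le> N \<Longrightarrow> \<delta> N < d" by (auto simp: eventually_sequentially)
    then have "\<omega> \<in> E N" if "N0 \<le> N" for N
      unfolding E_def fst_step_pair snd_step_pair[OF x1' x0'] using d(2)[OF \<delta> _ x1' x0'] that sp by simp
    then show "\<omega> \<in> (\<Union>N. \<Inter>N'\<in>{N..}. E N')" by blast
  qed
  \<comment> \<open>The sets \<open>E N\<close> need not be monotone, but these tail intersections
    increase, so a bound on each of them passes to their union and hence to
    \<open>A\<close>.\<close>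
  define D where "D N = (\<Inter>N'\<in>{N..}. E N')" for N
  have D_sets: "D N \<in> sets M" for N unfolding D_def using E_sets by (intro sets.countable_INT') auto
  have A_lim: "measure M A \<le> l" if "\<And>N. measure M (D N) \<le> l" for l
  proof -
    have "(\<lambda>N. measure M (D N)) \<longlonglongrightarrow> measure M (\<Union>N. D N)"
      using D_sets by (intro M.finite_Lim_measure_incseq) (auto simp: incseq_def D_def)
    then have "measure M (\<Union>N. D N) \<le> l" by (rule LIMSEQ_le_const2) (use that in auto)
    moreover have "measure M A \<le> measure M (\<Union>N. D N)"
      using sub D_sets by (intro M.finite_measure_mono) (auto simp: D_def)
    ultimately show ?thesis by linarith
  qed
  define K where "K = 2 / (sqrt (2 * pi) * (sqrt (real i * h) * \<sigma>s))"
  have K: "0 < K" using i h \<sigma> by (simp add: K_def)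
  have le_\<epsilon>: "measure M A \<le> K * (2 / real i * (sqrt (real i * h / 2) * sqrt (\<sigma>p\<^sup>2 + \<sigma>s\<^sup>2)) + \<epsilon>)"
    if \<epsilon>: "0 < \<epsilon>" for \<epsilon>
  proof (rule A_lim)
    fix N
    have "measure M (D N) \<le> bound N' \<epsilon>" if "N \<le> N'" for N'
    proof -
      have "measure M (D N) \<le> measure M (E N')"
        using that E_sets D_sets by (intro M.finite_measure_mono) (auto simp: D_def)
      then show ?thesis using E_le[OF \<epsilon>, of N'] by linarith
    qed
    then show "measure M (D N) \<le> K * (2 / real i * (sqrt (real i * h / 2) * sqrt (\<sigma>p\<^sup>2 + \<sigma>s\<^sup>2)) + \<epsilon>)"
      unfolding K_def by (intro LIMSEQ_le_const[OF limit[OF \<epsilon>]]) blast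
  qed
  have "measure M A \<le> K * (2 / real i * (sqrt (real i * h / 2) * sqrt (\<sigma>p\<^sup>2 + \<sigma>s\<^sup>2)))"
  proof (rule field_le_epsilon)
    fix e :: real assume "0 < e"
    then show "measure M A \<le> K * (2 / real i * (sqrt (real i * h / 2) * sqrt (\<sigma>p\<^sup>2 + \<sigma>s\<^sup>2))) + e"
      using le_\<epsilon>[of "e / K"] K by (simp add: distrib_left)
  qed
  \<comment> \<open>The length h cancels, in accordance with Brownian scaling; the 4 is the 2 of the
    survival bound times the 2 in m/n = 2/i.\<close>
  also have "\<dots> = (4 / sqrt (2 * pi) * sqrt ((1 + (\<sigma>p / \<sigma>s)\<^sup>2) / 2)) / real i"
  proof -
    have "sqrt (\<sigma>p\<^sup>2 + \<sigma>s\<^sup>2) = \<sigma>s * sqrt (1 + (\<sigma>p / \<sigma>s)\<^sup>2)"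
    proof -
      have "\<sigma>p\<^sup>2 + \<sigma>s\<^sup>2 = \<sigma>s\<^sup>2 * (1 + (\<sigma>p / \<sigma>s)\<^sup>2)" using \<sigma> by (simp add: field_simps)
      then show ?thesis using \<sigma> by (simp add: real_sqrt_mult)
    qed
    then show ?thesis using \<sigma> h i by (simp add: K_def real_sqrt_divide real_sqrt_mult field_simps)
  qed
  finally show ?thesis .
qed

text \<open>Each grid walk lies between 0 and the reflected path, so it also ends at 0. With n steps
  this has probability at most \<open>sqrt (2 * pi) / sqrt (real n)\<close>, and n is
  arbitrary.\<close>

lemma measure_end_value_zero:
  assumes noise: "driving_noise M \<sigma>s \<sigma>p 1 x P S"
    and \<sigma>: "0 < \<sigma>s" "0 < \<sigma>p" and x: "0 < x 1"
    and A: "A \<in> sets M" "\<And>\<omega>. \<omega> \<in> A \<Longrightarrow> B_plus x (\<lambda>y. P y \<omega>) (\<lambda>j y. S j y \<omega>) 1 1 0 = 0"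
  shows "measure M A = 0"
proof -
  interpret M: prob_space M using noise by (simp add: driving_noise_def brownian_motion_def)
  have le: "measure M A \<le> sqrt (2 * pi) / sqrt (real (Suc n))" for n
  proof -
    define \<delta> where "\<delta> = x 1 / real (Suc n)"
    have \<delta>: "0 < \<delta>" using x by (simp add: \<delta>_def)
    have x1: "x 1 = real (0 + Suc n) * \<delta>" by (simp add: \<delta>_def del: of_nat_Suc)
    have n: "0 < 0 + Suc n" by simp
    let ?\<xi> = "step_pair \<delta> 0 (Suc n) x P S"
    interpret G: gaussian_pair "distr M (borel \<Otimes>\<^sub>M borel) (?\<xi> 0)"
      "sqrt (\<sigma>p\<^sup>2 + \<sigma>s\<^sup>2) * sqrt \<delta>" "sqrt 2 * \<sigma>s * sqrt \<delta>"
      by (rule step_pair_gaussian[OF noise \<sigma> \<delta> n x1])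
    let ?E = "{\<omega> \<in> space M. reflected (\<lambda>i. fst (?\<xi> i \<omega>)) (0 + Suc n) = 0}"
    have rm: "(\<lambda>\<omega>. reflected (\<lambda>i. fst (?\<xi> i \<omega>)) (0 + Suc n)) \<in> borel_measurable M"
      by (rule borel_measurable_reflected, rule step_pair_measurable[OF noise \<sigma> \<delta> n x1])
    have E: "?E \<in> sets M" by (rule borel_measurable_eq[OF rm]) simp
    have "A \<subseteq> ?E"
    proof
      fix \<omega> assume \<omega>: "\<omega> \<in> A"
      then have sp: "\<omega> \<in> space M" using A(1) sets.sets_into_space by auto
      let ?B = "B_tilde x (\<lambda>y. P y \<omega>) (\<lambda>j y. S j y \<omega>) 1"
      have "continuous_on {- x 1..0} ?B"
        using driving_noise_paths[OF noise _ _ sp, of 1] x by simp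
      moreover have z: "- x 1 + real (0 + Suc n) * \<delta> = 0" using x1 by simp
      ultimately have "reflected (\<lambda>i. ?B (- x 1 + real (Suc i) * \<delta>) - ?B (- x 1 + real i * \<delta>)) (0 + Suc n)
          \<le> running_excess (- x 1) ?B (- x 1 + real (0 + Suc n) * \<delta>)"
        using \<delta> by (intro reflected_grid_le) auto
      also have "\<dots> = 0"
        using A(2)[OF \<omega>] unfolding z by (simp add: B_plus_last B_tilde_plus_eq)
      finally show "\<omega> \<in> ?E"
        using sp reflected_nonneg[of "\<lambda>i. fst (?\<xi> i \<omega>)" "0 + Suc n"] unfolding fst_step_pair by simp
    qed
    then have "emeasure M A \<le> emeasure M ?E" using E by (rule emeasure_mono)
    also have "\<dots> \<le> G.zero_probability (0 + Suc n) 0"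
      by (rule G.emeasure_reflected_eq_0_le[OF M.prob_space_axioms
          step_pair_indep[OF noise \<sigma> \<delta> n x1] step_pair_law[OF noise \<sigma> \<delta> n x1]])
    also have "\<dots> \<le> ennreal (sqrt (2 * pi) / sqrt (real (Suc n)))"
      using G.zero_probability_le[of "Suc n"] by simp
    finally show ?thesis by (simp add: M.emeasure_eq_measure)
  qed
  have "(\<lambda>n. sqrt (2 * pi) * sqrt (inverse (real (Suc n)))) \<longlonglongrightarrow> sqrt (2 * pi) * sqrt 0"
    by (intro tendsto_intros LIMSEQ_inverse_real_of_nat)
  then have "(\<lambda>n. sqrt (2 * pi) / sqrt (real (Suc n))) \<longlonglongrightarrow> 0"
    by (simp add: real_sqrt_inverse divide_inverse)
  then have "measure M A \<le> 0" using le by (intro LIMSEQ_le_const) auto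
  then show ?thesis using measure_nonneg[of M A] by linarith
qed

section \<open>Finite ranges of the process\<close>

text \<open>For arbitrary \<open>f\<close> the left side is either the right side or 0. The laws in
  \<open>C_vector_law\<close> can thus be used without proving the \<open>B_plus\<close> functional
  measurable.\<close>

lemma emeasure_distr_le:
  "emeasure (distr M N f) B \<le> emeasure M (f -` B \<inter> space M)"
  unfolding distr_def emeasure_measure_of_conv by auto

text \<open>The realization behind the law is only known to exist, so \<open>bound\<close> is
  assumed for every realization; it is applied to the preimage of \<open>B\<close>.\<close>

lemma C_process_pair_law:
  assumes C: "C_process \<rho> N C" and y: "0 \<le> y0" "y0 \<le> y1"
    and B: "B \<in> sets (\<Pi>\<^sub>M i\<in>{..1::nat}. borel)" and l: "0 \<le> l"
    and bound: "\<And>\<sigma>s \<sigma>p (M :: (nat option \<Rightarrow> real \<Rightarrow> real) measure) x P S A.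
      0 < \<sigma>s \<Longrightarrow> 0 < \<sigma>p \<Longrightarrow> \<sigma>s / \<sigma>p = \<rho> \<Longrightarrow> driving_noise M \<sigma>s \<sigma>p 1 x P S \<Longrightarrow> x 0 = y0 \<Longrightarrow> x 1 = y1 \<Longrightarrow>
      A \<in> sets M \<Longrightarrow> (\<And>\<omega>. \<omega> \<in> A \<Longrightarrow>
        (\<lambda>i\<in>{..1}. 1 / \<sigma>p * B_plus x (\<lambda>y. P y \<omega>) (\<lambda>j y. S j y \<omega>) 1 i 0) \<in> B) \<Longrightarrow> measure M A \<le> l"
  shows "emeasure N {\<omega> \<in> space N. (\<lambda>i\<in>{..1}. C (if i = 0 then y0 else y1) \<omega>) \<in> B} \<le> ennreal l"
proof -
  define x where "x i = (if i = 0 then y0 else y1)" for i :: nat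
  have meas: "\<And>t. 0 \<le> t \<Longrightarrow> C t \<in> borel_measurable N" using C by (simp add: C_process_def)
  have "C_vector_law \<rho> 1 x (distr N (\<Pi>\<^sub>M i\<in>{..1}. borel) (\<lambda>\<omega>. \<lambda>i\<in>{..1}. C (x i) \<omega>))"
  proof -
    have "0 \<le> x 0 \<and> (\<forall>i<1. x i \<le> x (Suc i))" using y by (simp add: x_def)
    then show ?thesis using C unfolding C_process_def by blast
  qed
  then obtain \<sigma>s \<sigma>p and M :: "(nat option \<Rightarrow> real \<Rightarrow> real) measure" and P S
    where \<sigma>: "0 < \<sigma>s" "\<sigma>s \<le> \<sigma>p" "\<sigma>s / \<sigma>p = \<rho>"
    and noise: "driving_noise M \<sigma>s \<sigma>p 1 x P S"
    and law: "distr N (\<Pi>\<^sub>M i\<in>{..1}. borel) (\<lambda>\<omega>. \<lambda>i\<in>{..1}. C (x i) \<omega>) = distr M (\<Pi>\<^sub>M i\<in>{..1}. borel)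
        (\<lambda>\<omega>. \<lambda>i\<in>{..1}. 1 / \<sigma>p * B_plus x (\<lambda>y. P y \<omega>) (\<lambda>j y. S j y \<omega>) 1 i 0)"
    unfolding C_vector_law_def by blast
  interpret M: prob_space M using noise by (simp add: driving_noise_def brownian_motion_def)
  let ?g = "\<lambda>\<omega>. \<lambda>i\<in>{..1::nat}. C (x i) \<omega>"
  let ?f = "\<lambda>\<omega>. \<lambda>i\<in>{..1::nat}. 1 / \<sigma>p * B_plus x (\<lambda>y. P y \<omega>) (\<lambda>j y. S j y \<omega>) 1 i 0"
  define A where "A = ?f -` B \<inter> space M"
  have "?g \<in> N \<rightarrow>\<^sub>M (\<Pi>\<^sub>M i\<in>{..1}. borel)"
    by (intro measurable_restrict meas) (use y in \<open>auto simp: x_def\<close>)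
  then have "emeasure N (?g -` B \<inter> space N) = emeasure (distr N (\<Pi>\<^sub>M i\<in>{..1}. borel) ?g) B"
    using B by (simp only: emeasure_distr)
  also have "\<dots> \<le> emeasure M A" unfolding law A_def by (rule emeasure_distr_le)
  also have "\<dots> \<le> ennreal l"
  proof (cases "A \<in> sets M")
    case True
    have "measure M A \<le> l"
    proof (rule bound[OF \<sigma>(1) _ \<sigma>(3) noise _ _ True])
      fix \<omega> assume "\<omega> \<in> A"
      then show "?f \<omega> \<in> B" by (simp only: A_def Int_iff vimage_eq)
    qed (use \<sigma> in \<open>auto simp: x_def\<close>)
    then show ?thesis by (simp add: M.emeasure_eq_measure l)
  next
    case False
    from emeasure_notin_sets[OF this] show ?thesis by (simp only: zero_le)
  qed
  also have "?g -` B \<inter> space N = {\<omega> \<in> space N. (\<lambda>i\<in>{..1}. C (if i = 0 then y0 else y1) \<omega>) \<in> B}"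
    by (auto simp: x_def[abs_def])
  finally show ?thesis .
qed

lemma C_process_change_le:
  assumes C: "C_process \<rho> N C" and \<rho>: "0 < \<rho>" and h: "0 < h" and i: "0 < i"
  shows "emeasure N {\<omega> \<in> space N. C (real i * h) \<omega> \<noteq> C (real (Suc i) * h) \<omega>}
    \<le> ennreal (4 / sqrt (2 * pi) * sqrt ((1 + (1 / \<rho>)\<^sup>2) / 2) / real i)"
proof -
  let ?\<Pi> = "\<Pi>\<^sub>M i\<in>{..1::nat}. (borel :: real measure)"
  let ?B = "{f \<in> space ?\<Pi>. f 0 \<noteq> f 1}"
  have c: "(\<lambda>f. f 0) \<in> borel_measurable ?\<Pi>" "(\<lambda>f. f 1) \<in> borel_measurable ?\<Pi>"
    by (rule measurable_component_singleton; simp)+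
  have "emeasure N {\<omega> \<in> space N. (\<lambda>j\<in>{..1::nat}. C (if j = 0 then real i * h else real (Suc i) * h) \<omega>) \<in> ?B}
    \<le> ennreal (4 / sqrt (2 * pi) * sqrt ((1 + (1 / \<rho>)\<^sup>2) / 2) / real i)"
  proof (rule C_process_pair_law[OF C])
    show "?B \<in> sets ?\<Pi>" by (rule borel_measurable_neq[OF c])
    fix \<sigma>s \<sigma>p :: real and M :: "(nat option \<Rightarrow> real \<Rightarrow> real) measure" and x P S A
    assume *: "0 < \<sigma>s" "0 < \<sigma>p" "\<sigma>s / \<sigma>p = \<rho>" "driving_noise M \<sigma>s \<sigma>p 1 x P S"
      "x 0 = real i * h" "x 1 = real (Suc i) * h" "A \<in> sets M"
      and A: "\<And>\<omega>. \<omega> \<in> A \<Longrightarrow> (\<lambda>i\<in>{..1}. 1 / \<sigma>p * B_plus x (\<lambda>y. P y \<omega>) (\<lambda>j y. S j y \<omega>) 1 i 0) \<in> ?B"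
    have "measure M A \<le> 4 / sqrt (2 * pi) * sqrt ((1 + (\<sigma>p / \<sigma>s)\<^sup>2) / 2) / real i"
    proof (rule measure_end_values_differ_le[OF *(4,1,2) h i *(5,6,7)])
      fix \<omega> assume "\<omega> \<in> A"
      from A[OF this] show "B_plus x (\<lambda>y. P y \<omega>) (\<lambda>j y. S j y \<omega>) 1 0 0 \<noteq> B_plus x (\<lambda>y. P y \<omega>) (\<lambda>j y. S j y \<omega>) 1 1 0"
        by auto
    qed
    moreover have "\<sigma>p / \<sigma>s = 1 / \<rho>" using *(1-3) by (auto simp: field_simps)
    ultimately show "measure M A \<le> 4 / sqrt (2 * pi) * sqrt ((1 + (1 / \<rho>)\<^sup>2) / 2) / real i" by simp
  qed (use h in \<open>auto intro!: mult_right_mono divide_nonneg_nonneg mult_nonneg_nonneg\<close>)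
  also have "{\<omega> \<in> space N. (\<lambda>j\<in>{..1::nat}. C (if j = 0 then real i * h else real (Suc i) * h) \<omega>) \<in> ?B}
      = {\<omega> \<in> space N. C (real i * h) \<omega> \<noteq> C (real (Suc i) * h) \<omega>}"
    by (auto simp: space_PiM)
  finally show ?thesis .
qed

text \<open>A single value is treated by the two-point law at coinciding points y, y, reading off
  index 1: there \<open>B_plus\<close> is the reflected path itself, without coalescence.\<close>

lemma C_process_value_null:
  assumes C: "C_process \<rho> N C" and y: "0 \<le> y" and V: "V \<in> sets borel"
    and null: "\<And>\<sigma>s \<sigma>p (M :: (nat option \<Rightarrow> real \<Rightarrow> real) measure) x P S A.
      0 < \<sigma>s \<Longrightarrow> 0 < \<sigma>p \<Longrightarrow> driving_noise M \<sigma>s \<sigma>p 1 x P S \<Longrightarrow> x 1 = y \<Longrightarrow>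
      A \<in> sets M \<Longrightarrow> (\<And>\<omega>. \<omega> \<in> A \<Longrightarrow>
        1 / \<sigma>p * B_plus x (\<lambda>y. P y \<omega>) (\<lambda>j y. S j y \<omega>) 1 1 0 \<in> V) \<Longrightarrow> measure M A \<le> 0"
  shows "AE \<omega> in N. C y \<omega> \<notin> V"
proof -
  let ?\<Pi> = "\<Pi>\<^sub>M i\<in>{..1::nat}. (borel :: real measure)"
  let ?B = "{f \<in> space ?\<Pi>. f 1 \<in> V}"
  have c: "(\<lambda>f. f 1) \<in> borel_measurable ?\<Pi>"
    by (rule measurable_component_singleton) simp
  have "emeasure N {\<omega> \<in> space N. (\<lambda>j\<in>{..1::nat}. C (if j = 0 then y else y) \<omega>) \<in> ?B} \<le> ennreal 0"
  proof (rule C_process_pair_law[OF C y])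
    show "?B \<in> sets ?\<Pi>" using measurable_sets[OF c V] by (simp add: vimage_def Int_def conj_commute)
    fix \<sigma>s \<sigma>p :: real and M :: "(nat option \<Rightarrow> real \<Rightarrow> real) measure" and x P S A
    assume *: "0 < \<sigma>s" "0 < \<sigma>p" "driving_noise M \<sigma>s \<sigma>p 1 x P S" "x 1 = y" "A \<in> sets M"
      and A: "\<And>\<omega>. \<omega> \<in> A \<Longrightarrow> (\<lambda>i\<in>{..1}. 1 / \<sigma>p * B_plus x (\<lambda>y. P y \<omega>) (\<lambda>j y. S j y \<omega>) 1 i 0) \<in> ?B"
    show "measure M A \<le> 0"
    proof (rule null[OF *])
      fix \<omega> assume "\<omega> \<in> A"
      from A[OF this] show "1 / \<sigma>p * B_plus x (\<lambda>y. P y \<omega>) (\<lambda>j y. S j y \<omega>) 1 1 0 \<in> V" by simp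
    qed
  qed auto
  also have "{\<omega> \<in> space N. (\<lambda>j\<in>{..1::nat}. C (if j = 0 then y else y) \<omega>) \<in> ?B} = {\<omega> \<in> space N. C y \<omega> \<in> V}"
    by (auto simp: space_PiM)
  finally have "emeasure N {\<omega> \<in> space N. C y \<omega> \<in> V} = 0" by simp
  moreover have "C y \<in> borel_measurable N" using C y by (simp add: C_process_def)
  from measurable_sets[OF this V] have "{\<omega> \<in> space N. C y \<omega> \<in> V} \<in> sets N"
    by (simp add: vimage_def Int_def conj_commute)
  ultimately show ?thesis by (intro AE_I[where N="{\<omega> \<in> space N. C y \<omega> \<in> V}"]) auto
qed

lemma C_process_zero:
  assumes "C_process \<rho> N C"
  shows "AE \<omega> in N. C 0 \<omega> = 0"
proof -
  have "AE \<omega> in N. C 0 \<omega> \<notin> - {0}"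
  proof (rule C_process_value_null[OF assms])
    fix \<sigma>s \<sigma>p :: real and M :: "(nat option \<Rightarrow> real \<Rightarrow> real) measure" and x P S A
    assume x: "x 1 = 0" and "A \<in> sets M" and A: "\<And>\<omega>. \<omega> \<in> A \<Longrightarrow> 1 / \<sigma>p * B_plus x (\<lambda>y. P y \<omega>) (\<lambda>j y. S j y \<omega>) 1 1 0 \<in> - {0}"
    have "B_plus x (\<lambda>y. P y \<omega>) (\<lambda>j y. S j y \<omega>) 1 1 0 = 0" for \<omega>
      using x by (simp add: B_plus_last B_tilde_plus_def)
    then have "A = {}" using A by force
    then show "measure M A \<le> 0" by simp
  qed auto
  then show ?thesis by simp
qed

lemma C_process_nonzero:
  assumes "C_process \<rho> N C" "0 < y"
  shows "AE \<omega> in N. C y \<omega> \<noteq> 0"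
proof -
  have "AE \<omega> in N. C y \<omega> \<notin> {0}"
  proof (rule C_process_value_null[OF assms(1)])
    fix \<sigma>s \<sigma>p :: real and M :: "(nat option \<Rightarrow> real \<Rightarrow> real) measure" and x P S A
    assume *: "0 < \<sigma>s" "0 < \<sigma>p" "driving_noise M \<sigma>s \<sigma>p 1 x P S" "x 1 = y" "A \<in> sets M"
      and A: "\<And>\<omega>. \<omega> \<in> A \<Longrightarrow> 1 / \<sigma>p * B_plus x (\<lambda>y. P y \<omega>) (\<lambda>j y. S j y \<omega>) 1 1 0 \<in> {0}"
    have "measure M A = 0"
    proof (rule measure_end_value_zero[OF *(3,1,2) _ *(5)])
      show "0 < x 1" using assms(2) *(4) by simp
      fix \<omega> assume "\<omega> \<in> A"
      from A[OF this] show "B_plus x (\<lambda>y. P y \<omega>) (\<lambda>j y. S j y \<omega>) 1 1 0 = 0" using *(2) by simp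
    qed
    then show "measure M A \<le> 0" by simp
  qed (use assms(2) in auto)
  then show ?thesis by simp
qed

section \<open>From counts on dyadic grids to finite ranges\<close>

lemma card_image_le_changes:
  assumes "p \<le> q"
  shows "card (g ` {p..q}) \<le> Suc (\<Sum>i\<in>{p..<q}. of_bool (g i \<noteq> g (Suc i)))"
  using assms
proof (induction q rule: dec_induct)
  case (step q)
  have eq: "g ` {p..Suc q} = insert (g (Suc q)) (g ` {p..q})"
    using step.hyps by (auto simp: atLeastAtMostSuc_conv)
  show ?case
  proof (cases "g q = g (Suc q)")
    case True
    then have "g (Suc q) \<in> g ` {p..q}" using step.hyps by (metis atLeastAtMost_iff image_eqI order_refl)
    then show ?thesis using step True unfolding eq by (simp add: insert_absorb)
  next
    case False
    then show ?thesis using step card_insert_le_m1[of "Suc (Suc 0)"] unfolding eq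
      by (auto simp: card_insert_if)
  qed
qed simp

text \<open>The points run from 2^-Q to 2^Q with spacing 2^-(Q+s). All indices are at least 2^s,
  which bounds the change probabilities K/i by K/2^s.\<close>

definition dyadic_grid :: "nat \<Rightarrow> nat \<Rightarrow> real set" where
  "dyadic_grid Q s = (\<lambda>i. real i * (1 / 2 ^ (Q + s))) ` {2 ^ s..2 ^ (s + 2 * Q)}"

lemma dyadic_grid_mono:
  assumes "s \<le> t" shows "dyadic_grid Q s \<subseteq> dyadic_grid Q t"
proof -
  have "dyadic_grid Q s \<subseteq> dyadic_grid Q (Suc s)" for s
  proof
    fix x assume "x \<in> dyadic_grid Q s"
    then obtain i where i: "x = real i * (1 / 2 ^ (Q + s))" "2 ^ s \<le> i" "i \<le> 2 ^ (s + 2 * Q)"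
      by (auto simp: dyadic_grid_def)
    then have "x = real (2 * i) * (1 / 2 ^ (Q + Suc s))" "2 ^ Suc s \<le> 2 * i" "2 * i \<le> 2 ^ (Suc s + 2 * Q)"
      by simp_all
    then show "x \<in> dyadic_grid Q (Suc s)" unfolding dyadic_grid_def by (intro image_eqI[of _ _ "2 * i"]) auto
  qed
  then show ?thesis using assms by (rule lift_Suc_mono_le)
qed

lemma finite_range_if_bounded_on_grids:
  fixes f :: "real \<Rightarrow> real"
  assumes rc: "\<And>x. 0 \<le> x \<Longrightarrow> (f \<longlongrightarrow> f x) (at_right x)"
    and freq: "\<exists>\<^sub>F s in sequentially. card (f ` dyadic_grid Q s) \<le> B"
  shows "finite (f ` {1 / 2 ^ Q..<2 ^ Q})"
proof -
  define D where "D = (\<Union>s. dyadic_grid Q s)"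
  have fin: "finite (dyadic_grid Q s)" for s by (simp add: dyadic_grid_def)
  have "finite (f ` D) \<and> card (f ` D) \<le> B"
  proof (rule finite_if_finite_subsets_card_bdd)
    fix F assume F: "F \<subseteq> f ` D" "finite F"
    then obtain X where X: "X \<subseteq> D" "finite X" "F = f ` X" by (meson finite_subset_image)
    have "\<exists>s0. X \<subseteq> dyadic_grid Q s0"
      using X(2,1)
    proof (induction X)
      case (insert x X)
      then obtain s t where "X \<subseteq> dyadic_grid Q s" "x \<in> dyadic_grid Q t" by (auto simp: D_def)
      then have "insert x X \<subseteq> dyadic_grid Q (max s t)"
        using dyadic_grid_mono[of s "max s t" Q] dyadic_grid_mono[of t "max s t" Q] by auto
      then show ?case by blast
    qed simp
    then obtain s0 where s0: "X \<subseteq> dyadic_grid Q s0" by blast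
    obtain s where s: "s0 \<le> s" "card (f ` dyadic_grid Q s) \<le> B"
      using freq unfolding frequently_sequentially by blast
    have "F \<subseteq> f ` dyadic_grid Q s" using X(3) s0 dyadic_grid_mono[OF s(1), of Q] by auto
    then have "card F \<le> card (f ` dyadic_grid Q s)" using fin by (intro card_mono) auto
    then show "card F \<le> B" using s(2) by simp
  qed
  then have finD: "finite (f ` D)" ..
  have "f ` {1 / 2 ^ Q..<2 ^ Q} \<subseteq> f ` D"
  proof
    fix v assume "v \<in> f ` {1 / 2 ^ Q..<2 ^ Q}"
    then obtain x where x: "1 / 2 ^ Q \<le> x" "x < 2 ^ Q" and v: "v = f x" by auto
    have x0: "0 \<le> x" using x(1) by (rule order_trans[rotated]) simp
    \<comment> \<open>The \<open>Suc\<close> makes \<open>y s\<close> strictly larger than x, as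
      convergence along \<open>at_right x\<close> requires.\<close>
    define k where "k s = Suc (nat \<lfloor>x * 2 ^ (Q + s)\<rfloor>)" for s
    define y where "y s = real (k s) * (1 / 2 ^ (Q + s))" for s
    have k: "real (k s) \<le> x * 2 ^ (Q + s) + 1" "x * 2 ^ (Q + s) < real (k s)" for s
      using x0 by (simp_all add: k_def) linarith+
    have y: "x < y s" "y s \<le> x + (1 / 2) ^ s" for s
    proof -
      show "x < y s" using k(2)[of s] by (simp add: y_def field_simps)
      have "y s \<le> x + 1 / 2 ^ (Q + s)" using k(1)[of s] by (simp add: y_def field_simps)
      also have "1 / 2 ^ (Q + s) \<le> (1 / 2 :: real) ^ s" by (simp add: power_add power_one_over field_simps)
      finally show "y s \<le> x + (1 / 2) ^ s" by simp
    qed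
    have yD: "y s \<in> D" for s
    proof -
      have "2 ^ s \<le> x * 2 ^ (Q + s)" using x(1) by (simp add: power_add field_simps)
      then have "real (2 ^ s) < real (k s)" using k(2)[of s] unfolding of_nat_power of_nat_numeral by linarith
      moreover have "x * 2 ^ (Q + s) < 2 ^ (s + 2 * Q)"
      proof -
        have "x * 2 ^ (Q + s) < 2 ^ Q * 2 ^ (Q + s)" using x(2) by (intro mult_strict_right_mono) auto
        also have "2 ^ Q * 2 ^ (Q + s) = (2 :: real) ^ (s + 2 * Q)" by (simp add: mult_2 ac_simps flip: power_add)
        finally show ?thesis .
      qed
      then have "\<lfloor>x * 2 ^ (Q + s)\<rfloor> < 2 ^ (s + 2 * Q)" by (simp add: floor_less_iff)
      then have "k s \<le> 2 ^ (s + 2 * Q)" using x0 by (simp add: k_def Suc_le_eq nat_less_iff)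
      ultimately have "k s \<in> {2 ^ s..2 ^ (s + 2 * Q)}" by (simp only: of_nat_less_iff atLeastAtMost_iff less_imp_le)
      then have "y s \<in> dyadic_grid Q s" unfolding dyadic_grid_def y_def by (rule imageI)
      then show ?thesis by (auto simp: D_def)
    qed
    have "(\<lambda>s. x + (1 / 2) ^ s) \<longlonglongrightarrow> x + 0" by (intro tendsto_intros LIMSEQ_power_zero) auto
    then have "(\<lambda>s. x + (1 / 2) ^ s) \<longlonglongrightarrow> x" by simp
    then have "y \<longlonglongrightarrow> x"
      by (rule real_tendsto_sandwich[rotated 3, rotated -1, OF tendsto_const]) (use y in \<open>auto intro!: always_eventually less_imp_le\<close>)
    then have "filterlim y (at_right x) sequentially"
      using y(1) by (intro filterlim_at_withinI) (auto intro!: always_eventually)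
    with rc[OF x0] have lim: "(\<lambda>s. f (y s)) \<longlonglongrightarrow> f x" by (rule filterlim_compose)
    have "closed (f ` D)" using finD by (rule finite_imp_closed)
    then show "v \<in> f ` D" unfolding v by (rule closed_sequentially[OF _ _ lim]) (rule imageI[OF yD])
  qed
  then show ?thesis using finD finite_subset by blast
qed

text \<open>By Fatou's lemma the lower limit is integrable, hence almost surely finite; a finite
  lower limit bounds infinitely many terms.\<close>

lemma AE_frequently_bounded:
  fixes u :: "nat \<Rightarrow> 'a \<Rightarrow> nat"
  assumes meas: "\<And>s. (\<lambda>\<omega>. of_nat (u s \<omega>) :: ennreal) \<in> borel_measurable M"
    and le: "\<And>s. (\<integral>\<^sup>+\<omega>. of_nat (u s \<omega>) \<partial>M) \<le> ennreal K"
  shows "AE \<omega> in M. \<exists>B. \<exists>\<^sub>F s in sequentially. u s \<omega> \<le> B"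
proof -
  have "(\<integral>\<^sup>+\<omega>. liminf (\<lambda>s. of_nat (u s \<omega>)) \<partial>M) \<le> liminf (\<lambda>s. \<integral>\<^sup>+\<omega>. of_nat (u s \<omega>) \<partial>M)"
    by (rule nn_integral_liminf[OF meas])
  also have "\<dots> \<le> limsup (\<lambda>s. \<integral>\<^sup>+\<omega>. of_nat (u s \<omega>) \<partial>M)" by (rule Liminf_le_Limsup) simp
  also have "\<dots> \<le> ennreal K" by (rule Limsup_bounded) (simp add: le)
  finally have "(\<integral>\<^sup>+\<omega>. liminf (\<lambda>s. of_nat (u s \<omega>)) \<partial>M) \<noteq> \<infinity>"
    using ennreal_less_top[of K] by (auto simp: top_unique)
  then have "AE \<omega> in M. liminf (\<lambda>s. of_nat (u s \<omega>) :: ennreal) \<noteq> \<infinity>"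
    by (intro nn_integral_PInf_AE borel_measurable_liminf meas)
  then show ?thesis
  proof eventually_elim
    case (elim \<omega>)
    then have "liminf (\<lambda>s. of_nat (u s \<omega>) :: ennreal) < top"
      by (simp only: infinity_ennreal_def less_top[symmetric] not_False_eq_True)
    then obtain B where B: "liminf (\<lambda>s. of_nat (u s \<omega>) :: ennreal) < of_nat B"
      using ennreal_Ex_less_of_nat by blast
    have "\<exists>\<^sub>F s in sequentially. u s \<omega> \<le> B"
    proof (rule ccontr)
      assume "\<not> (\<exists>\<^sub>F s in sequentially. u s \<omega> \<le> B)"
      then have "eventually (\<lambda>s. (of_nat B :: ennreal) \<le> of_nat (u s \<omega>)) sequentially"
        unfolding not_frequently by (rule eventually_mono) simp
      then have "of_nat B \<le> liminf (\<lambda>s. of_nat (u s \<omega>) :: ennreal)" by (rule Liminf_bounded)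
      then show False using B by (rule leD[THEN notE])
    qed
    then show ?case by blast
  qed
qed

lemma C_process_finite_range:
  assumes C: "C_process \<rho> N C" and \<rho>: "0 < \<rho>"
  shows "AE \<omega> in N. finite ((\<lambda>x. C x \<omega>) ` {1 / 2 ^ Q..<2 ^ Q})"
proof -
  define K where "K = 4 / sqrt (2 * pi) * sqrt ((1 + (1 / \<rho>)\<^sup>2) / 2)"
  have K: "0 \<le> K" by (simp add: K_def)
  have meas: "\<And>t. 0 \<le> t \<Longrightarrow> C t \<in> borel_measurable N" using C by (simp add: C_process_def)
  define g where "g s \<omega> i = C (real i * (1 / 2 ^ (Q + s))) \<omega>" for s \<omega> i
  define u where "u s \<omega> = (\<Sum>i\<in>{2 ^ s..<2 ^ (s + 2 * Q)}. of_bool (g s \<omega> i \<noteq> g s \<omega> (Suc i)) :: nat)" for s \<omega>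
  define Z where "Z s i = {\<omega> \<in> space N. g s \<omega> i \<noteq> g s \<omega> (Suc i)}" for s i
  have Z: "Z s i \<in> sets N" for s i
    unfolding Z_def g_def by (rule borel_measurable_neq[OF meas meas]) simp_all
  have u_eq: "(of_nat (u s \<omega>) :: ennreal) = (\<Sum>i\<in>{2 ^ s..<2 ^ (s + 2 * Q)}. indicator (Z s i) \<omega>)"
    if "\<omega> \<in> space N" for s \<omega>
    unfolding u_def of_nat_sum
  proof (rule sum.cong[OF refl])
    fix i
    show "of_nat (of_bool (g s \<omega> i \<noteq> g s \<omega> (Suc i))) = (indicator (Z s i) \<omega> :: ennreal)"
      using that by (cases "g s \<omega> i = g s \<omega> (Suc i)") (simp_all add: Z_def)
  qed
  have "AE \<omega> in N. \<exists>B. \<exists>\<^sub>F s in sequentially. u s \<omega> \<le> B"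
  proof (rule AE_frequently_bounded)
    fix s
    show "(\<lambda>\<omega>. of_nat (u s \<omega>) :: ennreal) \<in> borel_measurable N"
      by (rule measurable_cong[OF u_eq, THEN iffD2], assumption, rule borel_measurable_sum)
        (rule borel_measurable_indicator[OF Z])
    have "(\<integral>\<^sup>+\<omega>. of_nat (u s \<omega>) \<partial>N) = (\<integral>\<^sup>+\<omega>. (\<Sum>i\<in>{2 ^ s..<2 ^ (s + 2 * Q)}. indicator (Z s i) \<omega>) \<partial>N)"
      by (intro nn_integral_cong u_eq)
    also have "\<dots> = (\<Sum>i\<in>{2 ^ s..<2 ^ (s + 2 * Q)}. emeasure N (Z s i))"
      by (simp only: nn_integral_sum borel_measurable_indicator Z nn_integral_indicator)
    also have "\<dots> \<le> (\<Sum>i\<in>{2 ^ s..<2 ^ (s + 2 * Q) :: nat}. ennreal (K / 2 ^ s))"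
    proof (rule sum_mono)
      fix i :: nat assume i: "i \<in> {2 ^ s..<2 ^ (s + 2 * Q)}"
      then have i0: "0 < i" using less_le_trans[of 0 "2 ^ s" i] by simp
      have "2 ^ s \<le> i" using i by simp
      then have ri: "2 ^ s \<le> real i" using of_nat_mono[of "2 ^ s" i, where 'a=real] by simp
      have "emeasure N (Z s i) \<le> ennreal (K / real i)"
        unfolding Z_def g_def K_def by (rule C_process_change_le[OF C \<rho> _ i0]) simp
      also have "\<dots> \<le> ennreal (K / 2 ^ s)"
        using ri K i0 by (intro ennreal_leI divide_left_mono mult_pos_pos) auto
      finally show "emeasure N (Z s i) \<le> ennreal (K / 2 ^ s)" .
    qed
    \<comment> \<open>Dropping the lower index limit leaves 2^(s+2Q) terms K/2^s, whose sum K 4^Q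
      does not depend on s.\<close>
    also have "\<dots> \<le> (\<Sum>i\<in>{..<2 ^ (s + 2 * Q) :: nat}. ennreal (K / 2 ^ s))"
      by (rule sum_mono2) auto
    also have "\<dots> = ennreal (\<Sum>i\<in>{..<2 ^ (s + 2 * Q)::nat}. K / 2 ^ s)"
      using K by (intro sum_ennreal) auto
    also have "(\<Sum>i\<in>{..<2 ^ (s + 2 * Q)::nat}. K / 2 ^ s) = K * 2 ^ (2 * Q)"
      by (simp add: power_add)
    finally show "(\<integral>\<^sup>+\<omega>. of_nat (u s \<omega>) \<partial>N) \<le> ennreal (K * 2 ^ (2 * Q))" .
  qed
  moreover have "AE \<omega> in N. cadlag (\<lambda>x. C x \<omega>)" using C by (auto simp: C_process_def)
  ultimately show ?thesis
  proof eventually_elim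
    case (elim \<omega>)
    then obtain B where B: "\<exists>\<^sub>F s in sequentially. u s \<omega> \<le> B" by blast
    show ?case
    proof (rule finite_range_if_bounded_on_grids)
      show "\<exists>\<^sub>F s in sequentially. card ((\<lambda>x. C x \<omega>) ` dyadic_grid Q s) \<le> Suc B"
        using B
      proof (rule frequently_elim1)
        fix s assume "u s \<omega> \<le> B"
        moreover have "(\<lambda>x. C x \<omega>) ` dyadic_grid Q s = g s \<omega> ` {2 ^ s..2 ^ (s + 2 * Q)}"
          by (simp add: dyadic_grid_def g_def image_image)
        moreover have "card (g s \<omega> ` {2 ^ s..2 ^ (s + 2 * Q)}) \<le> Suc (u s \<omega>)"
          unfolding u_def by (rule card_image_le_changes) (simp add: power_increasing)
        ultimately show "card ((\<lambda>x. C x \<omega>) ` dyadic_grid Q s) \<le> Suc B" by simp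
      qed
    qed (use elim in \<open>auto simp: cadlag_def\<close>)
  qed
qed

theorem theorem2:
  fixes \<rho> :: real and N :: "'a measure" and C :: "real \<Rightarrow> 'a \<Rightarrow> real"
  assumes "0 < \<rho>" and "\<rho> \<le> 1"
    and "C_process \<rho> N C"
  shows "AE \<omega> in N.
    (\<forall>a b. 0 < a \<and> a < b \<longrightarrow> finite (jump_times (\<lambda>x. C x \<omega>) \<inter> {a..b})) \<and>
    (\<forall>I. is_interval I \<and> I \<subseteq> {0<..} \<and> I \<inter> jump_times (\<lambda>x. C x \<omega>) = {} \<longrightarrow>
         (\<lambda>x. C x \<omega>) constant_on I) \<and>
    (\<forall>U. open U \<and> 0 \<in> U \<longrightarrow> infinite (jump_times (\<lambda>x. C x \<omega>) \<inter> U))"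
proof -
  have "AE \<omega> in N. \<forall>Q. finite ((\<lambda>x. C x \<omega>) ` {1 / 2 ^ Q..<2 ^ Q})"
    unfolding AE_all_countable using C_process_finite_range[OF assms(3,1)] by blast
  moreover have "AE \<omega> in N. \<forall>n. C (1 / real (Suc n)) \<omega> \<noteq> 0"
    unfolding AE_all_countable using C_process_nonzero[OF assms(3)] by simp
  moreover have "AE \<omega> in N. mono_on {0..} (\<lambda>x. C x \<omega>) \<and> cadlag (\<lambda>x. C x \<omega>)"
    using assms(3) by (simp add: C_process_def)
  moreover note C_process_zero[OF assms(3)]
  ultimately show ?thesis
  proof eventually_elim
    case (elim \<omega>)
    show ?case
    proof (rule pure_jumps_if_finite_ranges)
      fix a b :: real assume a: "0 < a"
      obtain Q1 :: nat where Q1: "b < 2 ^ Q1" using real_arch_pow[of 2 b] by auto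
      obtain Q2 :: nat where Q2: "(1 / 2) ^ Q2 < a" using real_arch_pow_inv[of a "1 / 2"] a by auto
      define Q where "Q = max Q1 Q2"
      have "(2 :: real) ^ Q1 \<le> 2 ^ Q" by (rule power_increasing) (simp_all add: Q_def)
      then have "b < 2 ^ Q" using Q1 by linarith
      moreover have "1 / 2 ^ Q \<le> a"
      proof -
        have "(1 / 2 :: real) ^ Q \<le> (1 / 2) ^ Q2" by (rule power_decreasing) (simp_all add: Q_def)
        then show ?thesis using Q2 by (simp only: power_one_over)
      qed
      ultimately have "(\<lambda>x. C x \<omega>) ` {a..b} \<subseteq> (\<lambda>x. C x \<omega>) ` {1 / 2 ^ Q..<2 ^ Q}" by auto
      then show "finite ((\<lambda>x. C x \<omega>) ` {a..b})" using elim(1) finite_subset by blast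
    qed (use elim in auto)
  qed
qed

end
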